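(* Consider the networked multi-agent MDP with entropy-regularized objective $J$ described in the context. Suppose that $\gamma<0.8$, $\tau\ge 6\bar r\,\frac{4-3\gamma}{4-5\gamma}A_{\max}^2 e$, and $\sum_{j\in\mathcal N_i}C_{ij}<1/2$ for all $i\in\{1,\dots,n\}$. Let $\zeta^*\in\Delta_{\mathrm{policy}}$ be a policy maximizing $J$ over $\Delta_{\mathrm{policy}}$, and let $\kappa$ be a positive integer. Then there exists a $\kappa$-hop policy $\hat\zeta^{*,\kappa}$ such that $$J(\zeta^* )-J(\hat\zeta^{*,\kappa})\le \frac{\bar r(4-3\gamma)}{(1-\gamma)(4-5\gamma)}\,\frac{1}{(\kappa+1)^\mu},$$ where $$\mu=\min\Big\{\log_2\frac{\tau(4-5\gamma)}{6\bar r A_{\max}^2 e(4-3\gamma)},\ \log_2\frac{1}{2\sup_{i\in\mathcal N}\sum_{j\in\mathcal N_i}C_{ij}}\Big\}.$$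
   Context: Networked MDP. $\mathcal G=(\mathcal N,\mathcal E)$ is an undirected graph on $\mathcal N=\{1,\dots,n\}$ with graph distance $\mathrm{dist}$; $\mathcal N_i^\kappa=\{j:\mathrm{dist}(i,j)\le\kappa\}$ and $\mathcal N_i=\mathcal N_i^1$ (contains $i$). Agent $i$ has a finite state space $\mathcal S_i$ and a finite action space $\mathcal A_i$; $\mathcal S=\prod_i\mathcal S_i$, $\mathcal A=\prod_i\mathcal A_i$, $A_{\max}=\max_i|\mathcal A_i|$. For $\mathcal J\subseteq\mathcal N$, $s_{\mathcal J}=(s_j)_{j\in\mathcal J}$. Transitions factorize: $P(s'\mid s,a)=\prod_{i=1}^nP_i(s_i'\mid s_{\mathcal N_i},a_i)$. A joint policy is $\zeta=(\zeta_1,\dots,\zeta_n)$, where $\zeta_i(\cdot|s)$ is a probability distribution on $\mathcal A_i$ for each global state $s$, and $\zeta(a|s)=\prod_i\zeta_i(a_i|s)$; $\Delta_{\mathrm{policy}}$ is the set of joint policies. A joint policy is $\kappa$-hop if for each $i$ the distribution $\zeta_i(\cdot|s)$ depends on $s$ only through $s_{\mathcal N_i^\kappa}$. Rewards: $r_i(s_i,a_i)\in[0,\bar r]$, $r(s,a)=\frac1n\sum_ir_i(s_i,a_i)$. With discount factor $\gamma\in(0,1)$ and $\tau>0$, $V^\zeta(s)=\mathbb E\big[\sum_{t\ge0}\gamma^t\big(r(s(t),a(t))-\tau\log\zeta(a(t)|s(t))\big)\,\big|\,s(0)=s\big]$, where $a(t)\sim\zeta(\cdot|s(t))$ and $s(t+1)\sim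 P(\cdot|s(t),a(t))$. $J(\zeta)=\mathbb E_{s\sim\rho}V^\zeta(s)$ for a given initial distribution $\rho$ on $\mathcal S$. Interaction matrix $C\in\mathbb R^{n\times n}$ ($\mathrm{TV}$ = total variation distance): $C_{ij}=0$ if $j\notin\mathcal N_i$; for $j\in\mathcal N_i\setminus\{i\}$, $C_{ij}=\sup_{s_{\mathcal N_i\setminus j},a_i}\sup_{s_j,s_j'}\mathrm{TV}(P_i(\cdot|s_j,s_{\mathcal N_i\setminus j},a_i),P_i(\cdot|s_j',s_{\mathcal N_i\setminus j},a_i))$; and $C_{ii}=\sup_{s_{\mathcal N_i\setminus i}}\sup_{s_i,s_i',a_i,a_i'}\mathrm{TV}(P_i(\cdot|s_i,s_{\mathcal N_i\setminus i},a_i),P_i(\cdot|s_i',s_{\mathcal N_i\setminus i},a_i'))$. *)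

theory Defs
  imports
    "HOL-Probability.Probability"
    "Graph_Theory.Pair_Digraph"
    "Graph_Theory.Shortest_Path"
begin

text \<open>
  A joint state is an element of the dependent product \<open>\<Pi>\<^sub>E i\<in>{1..n}. S\<^sub>i\<close>, that is, an extensional
  function on the agents; joint actions and partial states \<open>s\<^sub>J\<close> are represented in the same way.
  The local transition kernel \<open>P\<^sub>i\<close> takes the partial state \<open>s\<^bsub>N\<^sub>i\<^esub>\<close> as its argument, which makes
  it depend on the neighbourhood of \<open>i\<close> only.
\<close>

record ('s, 'a) nmdp =
  num_agents :: nat
  network :: "nat pair_pre_digraph"
  states :: "nat \<Rightarrow> 's set"
  actions :: "nat \<Rightarrow> 'a set"
  kernel :: "nat \<Rightarrow> (nat \<Rightarrow> 's) \<Rightarrow> 'a \<Rightarrow> 's pmf"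
  local_reward :: "nat \<Rightarrow> 's \<Rightarrow> 'a \<Rightarrow> real"
  init :: "(nat \<Rightarrow> 's) pmf"

definition agents :: "('s, 'a) nmdp \<Rightarrow> nat set" where
  "agents M = {1..num_agents M}"

text \<open>Unit arc weights; the distance is \<open>\<infinity>\<close> between different connected components.\<close>

definition graph_dist :: "('s, 'a) nmdp \<Rightarrow> nat \<Rightarrow> nat \<Rightarrow> ereal" where
  "graph_dist M i j = wf_digraph.\<mu> (with_proj (network M)) (\<lambda>_. 1) i j"

definition nbhd :: "('s, 'a) nmdp \<Rightarrow> nat \<Rightarrow> nat \<Rightarrow> nat set" where
  "nbhd M \<kappa> i = {j \<in> agents M. graph_dist M i j \<le> ereal (real \<kappa>)}"

definition partial_states :: "('s, 'a) nmdp \<Rightarrow> nat set \<Rightarrow> (nat \<Rightarrow> 's) set" where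
  "partial_states M J = (\<Pi>\<^sub>E i\<in>J. states M i)"

definition joint_states :: "('s, 'a) nmdp \<Rightarrow> (nat \<Rightarrow> 's) set" where
  "joint_states M = partial_states M (agents M)"

locale networked_mdp =
  fixes M :: "('s, 'a) nmdp" and rbar :: real
  assumes agents_nonempty: "num_agents M \<ge> 1"
    and network_graph: "pair_graph (network M)"
    and network_verts: "pverts (network M) = agents M"
    and states_finite: "i \<in> agents M \<Longrightarrow> finite (states M i)"
    and states_nonempty: "i \<in> agents M \<Longrightarrow> states M i \<noteq> {}"
    and actions_finite: "i \<in> agents M \<Longrightarrow> finite (actions M i)"
    and actions_nonempty: "i \<in> agents M \<Longrightarrow> actions M i \<noteq> {}"
    and kernel_states: "i \<in> agents M \<Longrightarrow> u \<in> partial_states M (nbhd M 1 i) \<Longrightarrow> b \<in> actions M i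
          \<Longrightarrow> set_pmf (kernel M i u b) \<subseteq> states M i"
    and reward_bounds: "i \<in> agents M \<Longrightarrow> x \<in> states M i \<Longrightarrow> b \<in> actions M i
          \<Longrightarrow> local_reward M i x b \<in> {0..rbar}"
    and init_states: "set_pmf (init M) \<subseteq> joint_states M"

definition max_actions :: "('s, 'a) nmdp \<Rightarrow> nat" where
  "max_actions M = Max ((\<lambda>i. card (actions M i)) ` agents M)"

definition transition :: "('s, 'a) nmdp \<Rightarrow> (nat \<Rightarrow> 's) \<Rightarrow> (nat \<Rightarrow> 'a) \<Rightarrow> (nat \<Rightarrow> 's) pmf" where
  "transition M s a =
     Pi_pmf (agents M) undefined (\<lambda>i. kernel M i (restrict s (nbhd M 1 i)) (a i))"

definition reward :: "('s, 'a) nmdp \<Rightarrow> (nat \<Rightarrow> 's) \<Rightarrow> (nat \<Rightarrow> 'a) \<Rightarrow> real" where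
  "reward M s a = (1 / real (num_agents M)) * (\<Sum>i\<in>agents M. local_reward M i (s i) (a i))"


type_synonym ('s, 'a) joint_policy = "nat \<Rightarrow> (nat \<Rightarrow> 's) \<Rightarrow> 'a pmf"

definition policies :: "('s, 'a) nmdp \<Rightarrow> ('s, 'a) joint_policy set" where
  "policies M = {\<zeta>. \<forall>i\<in>agents M. \<forall>s\<in>joint_states M. set_pmf (\<zeta> i s) \<subseteq> actions M i}"

definition khop_policies :: "('s, 'a) nmdp \<Rightarrow> nat \<Rightarrow> ('s, 'a) joint_policy set" where
  "khop_policies M \<kappa> = {\<zeta> \<in> policies M.
     \<forall>i\<in>agents M. \<forall>s\<in>joint_states M. \<forall>s'\<in>joint_states M.
       restrict s (nbhd M \<kappa> i) = restrict s' (nbhd M \<kappa> i) \<longrightarrow> \<zeta> i s = \<zeta> i s'}"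

definition joint_action_pmf ::
    "('s, 'a) nmdp \<Rightarrow> ('s, 'a) joint_policy \<Rightarrow> (nat \<Rightarrow> 's) \<Rightarrow> (nat \<Rightarrow> 'a) pmf" where
  "joint_action_pmf M \<zeta> s = Pi_pmf (agents M) undefined (\<lambda>i. \<zeta> i s)"

text \<open>
  The law of the trajectory \<open>(s(t), a(t))\<^sub>t\<close> started in \<open>s\<close>: the kernel \<open>step_kernel M \<zeta> s t\<close> maps the
  history before time \<open>t\<close> to the distribution of \<open>(s(t), a(t))\<close>, and the Ionescu-Tulcea theorem
  yields the measure on infinite trajectories.
\<close>

definition step_kernel :: "('s, 'a) nmdp \<Rightarrow> ('s, 'a) joint_policy \<Rightarrow> (nat \<Rightarrow> 's)
    \<Rightarrow> nat \<Rightarrow> (nat \<Rightarrow> (nat \<Rightarrow> 's) \<times> (nat \<Rightarrow> 'a)) \<Rightarrow> ((nat \<Rightarrow> 's) \<times> (nat \<Rightarrow> 'a)) measure" where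
  "step_kernel M \<zeta> s t \<omega> = measure_pmf (do {
     x \<leftarrow> (case t of 0 \<Rightarrow> return_pmf s | Suc u \<Rightarrow> transition M (fst (\<omega> u)) (snd (\<omega> u)));
     a \<leftarrow> joint_action_pmf M \<zeta> x;
     return_pmf (x, a)
   })"

lemma Ionescu_Tulcea_step_kernel:
  "Ionescu_Tulcea (step_kernel M \<zeta> s) (\<lambda>_. count_space UNIV)"
proof (rule Ionescu_Tulcea.intro)
  fix t
  show "step_kernel M \<zeta> s t \<in>
      measurable (PiM {0..<t} (\<lambda>_. count_space UNIV)) (subprob_algebra (count_space UNIV))"
  proof (cases t)
    case 0
    then show ?thesis
      by (auto simp: step_kernel_def[abs_def] intro!: measurable_const measure_pmf_in_subprob_algebra)
  next
    case (Suc u)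
    define k where "k = (\<lambda>z. measure_pmf (do {
       x \<leftarrow> transition M (fst z) (snd z); a \<leftarrow> joint_action_pmf M \<zeta> x; return_pmf (x, a)}))"
    have "(\<lambda>\<omega>. \<omega> u) \<in> measurable (PiM {0..<t} (\<lambda>_. count_space UNIV)) (count_space UNIV)"
      using Suc by (intro measurable_component_singleton) auto
    moreover have "k \<in> measurable (count_space UNIV) (subprob_algebra (count_space UNIV))"
      by (auto simp: k_def intro!: measure_pmf_in_subprob_algebra)
    ultimately have "(\<lambda>\<omega>. k (\<omega> u)) \<in>
        measurable (PiM {0..<t} (\<lambda>_. count_space UNIV)) (subprob_algebra (count_space UNIV))"
      by (rule measurable_compose)
    then show ?thesis
      using Suc by (simp add: k_def step_kernel_def[abs_def])
  qed
next
  fix t \<omega>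
  show "prob_space (step_kernel M \<zeta> s t \<omega>)"
    by (simp add: step_kernel_def prob_space_measure_pmf)
qed

definition trajectory :: "('s, 'a) nmdp \<Rightarrow> ('s, 'a) joint_policy \<Rightarrow> (nat \<Rightarrow> 's)
    \<Rightarrow> (nat \<Rightarrow> (nat \<Rightarrow> 's) \<times> (nat \<Rightarrow> 'a)) measure" where
  "trajectory M \<zeta> s =
     projective_family.lim UNIV
       (Ionescu_Tulcea.CI (step_kernel M \<zeta> s) (\<lambda>_. count_space UNIV)) (\<lambda>_. count_space UNIV)"

definition value_fun ::
    "('s, 'a) nmdp \<Rightarrow> real \<Rightarrow> real \<Rightarrow> ('s, 'a) joint_policy \<Rightarrow> (nat \<Rightarrow> 's) \<Rightarrow> real" where
  "value_fun M \<gamma> \<tau> \<zeta> s =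
     (\<integral>\<omega>. (\<Sum>t. \<gamma> ^ t * (reward M (fst (\<omega> t)) (snd (\<omega> t))
                          - \<tau> * ln (pmf (joint_action_pmf M \<zeta> (fst (\<omega> t))) (snd (\<omega> t)))))
        \<partial>trajectory M \<zeta> s)"

definition objective ::
    "('s, 'a) nmdp \<Rightarrow> real \<Rightarrow> real \<Rightarrow> ('s, 'a) joint_policy \<Rightarrow> real" where
  "objective M \<gamma> \<tau> \<zeta> = measure_pmf.expectation (init M) (value_fun M \<gamma> \<tau> \<zeta>)"


definition tv_dist :: "'b pmf \<Rightarrow> 'b pmf \<Rightarrow> real" where
  "tv_dist p q = (SUP B. \<bar>measure_pmf.prob p B - measure_pmf.prob q B\<bar>)"

text \<open>The updates \<open>u(j := x)\<close> and \<open>u(j := x')\<close> range over the pairs that agree off \<open>j\<close>.\<close>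

definition interaction :: "('s, 'a) nmdp \<Rightarrow> nat \<Rightarrow> nat \<Rightarrow> real" where
  "interaction M i j =
    (if j \<notin> nbhd M 1 i then 0
     else if j \<noteq> i then
       (SUP (u, x, x', b) \<in> partial_states M (nbhd M 1 i) \<times> states M j \<times> states M j \<times> actions M i.
          tv_dist (kernel M i (u(j := x)) b) (kernel M i (u(j := x')) b))
     else
       (SUP (u, x, x', b, b') \<in> partial_states M (nbhd M 1 i)
            \<times> states M i \<times> states M i \<times> actions M i \<times> actions M i.
          tv_dist (kernel M i (u(i := x)) b) (kernel M i (u(i := x')) b')))"


text \<open>
  The decay exponent contains \<open>log\<^sub>2 (a / b)\<close> with \<open>a > 0\<close> and \<open>b \<ge> 0\<close>, where \<open>b\<close> vanishes for zero
  rewards or zero interaction. The logarithm is then \<open>\<infinity>\<close> and, for \<open>x > 1\<close>, \<open>1 / x\<^sup>\<infinity> = 0\<close>.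
\<close>

definition log2_quotient :: "real \<Rightarrow> real \<Rightarrow> ereal" where
  "log2_quotient a b = (if b = 0 then \<infinity> else ereal (log 2 (a / b)))"

definition inverse_power :: "real \<Rightarrow> ereal \<Rightarrow> real" where
  "inverse_power x m = (if m = \<infinity> then 0 else 1 / x powr real_of_ereal m)"

end

theory Submission
  imports Defs "HOL-Real_Asymp.Real_Asymp"
begin

text \<open>
  Dynamic programming over product policies: \<open>V\<^sub>0 = 0\<close> and \<open>V\<^sub>m\<^sub>+\<^sub>1(s)\<close> is the maximum over product
  distributions \<open>p\<close> of \<open>E\<^sub>p Q\<^sub>m(s, \<cdot>) + \<tau> \<Sum>\<^sub>i H(p\<^sub>i)\<close>, where \<open>Q\<^sub>m = r + \<gamma> P V\<^sub>m\<close>. The maximizer solves the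
  mean field equations \<open>p\<^sub>i \<propto> exp (E\<^sub>p Q\<^sub>m(s, a\<^sub>i, \<cdot>) / \<tau>)\<close>.

  Along the iteration one controls how the increment of \<open>V\<^sub>m\<close> in the coordinate \<open>k\<close> depends on the state
  outside the ball of radius \<open>D\<close> about \<open>k\<close>: by at most \<open>N\<^sub>k \<eta>\<^sup>\<lceil>\<^sup>D\<^sup>/\<^sup>2\<^sup>\<rceil>\<close>, where \<open>\<eta> = 2\<^sup>-\<^sup>\<mu>\<close> and \<open>\<Sum>\<^sub>k N\<^sub>k\<close>
  stays bounded. The kernel step gains a factor \<open>\<eta>/2\<close> from the row sums of the interaction matrix. For the
  maximization step, the stability of the mean field equations makes \<open>p\<^sub>i\<close> react to a change at \<open>k\<close> by at
  most \<open>N\<^sub>k \<eta>\<^sup>\<lceil>\<^sup>d\<^sup>(\<^sup>i\<^sup>,\<^sup>k\<^sup>)\<^sup>/\<^sup>2\<^sup>\<rceil> / (\<tau> - Z)\<close> with \<open>Z = \<Sum>\<^sub>k N\<^sub>k\<close>, and the envelope theorem transfers this to \<open>V\<^sub>m\<^sub>+\<^sub>1\<close>.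

  Hence freezing the state outside the \<open>\<kappa>\<close>-hop neighbourhood changes the maximizer little. The resulting
  \<open>\<kappa>\<close>-hop policy loses at most a multiple of \<open>\<eta>\<^sup>\<lceil>\<^sup>(\<^sup>\<kappa>\<^sup>+\<^sup>1\<^sup>)\<^sup>/\<^sup>2\<^sup>\<rceil> \<le> (\<kappa> + 1)\<^sup>-\<^sup>\<mu>\<close> in each Bellman step.
\<close>

section \<open>Expectations under product distributions\<close>

text \<open>Decay is imposed on increments of the value function because softmax, and with it the
  mean field equations, see only differences of their fields: what counts is how the effect of one
  agent's change varies with the far state. The obstacle is that a maximizer over product laws has
  no closed form and is known only through coupled equations. Total coupling
  \<open>Z < \<tau>\<close> makes them contract in a maximum norm weighted by the decay around the
  perturbed agent, so every response inherits this profile. Multiplying the profile along a path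
  gives at most its value for the direct distance, which lets the bounds keep their form from one
  step to the next.

  No limit of the iteration is constructed. A late iterate with small Bellman residual serves as the
  reference for both policies, since the value of any policy differs from it by the discounted sum
  of its Bellman defects. This takes a positive tolerance. For zero rewards, where the claimed bound
  is 0, a maximal entropy policy that ignores the state is used instead.\<close>

definition prob_vec :: "'a set \<Rightarrow> ('a \<Rightarrow> real) \<Rightarrow> bool" where
  "prob_vec A x \<longleftrightarrow> (\<forall>a\<in>A. 0 \<le> x a) \<and> sum x A = 1"

text \<open>On probability vectors this is the total variation distance.\<close>

definition half_l1 :: "'a set \<Rightarrow> ('a \<Rightarrow> real) \<Rightarrow> ('a \<Rightarrow> real) \<Rightarrow> real" where
  "half_l1 A x y = (\<Sum>a\<in>A. \<bar>x a - y a\<bar>) / 2"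

text \<open>Laws are families of real vectors rather than of type \<open>pmf\<close>: a single
  marginal can then be overwritten by function update, and compactness is available in the product
  topology.\<close>

definition prod_expect ::
    "'i set \<Rightarrow> ('i \<Rightarrow> 'a set) \<Rightarrow> ('i \<Rightarrow> 'a \<Rightarrow> real) \<Rightarrow> (('i \<Rightarrow> 'a) \<Rightarrow> real) \<Rightarrow> real" where
  "prod_expect I A x f = (\<Sum>w\<in>PiE I A. (\<Prod>i\<in>I. x i (w i)) * f w)"

lemma half_l1_nonneg: "0 \<le> half_l1 A x y"
  by (simp add: half_l1_def sum_nonneg)

lemma half_l1_commute: "half_l1 A x y = half_l1 A y x"
  by (simp add: half_l1_def abs_minus_commute)

lemma half_l1_triangle: "half_l1 A x z \<le> half_l1 A x y + half_l1 A y z"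
proof -
  have "(\<Sum>a\<in>A. \<bar>x a - z a\<bar>) \<le> (\<Sum>a\<in>A. \<bar>x a - y a\<bar> + \<bar>y a - z a\<bar>)"
    by (intro sum_mono) linarith
  then show ?thesis
    by (simp add: half_l1_def sum.distrib)
qed

lemma half_l1_refl [simp]: "half_l1 A x x = 0"
  by (simp add: half_l1_def)

lemma half_l1_cong:
  assumes "\<And>a. a \<in> A \<Longrightarrow> x a = x' a" "\<And>a. a \<in> A \<Longrightarrow> y a = y' a"
  shows "half_l1 A x y = half_l1 A x' y'"
  using assms by (simp add: half_l1_def)

text \<open>Since \<open>x - y\<close> has total mass 0, \<open>f\<close> may be centred at the
  midpoint of its range, which leaves \<open>\<bar>f a - m\<bar> \<le> c / 2\<close>. So only the
  oscillation of \<open>f\<close> enters, and its factor 1/2 is the one in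
  \<open>half_l1\<close>.\<close>

lemma sum_diff_le_half_l1:
  assumes A: "finite A" "A \<noteq> {}" and x: "prob_vec A x" and y: "prob_vec A y"
    and osc: "\<And>a b. a \<in> A \<Longrightarrow> b \<in> A \<Longrightarrow> f a - f b \<le> c"
  shows "\<bar>\<Sum>a\<in>A. (x a - y a) * f a\<bar> \<le> half_l1 A x y * c"
proof -
  define m where "m = (Max (f ` A) + Min (f ` A)) / 2"
  have *: "\<bar>f a - m\<bar> \<le> c / 2" if a: "a \<in> A" for a
  proof -
    have "Max (f ` A) \<in> f ` A" "Min (f ` A) \<in> f ` A"
      using A by (auto intro!: Max_in Min_in)
    then obtain p q where "p \<in> A" "Max (f ` A) = f p" "q \<in> A" "Min (f ` A) = f q"
      by blast
    moreover have "f a \<le> Max (f ` A)" "Min (f ` A) \<le> f a"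
      using A a by auto
    ultimately have "f a \<le> f p" "f q \<le> f a" "f p - f q \<le> c" "m = (f p + f q) / 2"
      using osc[of p q] by (auto simp: m_def)
    then show ?thesis
      by (cases "m \<le> f a") (auto simp: field_simps)
  qed
  have "(\<Sum>a\<in>A. (x a - y a) * f a) = (\<Sum>a\<in>A. (x a - y a) * (f a - m)) + (\<Sum>a\<in>A. x a - y a) * m"
    unfolding sum_distrib_right sum.distrib[symmetric] by (intro sum.cong) (auto simp: algebra_simps)
  also have "(\<Sum>a\<in>A. x a - y a) = 0"
    using x y by (simp add: prob_vec_def sum_subtractf)
  finally have "\<bar>\<Sum>a\<in>A. (x a - y a) * f a\<bar> = \<bar>\<Sum>a\<in>A. (x a - y a) * (f a - m)\<bar>"
    by simp
  also have "\<dots> \<le> (\<Sum>a\<in>A. \<bar>x a - y a\<bar> * \<bar>f a - m\<bar>)"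
    by (rule order_trans[OF sum_abs]) (simp add: abs_mult)
  also have "\<dots> \<le> (\<Sum>a\<in>A. \<bar>x a - y a\<bar> * (c / 2))"
    by (intro sum_mono mult_left_mono *) auto
  also have "\<dots> = half_l1 A x y * c"
    by (simp add: half_l1_def sum_distrib_right sum_divide_distrib)
  finally show ?thesis .
qed

locale finite_family =
  fixes I :: "'i set" and A :: "'i \<Rightarrow> 'a set"
  assumes finite_index: "finite I"
    and finite_fibre: "\<And>i. i \<in> I \<Longrightarrow> finite (A i)"
    and nonempty_fibre: "\<And>i. i \<in> I \<Longrightarrow> A i \<noteq> {}"
begin

abbreviation E :: "('i \<Rightarrow> 'a \<Rightarrow> real) \<Rightarrow> (('i \<Rightarrow> 'a) \<Rightarrow> real) \<Rightarrow> real" where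
  "E x f \<equiv> prod_expect I A x f"

definition laws :: "('i \<Rightarrow> 'a \<Rightarrow> real) set" where
  "laws = {x. \<forall>i\<in>I. prob_vec (A i) (x i)}"

lemma finite_configs: "finite (PiE I A)"
  using finite_index finite_fibre by (intro finite_PiE)

lemma configs_nonempty: "PiE I A \<noteq> {}"
  using nonempty_fibre by (simp add: PiE_eq_empty_iff)

lemma fun_upd_configs: "w \<in> PiE I A \<Longrightarrow> i \<in> I \<Longrightarrow> z \<in> A i \<Longrightarrow> w(i := z) \<in> PiE I A"
  by (auto simp: PiE_iff extensional_def)

lemma laws_nonneg: "x \<in> laws \<Longrightarrow> i \<in> I \<Longrightarrow> a \<in> A i \<Longrightarrow> 0 \<le> x i a"
  by (auto simp: laws_def prob_vec_def)

lemma laws_sum: "x \<in> laws \<Longrightarrow> i \<in> I \<Longrightarrow> sum (x i) (A i) = 1"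
  by (auto simp: laws_def prob_vec_def)

lemma laws_upd: "x \<in> laws \<Longrightarrow> prob_vec (A i) p \<Longrightarrow> x(i := p) \<in> laws"
  by (auto simp: laws_def)

lemma E_cong: "(\<And>w. w \<in> PiE I A \<Longrightarrow> f w = g w) \<Longrightarrow> E x f = E x g"
  by (simp add: prod_expect_def)

lemma E_cong_law: "(\<And>i a. i \<in> I \<Longrightarrow> a \<in> A i \<Longrightarrow> x i a = y i a) \<Longrightarrow> E x f = E y f"
  unfolding prod_expect_def by (intro sum.cong refl arg_cong2[of _ _ _ _ "(*)"] prod.cong) auto

lemma E_add: "E x (\<lambda>w. f w + g w) = E x f + E x g"
  by (simp add: prod_expect_def algebra_simps sum.distrib)

lemma E_diff: "E x (\<lambda>w. f w - g w) = E x f - E x g"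
  by (simp add: prod_expect_def algebra_simps sum_subtractf)

lemma E_cmult: "E x (\<lambda>w. c * f w) = c * E x f"
  by (simp add: prod_expect_def sum_distrib_left algebra_simps)

lemma E_sum: "E x (\<lambda>w. \<Sum>j\<in>J. f j w) = (\<Sum>j\<in>J. E x (f j))"
  unfolding prod_expect_def sum_distrib_left by (rule sum.swap)

lemma E_const: assumes "x \<in> laws" shows "E x (\<lambda>_. c) = c"
proof -
  have "(\<Sum>w\<in>PiE I A. \<Prod>i\<in>I. x i (w i)) = (\<Prod>i\<in>I. \<Sum>a\<in>A i. x i a)"
    using finite_index finite_fibre by (simp add: prod_sum_PiE)
  also have "\<dots> = 1"
    using assms by (intro prod.neutral) (auto simp: laws_def prob_vec_def)
  finally show ?thesis
    by (simp add: prod_expect_def sum_distrib_right[symmetric])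
qed

lemma E_mono:
  assumes "x \<in> laws" "\<And>w. w \<in> PiE I A \<Longrightarrow> f w \<le> g w"
  shows "E x f \<le> E x g"
  unfolding prod_expect_def using assms
  by (intro sum_mono mult_left_mono prod_nonneg) (auto simp: laws_nonneg PiE_mem)

lemma E_abs_le:
  assumes "x \<in> laws" "\<And>w. w \<in> PiE I A \<Longrightarrow> \<bar>f w\<bar> \<le> c"
  shows "\<bar>E x f\<bar> \<le> c"
proof -
  have "E x f \<le> E x (\<lambda>_. c)" "E x (\<lambda>_. - c) \<le> E x f"
    using assms by (auto intro!: E_mono simp: abs_le_iff minus_le_iff)
  then show ?thesis
    using assms(1) by (simp add: E_const abs_le_iff)
qed

text \<open>A configuration is a value at \<open>i\<close> together with a configuration of the
  other coordinates. The inner sum does not involve \<open>x i\<close>, which is what later allows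
  this marginal to be exchanged.\<close>

lemma E_split:
  assumes i: "i \<in> I"
  shows "E x f = (\<Sum>z\<in>A i. x i z * (\<Sum>g\<in>PiE (I - {i}) A. (\<Prod>j\<in>I - {i}. x j (g j)) * f (g(i := z))))"
proof -
  let ?J = "I - {i}"
  have I: "insert i ?J = I" and fJ: "finite ?J"
    using i finite_index by auto
  have "PiE (insert i ?J) A = (\<lambda>(z, g). g(i := z)) ` (A i \<times> PiE ?J A)"
    by (rule PiE_insert_eq)
  then have eq: "PiE I A = (\<lambda>(z, g). g(i := z)) ` (A i \<times> PiE ?J A)"
    unfolding I .
  have inj: "inj_on (\<lambda>(z, g). g(i := z)) (A i \<times> PiE ?J A)"
  proof (rule inj_onI, clarify)
    fix z g z' g'
    assume g: "g \<in> PiE ?J A" "g' \<in> PiE ?J A" and e: "g(i := z) = g'(i := z')"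
    have "z = z'"
      using fun_cong[OF e, of i] by simp
    moreover have "g j = g' j" for j
      using fun_cong[OF e, of j] g by (cases "j = i") (auto simp: PiE_iff extensional_def)
    ultimately show "z = z' \<and> g = g'"
      by auto
  qed
  have pr: "(\<Prod>j\<in>I. x j ((g(i := z)) j)) = x i z * (\<Prod>j\<in>?J. x j (g j))" for g z
    using i finite_index by (subst prod.remove[of I i]) (auto intro!: prod.cong)
  have "E x f = (\<Sum>(z, g)\<in>A i \<times> PiE ?J A. (\<Prod>j\<in>I. x j ((g(i := z)) j)) * f (g(i := z)))"
    unfolding prod_expect_def eq by (subst sum.reindex[OF inj]) (auto simp: case_prod_beta intro!: sum.cong)
  also have "\<dots> = (\<Sum>z\<in>A i. \<Sum>g\<in>PiE ?J A. (\<Prod>j\<in>I. x j ((g(i := z)) j)) * f (g(i := z)))"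
    by (rule sum.cartesian_product[symmetric])
  finally show ?thesis
    by (simp only: pr) (simp add: sum_distrib_left mult.assoc)
qed

lemma E_expand:
  assumes i: "i \<in> I" and x: "x \<in> laws"
  shows "E x f = (\<Sum>z\<in>A i. x i z * E x (\<lambda>w. f (w(i := z))))"
proof -
  have "E x (\<lambda>w. f (w(i := z))) = (\<Sum>g\<in>PiE (I - {i}) A. (\<Prod>j\<in>I - {i}. x j (g j)) * f (g(i := z)))" for z
    by (subst E_split[OF i]) (simp add: laws_sum[OF x i] sum_distrib_right[symmetric])
  then show ?thesis
    by (subst E_split[OF i]) simp
qed

lemma E_upd:
  assumes i: "i \<in> I" and x: "x \<in> laws" and p: "prob_vec (A i) p"
  shows "E (x(i := p)) f = (\<Sum>z\<in>A i. p z * E x (\<lambda>w. f (w(i := z))))"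
proof -
  have "E (x(i := p)) (\<lambda>w. f (w(i := z))) = E x (\<lambda>w. f (w(i := z)))" for z
    using p laws_sum[OF x i]
    by (subst (1 2) E_split[OF i]) (simp add: sum_distrib_right[symmetric] prob_vec_def)
  then show ?thesis
    by (subst E_expand[OF i laws_upd[OF x p]]) simp
qed

lemma E_marginal:
  assumes i: "i \<in> I" and x: "x \<in> laws"
  shows "E x (\<lambda>w. g (w i)) = (\<Sum>z\<in>A i. x i z * g z)"
  by (subst E_expand[OF i x]) (simp add: E_const[OF x])

section \<open>Exchanging the marginals of a product law one at a time\<close>

definition hybrid :: "'i set \<Rightarrow> ('i \<Rightarrow> 'a \<Rightarrow> real) \<Rightarrow> ('i \<Rightarrow> 'a \<Rightarrow> real) \<Rightarrow> 'i \<Rightarrow> 'a \<Rightarrow> real" where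
  "hybrid J x y = (\<lambda>i. if i \<in> J then y i else x i)"

lemma hybrid_laws: "x \<in> laws \<Longrightarrow> y \<in> laws \<Longrightarrow> hybrid J x y \<in> laws"
  by (auto simp: hybrid_def laws_def)

lemma hybrid_insert: "hybrid (insert i J) x y = (hybrid J x y)(i := y i)"
  by (auto simp: hybrid_def)

lemma E_hybrid_all: "E (hybrid I x y) f = E y f"
  by (rule E_cong_law) (simp add: hybrid_def)

lemma E_hybrid_step:
  assumes "i \<in> I" "i \<notin> J" "x \<in> laws" "y \<in> laws"
  shows "E (hybrid (insert i J) x y) f - E (hybrid J x y) f =
    (\<Sum>z\<in>A i. (y i z - x i z) * E (hybrid J x y) (\<lambda>w. f (w(i := z))))"
proof -
  have h: "hybrid J x y \<in> laws" "prob_vec (A i) (y i)" "hybrid J x y i = x i"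
    using assms by (auto simp: hybrid_laws) (auto simp: hybrid_def laws_def)
  have "E (hybrid J x y) f = (\<Sum>z\<in>A i. x i z * E (hybrid J x y) (\<lambda>w. f (w(i := z))))"
    unfolding h(3)[symmetric] by (rule E_expand[OF assms(1) h(1)])
  then show ?thesis
    by (simp only: hybrid_insert E_upd[OF assms(1) h(1,2)] sum_subtractf left_diff_distrib)
qed

text \<open>The marginals are exchanged one by one along the hybrids between \<open>x\<close> and
  \<open>y\<close>. A single exchange compares two averages over one coordinate and is bounded by
  the oscillation of \<open>f\<close> in that coordinate.\<close>

lemma E_diff_le:
  assumes x: "x \<in> laws" and y: "y \<in> laws"
    and f: "\<And>i w z z'. i \<in> I \<Longrightarrow> w \<in> PiE I A \<Longrightarrow> z \<in> A i \<Longrightarrow> z' \<in> A i \<Longrightarrow>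
      f (w(i := z)) - f (w(i := z')) \<le> c i"
  shows "\<bar>E y f - E x f\<bar> \<le> (\<Sum>i\<in>I. half_l1 (A i) (x i) (y i) * c i)"
proof -
  have "\<bar>E (hybrid J x y) f - E x f\<bar> \<le> (\<Sum>i\<in>J. half_l1 (A i) (x i) (y i) * c i)"
    if "finite J" "J \<subseteq> I" for J
    using that
  proof (induction J)
    case empty
    then show ?case
      by (simp add: hybrid_def)
  next
    case (insert i J)
    let ?h = "hybrid J x y"
    have i: "i \<in> I" and h: "?h \<in> laws"
      using insert x y by (auto simp: hybrid_laws)
    have "\<bar>E (hybrid (insert i J) x y) f - E ?h f\<bar> \<le> half_l1 (A i) (y i) (x i) * c i"
      unfolding E_hybrid_step[OF i insert(2) x y]
    proof (rule sum_diff_le_half_l1)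
      fix a b assume ab: "a \<in> A i" "b \<in> A i"
      have "E ?h (\<lambda>w. f (w(i := a)) - f (w(i := b))) \<le> E ?h (\<lambda>_. c i)"
        using f[OF i _ ab] by (intro E_mono h)
      then show "E ?h (\<lambda>w. f (w(i := a))) - E ?h (\<lambda>w. f (w(i := b))) \<le> c i"
        by (simp add: E_diff E_const[OF h])
    qed (use i x y in \<open>auto simp: finite_fibre nonempty_fibre laws_def\<close>)
    with insert show ?case
      by (simp add: half_l1_commute[of "A i" "y i"])
  qed
  from this[OF finite_index subset_refl] show ?thesis
    by (simp add: E_hybrid_all)
qed

text \<open>Replace \<open>f\<close> by \<open>g\<close>, its maximum over the configurations that
  agree on \<open>B\<close>. Then \<open>f \<le> g \<le> f + c\<close>, and \<open>g\<close> depends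
  on the coordinates in \<open>B\<close> only, so both laws give it the same expectation.\<close>

lemma E_diff_le_shared:
  assumes x: "x \<in> laws" and y: "y \<in> laws" and B: "\<And>i. i \<in> I \<inter> B \<Longrightarrow> x i = y i"
    and f: "\<And>w w'. w \<in> PiE I A \<Longrightarrow> w' \<in> PiE I A \<Longrightarrow> (\<And>i. i \<in> I \<inter> B \<Longrightarrow> w i = w' i) \<Longrightarrow> f w - f w' \<le> c"
  shows "\<bar>E x f - E y f\<bar> \<le> c"
proof -
  define cls where "cls w = {w' \<in> PiE I A. \<forall>i\<in>I \<inter> B. w' i = w i}" for w
  define g where "g w = Max (f ` cls w)" for w
  have fin: "finite (cls w)" for w
    unfolding cls_def using finite_configs by auto
  have self: "w \<in> cls w" if "w \<in> PiE I A" for w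
    using that by (auto simp: cls_def)
  have up: "f w \<le> g w" if "w \<in> PiE I A" for w
    unfolding g_def using self[OF that] fin by (intro Max_ge) auto
  have low: "g w \<le> f w + c" if w: "w \<in> PiE I A" for w
  proof -
    have "f w' \<le> f w + c" if "w' \<in> cls w" for w'
      using f[of w' w] that w by (force simp: cls_def)
    then show ?thesis
      unfolding g_def using self[OF w] fin by (subst Max_le_iff) auto
  qed
  have cls_upd: "cls (w(i := z)) = cls (w(i := z'))" if "i \<notin> B" for w i z z'
    using that by (auto simp: cls_def)
  \<comment> \<open>On \<open>B\<close> any finite bound will do, since it gets multiplied by the
    distance of two equal marginals.\<close>
  have osc: "g (w(i := z)) - g (w(i := z')) \<le> (if i \<in> B then 2 * Max ((\<lambda>w. \<bar>g w\<bar>) ` PiE I A) else 0)"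
    if "i \<in> I" "w \<in> PiE I A" "z \<in> A i" "z' \<in> A i" for i w z z'
  proof (cases "i \<in> B")
    case True
    have "\<bar>g (w(i := z))\<bar> \<le> Max ((\<lambda>w. \<bar>g w\<bar>) ` PiE I A)" "\<bar>g (w(i := z'))\<bar> \<le> Max ((\<lambda>w. \<bar>g w\<bar>) ` PiE I A)"
      using that fun_upd_configs finite_configs by (auto intro!: Max_ge)
    with True show ?thesis
      by simp
  next
    case False
    then show ?thesis
      using cls_upd[OF False, of w z z'] by (simp add: g_def)
  qed
  have "\<bar>E u g - E v g\<bar> \<le> (\<Sum>i\<in>I. half_l1 (A i) (v i) (u i) *
      (if i \<in> B then 2 * Max ((\<lambda>w. \<bar>g w\<bar>) ` PiE I A) else 0))"
    if "u \<in> laws" "v \<in> laws" for u v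
    using that by (intro E_diff_le osc) auto
  from this[OF x y] have eq: "E x g = E y g"
    using B by (auto simp: sum.neutral)
  have 1: "E u f \<le> E u g" "E u g \<le> E u f + c" if u: "u \<in> laws" for u
  proof -
    show "E u f \<le> E u g"
      using u up by (rule E_mono)
    have "E u g \<le> E u (\<lambda>w. f w + c)"
      using u low by (rule E_mono)
    then show "E u g \<le> E u f + c"
      by (simp add: E_add E_const[OF u])
  qed
  show ?thesis
    using 1[OF x] 1[OF y] eq by linarith
qed

text \<open>The paths from \<open>x\<close> to \<open>x'\<close> and from \<open>y\<close> to
  \<open>y'\<close> exchange coordinates in the same order. A coordinate contributes only if it
  moves. It then moves identically on both paths, and what remains is the increment of
  \<open>f\<close> at \<open>i\<close> under two hybrid laws with the same marginals on
  \<open>B i\<close>, which \<open>E_diff_le_shared\<close> compares.\<close>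

lemma E_mixed_diff_le:
  assumes x: "x \<in> laws" "x' \<in> laws" and y: "y \<in> laws" "y' \<in> laws"
    and c: "\<And>i. i \<in> I \<Longrightarrow> half_l1 (A i) (x i) (x' i) \<le> c i"
    and m: "\<And>i. i \<in> I \<Longrightarrow> 0 \<le> m i"
    and cases: "\<And>i. i \<in> I \<Longrightarrow> x i = x' i \<and> y i = y' i \<or>
      x i = y i \<and> x' i = y' i \<and> (\<forall>j\<in>I \<inter> B i. x j = y j \<and> x' j = y' j) \<and>
      (\<forall>w\<in>PiE I A. \<forall>w'\<in>PiE I A. \<forall>z\<in>A i. \<forall>z'\<in>A i. (\<forall>j\<in>I \<inter> B i. w j = w' j) \<longrightarrow>
        f (w(i := z)) - f (w(i := z')) - (f (w'(i := z)) - f (w'(i := z'))) \<le> m i)"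
  shows "\<bar>(E x' f - E x f) - (E y' f - E y f)\<bar> \<le> (\<Sum>i\<in>I. c i * m i)"
proof -
  have "\<bar>(E (hybrid J x x') f - E x f) - (E (hybrid J y y') f - E y f)\<bar> \<le> (\<Sum>i\<in>J. c i * m i)"
    if "finite J" "J \<subseteq> I" for J
    using that
  proof (induction J)
    case empty
    then show ?case
      by (simp add: hybrid_def)
  next
    case (insert i J)
    let ?h = "hybrid J x x'" and ?k = "hybrid J y y'"
    have i: "i \<in> I" and h: "?h \<in> laws" "?k \<in> laws"
      using insert x y by (auto simp: hybrid_laws)
    have c0: "0 \<le> c i * m i"
      using c[OF i] m[OF i] half_l1_nonneg[of "A i" "x i" "x' i"] by (intro mult_nonneg_nonneg) auto
    have step: "\<bar>(E (hybrid (insert i J) x x') f - E ?h f) - (E (hybrid (insert i J) y y') f - E ?k f)\<bar> \<le> c i * m i"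
    proof (cases "x i = x' i \<and> y i = y' i")
      case True
      then show ?thesis
        using c0 by (simp add: E_hybrid_step[OF i insert(2)] x y)
    next
      case False
      with cases[OF i] have eq: "y i = x i" "y' i = x' i" and sh: "\<forall>j\<in>I \<inter> B i. x j = y j \<and> x' j = y' j"
        and f: "\<And>w w' z z'. w \<in> PiE I A \<Longrightarrow> w' \<in> PiE I A \<Longrightarrow> z \<in> A i \<Longrightarrow> z' \<in> A i \<Longrightarrow>
          (\<forall>j\<in>I \<inter> B i. w j = w' j) \<Longrightarrow> f (w(i := z)) - f (w(i := z')) - (f (w'(i := z)) - f (w'(i := z'))) \<le> m i"
        by auto
      have "\<bar>\<Sum>z\<in>A i. (x' i z - x i z) * (E ?h (\<lambda>w. f (w(i := z))) - E ?k (\<lambda>w. f (w(i := z))))\<bar>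
          \<le> half_l1 (A i) (x' i) (x i) * m i"
      proof (rule sum_diff_le_half_l1)
        fix a b assume ab: "a \<in> A i" "b \<in> A i"
        have "\<bar>E ?h (\<lambda>w. f (w(i := a)) - f (w(i := b))) - E ?k (\<lambda>w. f (w(i := a)) - f (w(i := b)))\<bar> \<le> m i"
          by (rule E_diff_le_shared[OF h, of "B i"])
            (use sh f ab in \<open>auto simp: hybrid_def\<close>)
        then show "E ?h (\<lambda>w. f (w(i := a))) - E ?k (\<lambda>w. f (w(i := a)))
            - (E ?h (\<lambda>w. f (w(i := b))) - E ?k (\<lambda>w. f (w(i := b)))) \<le> m i"
          by (simp add: E_diff)
      qed (use i x in \<open>auto simp: finite_fibre nonempty_fibre laws_def\<close>)
      also have "\<dots> \<le> c i * m i"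
        using c[OF i] m[OF i] by (intro mult_right_mono) (auto simp: half_l1_commute)
      finally show ?thesis
        by (simp add: E_hybrid_step[OF i insert(2)] x y eq sum_subtractf[symmetric] algebra_simps)
    qed
    have "(\<Sum>i\<in>insert i J. c i * m i) = c i * m i + (\<Sum>i\<in>J. c i * m i)"
      using insert by simp
    moreover have "\<bar>(E ?h f - E x f) - (E ?k f - E y f)\<bar> \<le> (\<Sum>i\<in>J. c i * m i)"
      using insert by simp
    ultimately show ?case
      using step by linarith
  qed
  from this[OF finite_index subset_refl] show ?thesis
    by (simp add: E_hybrid_all)
qed

end

section \<open>Mean field maximizers of the free energy\<close>

definition entropy :: "'a set \<Rightarrow> ('a \<Rightarrow> real) \<Rightarrow> real" where
  "entropy A x = - (\<Sum>a\<in>A. x a * ln (x a))"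

definition softmax :: "real \<Rightarrow> 'a set \<Rightarrow> ('a \<Rightarrow> real) \<Rightarrow> 'a \<Rightarrow> real" where
  "softmax \<tau> A h a = exp (h a / \<tau>) / (\<Sum>b\<in>A. exp (h b / \<tau>))"

lemma softmax_denom_pos: "finite A \<Longrightarrow> A \<noteq> {} \<Longrightarrow> 0 < (\<Sum>b\<in>A. exp (h b / \<tau> :: real))"
  by (intro sum_pos) auto

lemma softmax_pos: "finite A \<Longrightarrow> A \<noteq> {} \<Longrightarrow> 0 < softmax \<tau> A h a"
  by (simp add: softmax_def softmax_denom_pos)

lemma prob_vec_softmax: "finite A \<Longrightarrow> A \<noteq> {} \<Longrightarrow> prob_vec A (softmax \<tau> A h)"
  using softmax_denom_pos[of A h \<tau>]
  by (auto simp: prob_vec_def softmax_pos less_imp_le)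
     (simp add: softmax_def sum_divide_distrib[symmetric])

text \<open>This is \<open>ln u \<le> u - 1\<close> at \<open>u = sqrt (y / x)\<close>. Multiplied
  by \<open>x\<close> it also covers \<open>x = 0\<close>, the boundary of the simplex.\<close>

lemma mult_ln_quotient_le:
  fixes x y :: real
  assumes "0 \<le> x" "0 < y"
  shows "x * (ln y - ln x) \<le> 2 * sqrt x * sqrt y - 2 * x"
proof (cases "x = 0")
  case False
  with assms have x: "0 < x"
    by simp
  have "ln (sqrt (y / x)) \<le> sqrt (y / x) - 1"
    using x assms by (intro ln_le_minus_one) auto
  then have "ln y - ln x \<le> 2 * (sqrt (y / x) - 1)"
    using x assms by (simp add: ln_sqrt ln_div)
  then have "x * (ln y - ln x) \<le> x * (2 * (sqrt (y / x) - 1))"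
    using x by (intro mult_left_mono) auto
  also have "x * sqrt (y / x) = sqrt x * sqrt y"
    using x by (simp add: real_sqrt_divide field_simps)
  then have "x * (2 * (sqrt (y / x) - 1)) = 2 * sqrt x * sqrt y - 2 * x"
    by (simp add: algebra_simps)
  finally show ?thesis .
qed (use assms in auto)

text \<open>The bound \<open>ln u \<le> 2 (\<surd>u - 1)\<close> gives the squared Hellinger distance as the deficit, hence uniqueness.\<close>

lemma free_energy_le_softmax:
  fixes h :: "'a \<Rightarrow> real"
  assumes A: "finite A" "A \<noteq> {}" and \<tau>: "0 < \<tau>" and x: "prob_vec A x"
  defines "y \<equiv> softmax \<tau> A h"
  shows "(\<Sum>a\<in>A. x a * h a) + \<tau> * entropy A x + \<tau> * (\<Sum>a\<in>A. (sqrt (x a) - sqrt (y a))\<^sup>2)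
    \<le> (\<Sum>a\<in>A. y a * h a) + \<tau> * entropy A y"
proof -
  define Z where "Z = (\<Sum>b\<in>A. exp (h b / \<tau>))"
  have Z: "0 < Z"
    unfolding Z_def using A by (rule softmax_denom_pos)
  have y: "prob_vec A y" and ypos: "\<And>a. 0 < y a"
    unfolding y_def using A by (auto simp: prob_vec_softmax softmax_pos)
  have lny: "ln (y a) = h a / \<tau> - ln Z" for a
    using Z by (simp add: y_def softmax_def Z_def[symmetric] ln_div)
  have h: "h a = \<tau> * ln (y a) + \<tau> * ln Z" for a
    using \<tau> by (simp add: lny field_simps)
  have sh: "(\<Sum>a\<in>A. p a * h a) = \<tau> * (\<Sum>a\<in>A. p a * ln (y a)) + \<tau> * ln Z" if "prob_vec A p" for p
  proof -
    have "(\<Sum>a\<in>A. p a * h a) = \<tau> * (\<Sum>a\<in>A. p a * ln (y a)) + (\<Sum>a\<in>A. p a) * (\<tau> * ln Z)"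
      by (simp add: h distrib_left sum.distrib sum_distrib_left sum_distrib_right mult.left_commute)
    with that show ?thesis
      by (simp add: prob_vec_def)
  qed
  have sq: "(sqrt (x a) - sqrt (y a))\<^sup>2 = x a + y a - 2 * sqrt (x a) * sqrt (y a)" if "a \<in> A" for a
    using that x ypos[of a] by (simp add: prob_vec_def power2_diff less_imp_le)
  have "(\<Sum>a\<in>A. x a * (ln (y a) - ln (x a))) \<le> (\<Sum>a\<in>A. 2 * sqrt (x a) * sqrt (y a) - 2 * x a)"
    using x ypos by (intro sum_mono mult_ln_quotient_le) (auto simp: prob_vec_def)
  also have "\<dots> = (\<Sum>a\<in>A. - (sqrt (x a) - sqrt (y a))\<^sup>2 + (y a - x a))"
    by (intro sum.cong) (auto simp: sq)
  also have "\<dots> = - (\<Sum>a\<in>A. (sqrt (x a) - sqrt (y a))\<^sup>2)"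
    using x y by (simp only: sum.distrib sum_negf sum_subtractf) (simp add: prob_vec_def)
  finally have "(\<Sum>a\<in>A. x a * ln (y a)) + entropy A x + (\<Sum>a\<in>A. (sqrt (x a) - sqrt (y a))\<^sup>2) \<le> 0"
    by (simp add: entropy_def right_diff_distrib sum_subtractf)
  then have "\<tau> * ((\<Sum>a\<in>A. x a * ln (y a)) + entropy A x + (\<Sum>a\<in>A. (sqrt (x a) - sqrt (y a))\<^sup>2)) \<le> 0"
    using \<tau> by (simp add: mult_le_0_iff)
  then show ?thesis
    unfolding sh[OF x] sh[OF y] by (simp add: distrib_left right_diff_distrib entropy_def)
qed

lemma free_energy_le:
  assumes "finite A" "A \<noteq> {}" "0 < \<tau>" "prob_vec A x"
  shows "(\<Sum>a\<in>A. x a * h a) + \<tau> * entropy A x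
    \<le> (\<Sum>a\<in>A. softmax \<tau> A h a * h a) + \<tau> * entropy A (softmax \<tau> A h)"
proof -
  have "0 \<le> \<tau> * (\<Sum>a\<in>A. (sqrt (x a) - sqrt (softmax \<tau> A h a))\<^sup>2)"
    using assms by (intro mult_nonneg_nonneg sum_nonneg) auto
  with free_energy_le_softmax[OF assms, of h] show ?thesis
    by linarith
qed

lemma free_energy_maximizer:
  assumes A: "finite A" "A \<noteq> {}" and \<tau>: "0 < \<tau>" and x: "prob_vec A x"
    and max: "(\<Sum>a\<in>A. softmax \<tau> A h a * h a) + \<tau> * entropy A (softmax \<tau> A h)
      \<le> (\<Sum>a\<in>A. x a * h a) + \<tau> * entropy A x"
    and a: "a \<in> A"
  shows "x a = softmax \<tau> A h a"
proof -
  let ?D = "\<lambda>a. (sqrt (x a) - sqrt (softmax \<tau> A h a))\<^sup>2"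
  have "\<tau> * (\<Sum>a\<in>A. ?D a) \<le> 0"
    using free_energy_le_softmax[OF A \<tau> x, of h] max by linarith
  then have "(\<Sum>a\<in>A. ?D a) \<le> 0"
    using \<tau> by (simp add: mult_le_0_iff)
  then have "(\<Sum>a\<in>A. ?D a) = 0"
    by (intro antisym sum_nonneg) auto
  then have "?D a = 0"
    using A a by (simp add: sum_nonneg_eq_0_iff)
  then show ?thesis
    by simp
qed

text \<open>If the change of the field oscillates by at most \<open>c\<close>, the new softmax
  vector is pointwise at least \<open>exp (- c / \<tau>)\<close> times the old one. The total
  variation distance is then at most \<open>1 - exp (- c / \<tau>) \<le> c / \<tau>\<close>, with no
  factor from the number of actions.\<close>

lemma half_l1_softmax_le:
  assumes A: "finite A" "A \<noteq> {}" and \<tau>: "0 < \<tau>"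
    and osc: "\<And>a b. a \<in> A \<Longrightarrow> b \<in> A \<Longrightarrow> (h' a - h a) - (h' b - h b) \<le> c"
  shows "half_l1 A (softmax \<tau> A h) (softmax \<tau> A h') \<le> c / \<tau>"
proof -
  let ?p = "softmax \<tau> A h" and ?q = "softmax \<tau> A h'"
  have p: "prob_vec A ?p" and q: "prob_vec A ?q"
    using A by (auto simp: prob_vec_softmax)
  have c: "0 \<le> c"
    using osc A by (metis diff_self ex_in_conv)
  have low: "exp (- c / \<tau>) * ?p a \<le> ?q a" if a: "a \<in> A" for a
  proof -
    have "exp (h' b / \<tau>) \<le> exp (h b / \<tau>) * exp ((h' a - h a + c) / \<tau>)" if b: "b \<in> A" for b
    proof -
      have "h' b / \<tau> \<le> h b / \<tau> + (h' a - h a + c) / \<tau>"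
        using osc[OF b a] \<tau> unfolding add_divide_distrib[symmetric] by (intro divide_right_mono) auto
      then show ?thesis
        by (simp add: exp_add[symmetric])
    qed
    then have "(\<Sum>b\<in>A. exp (h' b / \<tau>)) \<le> (\<Sum>b\<in>A. exp (h b / \<tau>)) * exp ((h' a - h a + c) / \<tau>)"
      by (simp add: sum_distrib_right sum_mono)
    then have "exp (h' a / \<tau>) / ((\<Sum>b\<in>A. exp (h b / \<tau>)) * exp ((h' a - h a + c) / \<tau>)) \<le> ?q a"
      unfolding softmax_def using softmax_denom_pos[OF A, of h' \<tau>] softmax_denom_pos[OF A, of h \<tau>]
      by (intro divide_left_mono mult_pos_pos) (auto intro: order_less_le_trans)
    also have "exp (h' a / \<tau>) / ((\<Sum>b\<in>A. exp (h b / \<tau>)) * exp ((h' a - h a + c) / \<tau>))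
        = exp (h' a / \<tau> - (h' a - h a + c) / \<tau>) / (\<Sum>b\<in>A. exp (h b / \<tau>))"
      by (simp add: exp_diff divide_divide_eq_left mult.commute)
    also have "h' a / \<tau> - (h' a - h a + c) / \<tau> = - c / \<tau> + h a / \<tau>"
      by (simp add: diff_divide_distrib add_divide_distrib)
    finally show ?thesis
      by (simp add: softmax_def exp_add exp_diff exp_minus field_simps)
  qed
  have e: "1 - exp (- c / \<tau>) \<le> c / \<tau>" "0 \<le> 1 - exp (- c / \<tau>)"
    using exp_ge_add_one_self[of "- c / \<tau>"] c \<tau> by auto
  \<comment> \<open>An absolute value is twice the positive part minus the number itself. Only the
    positive part has to be estimated; the signed remainder sums to 0.\<close>
  have "\<bar>?p a - ?q a\<bar> \<le> 2 * (c / \<tau> * ?p a) + (?q a - ?p a)" if a: "a \<in> A" for a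
  proof -
    have pa: "0 < ?p a"
      using A by (rule softmax_pos)
    have "?p a - ?q a \<le> (1 - exp (- c / \<tau>)) * ?p a"
      using low[OF a] by (simp add: algebra_simps)
    also have "\<dots> \<le> c / \<tau> * ?p a"
      using e pa by (intro mult_right_mono) auto
    finally have "?p a - ?q a \<le> c / \<tau> * ?p a" .
    moreover have "0 \<le> c / \<tau> * ?p a"
      using c \<tau> pa by simp
    ultimately show ?thesis
      by linarith
  qed
  then have "(\<Sum>a\<in>A. \<bar>?p a - ?q a\<bar>) \<le> (\<Sum>a\<in>A. 2 * (c / \<tau> * ?p a) + (?q a - ?p a))"
    by (intro sum_mono)
  also have "\<dots> = 2 * (c / \<tau> * sum ?p A) + (sum ?q A - sum ?p A)"
    by (simp add: sum.distrib sum_subtractf sum_distrib_left)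
  also have "\<dots> = 2 * (c / \<tau>)"
    using p q by (simp add: prob_vec_def)
  finally show ?thesis
    by (simp add: half_l1_def mult.commute)
qed

text \<open>Continuity at 0 makes the entropy continuous up to the boundary of the simplex, so that
  compactness yields a maximizer.\<close>

lemma continuous_on_mult_ln: "continuous_on {0..} (\<lambda>x::real. x * ln x)"
  unfolding continuous_on_eq_continuous_within
proof
  fix x :: real assume "x \<in> {0..}"
  show "continuous (at x within {0..}) (\<lambda>x. x * ln x)"
  proof (cases "x = 0")
    case True
    have "((\<lambda>x::real. x * ln x) \<longlongrightarrow> 0) (at_right 0)"
      by real_asymp
    moreover have "{0..} - {0} = {0<..} - {0::real}"
      by auto
    then have "at 0 within {0..} = at_right (0::real)"
      by (simp add: at_within_def)
    ultimately show ?thesis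
      using True by (simp add: continuous_within)
  next
    case False
    then show ?thesis
      by (intro continuous_intros) auto
  qed
qed

section \<open>Existence, fixed point equations and stability of the maximizers\<close>

locale mean_field = finite_family I A for I :: "'i set" and A :: "'i \<Rightarrow> 'a set" +
  fixes \<tau> :: real
  assumes temp_pos: "0 < \<tau>"
begin

definition energy :: "(('i \<Rightarrow> 'a) \<Rightarrow> real) \<Rightarrow> ('i \<Rightarrow> 'a \<Rightarrow> real) \<Rightarrow> real" where
  "energy q x = E x q + \<tau> * (\<Sum>i\<in>I. entropy (A i) (x i))"

definition is_opt :: "(('i \<Rightarrow> 'a) \<Rightarrow> real) \<Rightarrow> ('i \<Rightarrow> 'a \<Rightarrow> real) \<Rightarrow> bool" where
  "is_opt q x \<longleftrightarrow> x \<in> laws \<and> (\<forall>y\<in>laws. energy q y \<le> energy q x)"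

text \<open>The energy need not be jointly concave in the marginals, so a maximizer is merely
  chosen. The stability estimates rest on the mean field equations, which every choice
  satisfies.\<close>

definition opt_law :: "(('i \<Rightarrow> 'a) \<Rightarrow> real) \<Rightarrow> 'i \<Rightarrow> 'a \<Rightarrow> real" where
  "opt_law q = (SOME x. is_opt q x)"

definition opt_val :: "(('i \<Rightarrow> 'a) \<Rightarrow> real) \<Rightarrow> real" where
  "opt_val q = energy q (opt_law q)"

definition field :: "(('i \<Rightarrow> 'a) \<Rightarrow> real) \<Rightarrow> ('i \<Rightarrow> 'a \<Rightarrow> real) \<Rightarrow> 'i \<Rightarrow> 'a \<Rightarrow> real" where
  "field q x i z = E x (\<lambda>w. q (w(i := z)))"

text \<open>\<open>laws\<close> leaves entries outside \<open>I\<close> and \<open>A i\<close>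
  unrestricted. The maximum is therefore taken over the compact set \<open>L\<close>, where all
  entries lie in [0, 1]; zeroing the irrelevant entries by \<open>cut\<close> moves any law into
  \<open>L\<close> without changing its energy.\<close>

lemma is_opt_exists: "\<exists>x. is_opt q x"
proof -
  define X :: "('i \<Rightarrow> 'a \<Rightarrow> real) set" where "X = PiE UNIV (\<lambda>_. PiE UNIV (\<lambda>_. {0..1}))"
  define L where "L = X \<inter> {x. \<forall>i\<in>I. (\<Sum>a\<in>A i. x i a) = 1}"
  have cX1: "compact (PiE UNIV (\<lambda>_. {0..1}) :: ('a \<Rightarrow> real) set)"
    using compactin_PiE[of "\<lambda>_::'a. euclidean :: real topology" UNIV "\<lambda>_. {0..1}"]
    by (simp add: euclidean_product_topology)
  have "compact X"
    using compactin_PiE[of "\<lambda>_::'i. euclidean :: ('a \<Rightarrow> real) topology" UNIV "\<lambda>_. PiE UNIV (\<lambda>_. {0..1})"] cX1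
    by (simp add: euclidean_product_topology X_def)
  have coord: "continuous_on S (\<lambda>x::'i \<Rightarrow> 'a \<Rightarrow> real. x i a)" for S i a
  proof -
    have "continuous_on UNIV (\<lambda>x::'i \<Rightarrow> 'a \<Rightarrow> real. x i a)"
      by (intro continuous_on_compose2[OF continuous_on_product_coordinates[of a] continuous_on_product_coordinates[of i]]) auto
    then show ?thesis
      by (rule continuous_on_subset) auto
  qed
  have "closed {x::'i \<Rightarrow> 'a \<Rightarrow> real. \<forall>i\<in>I. (\<Sum>a\<in>A i. x i a) = 1}"
  proof -
    have "{x::'i \<Rightarrow> 'a \<Rightarrow> real. \<forall>i\<in>I. (\<Sum>a\<in>A i. x i a) = 1} = (\<Inter>i\<in>I. {x. (\<Sum>a\<in>A i. x i a) = 1})"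
      by auto
    moreover have "closed {x::'i \<Rightarrow> 'a \<Rightarrow> real. (\<Sum>a\<in>A i. x i a) = 1}" for i
      by (intro closed_Collect_eq continuous_on_sum coord continuous_intros)
    ultimately show ?thesis
      by auto
  qed
  with \<open>compact X\<close> have cL: "compact L"
    unfolding L_def by (rule compact_Int_closed)
  define cut where "cut x = (\<lambda>i a. if i \<in> I \<and> a \<in> A i then x i a else 0)" for x :: "'i \<Rightarrow> 'a \<Rightarrow> real"
  have cut: "cut x \<in> L" "energy q (cut x) = energy q x" if x: "x \<in> laws" for x
  proof -
    have "x i a \<le> 1" if "i \<in> I" "a \<in> A i" for i a
    proof -
      have "x i a \<le> sum (x i) (A i)"
        using that x finite_fibre by (intro member_le_sum) (auto simp: laws_nonneg)
      with laws_sum[OF x that(1)] show ?thesis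
        by simp
    qed
    then show "cut x \<in> L"
      using x by (auto simp: L_def X_def cut_def laws_nonneg laws_sum[unfolded sum_def] laws_sum)
    have "E (cut x) q = E x q"
      by (rule E_cong_law) (simp add: cut_def)
    then show "energy q (cut x) = energy q x"
      by (simp add: energy_def entropy_def cut_def)
  qed
  have L_laws: "L \<subseteq> laws"
    by (auto simp: L_def X_def laws_def prob_vec_def PiE_iff)
  obtain x0 where "x0 \<in> laws"
    using finite_fibre nonempty_fibre prob_vec_softmax[of _ 1 "\<lambda>_. 0"]
    by (force simp: laws_def)
  then have "L \<noteq> {}"
    using cut by auto
  moreover have "continuous_on L (\<lambda>x. x i a * ln (x i a))" for i a
    by (rule continuous_on_compose2[OF continuous_on_mult_ln coord]) (auto simp: L_def X_def PiE_iff)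
  then have "continuous_on L (\<lambda>x. entropy (A i) (x i))" for i
    unfolding entropy_def by (intro continuous_on_minus continuous_on_sum)
  then have "continuous_on L (energy q)"
    unfolding energy_def[abs_def] prod_expect_def by (intro continuous_intros coord)
  ultimately obtain x where x: "x \<in> L" "\<forall>y\<in>L. energy q y \<le> energy q x"
    using continuous_attains_sup[OF cL] by blast
  have "is_opt q x"
    unfolding is_opt_def
  proof (intro conjI ballI)
    show "x \<in> laws"
      using x L_laws by auto
    show "energy q y \<le> energy q x" if "y \<in> laws" for y
      using cut[OF that] x by metis
  qed
  then show ?thesis
    by blast
qed

lemma is_opt_opt_law: "is_opt q (opt_law q)"
  unfolding opt_law_def using is_opt_exists by (rule someI_ex)

lemma opt_law_laws: "opt_law q \<in> laws"
  using is_opt_opt_law by (simp add: is_opt_def)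

lemma energy_le_opt_val: "x \<in> laws \<Longrightarrow> energy q x \<le> opt_val q"
  using is_opt_opt_law by (simp add: is_opt_def opt_val_def)

lemma energy_upd:
  assumes i: "i \<in> I" and x: "x \<in> laws" and p: "prob_vec (A i) p"
  shows "energy q (x(i := p)) = (\<Sum>z\<in>A i. p z * field q x i z) + \<tau> * entropy (A i) p
    + \<tau> * (\<Sum>j\<in>I - {i}. entropy (A j) (x j))"
proof -
  have "(\<Sum>j\<in>I. entropy (A j) ((x(i := p)) j)) = entropy (A i) p + (\<Sum>j\<in>I - {i}. entropy (A j) (x j))"
    using i finite_index by (subst sum.remove[of I i]) auto
  then show ?thesis
    by (simp add: energy_def E_upd[OF i x p] field_def algebra_simps)
qed

text \<open>With the other marginals frozen, the energy is a linear functional of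
  \<open>x i\<close>, given by the field, plus an entropy. Softmax is its only maximizer on
  \<open>A i\<close>.\<close>

lemma opt_law_softmax:
  assumes i: "i \<in> I" and a: "a \<in> A i"
  shows "opt_law q i a = softmax \<tau> (A i) (field q (opt_law q) i) a"
proof -
  let ?x = "opt_law q" and ?p = "softmax \<tau> (A i) (field q (opt_law q) i)"
  have x: "?x \<in> laws" and xi: "prob_vec (A i) (?x i)"
    using opt_law_laws[of q] i by (auto simp: laws_def)
  have p: "prob_vec (A i) ?p"
    using i by (intro prob_vec_softmax finite_fibre nonempty_fibre)
  have "energy q (?x(i := ?p)) \<le> energy q (?x(i := ?x i))"
    using energy_le_opt_val[OF laws_upd[OF x p], of q] by (simp add: opt_val_def)
  then show ?thesis
    unfolding energy_upd[OF i x p] energy_upd[OF i x xi]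
    by (intro free_energy_maximizer finite_fibre nonempty_fibre i temp_pos xi a) simp
qed

lemma opt_val_diff_le:
  assumes "\<And>w. w \<in> PiE I A \<Longrightarrow> q w - q' w \<le> c"
  shows "opt_val q - opt_val q' \<le> c"
proof -
  have "E (opt_law q) (\<lambda>w. q w - q' w) \<le> E (opt_law q) (\<lambda>_. c)"
    using assms opt_law_laws by (intro E_mono) auto
  then have "energy q (opt_law q) - energy q' (opt_law q) \<le> c"
    by (simp add: energy_def E_diff E_const[OF opt_law_laws])
  with energy_le_opt_val[OF opt_law_laws, of q' q] show ?thesis
    by (simp add: opt_val_def)
qed

text \<open>One-sided envelope theorem: the maximizer for \<open>q\<close> competes in the problem
  for \<open>q'\<close>, and the entropies cancel. It takes the place of a derivative of
  \<open>opt_val\<close>.\<close>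

lemma opt_val_diff_le_E: "opt_val q - opt_val q' \<le> E (opt_law q) (\<lambda>w. q w - q' w)"
  using energy_le_opt_val[OF opt_law_laws, of q' q]
  by (simp add: opt_val_def energy_def E_diff)

text \<open>The two fields of \<open>i\<close> differ because the objective changes, with
  oscillation \<open>\<rho>\<close> in the action of \<open>i\<close>, and because the other
  marginals move. The latter is felt only through the mixed differences \<open>m l\<close> of
  \<open>q\<close> in the actions of \<open>l\<close> and \<open>i\<close>. The marginal of
  \<open>i\<close> itself drops out, as the field overwrites that coordinate.\<close>

lemma opt_law_stability:
  assumes i: "i \<in> I"
    and \<rho>: "\<And>w z z'. w \<in> PiE I A \<Longrightarrow> z \<in> A i \<Longrightarrow> z' \<in> A i \<Longrightarrow>
      (q' (w(i := z)) - q (w(i := z))) - (q' (w(i := z')) - q (w(i := z'))) \<le> \<rho>"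
    and m: "\<And>l w y y' z z'. l \<in> I \<Longrightarrow> l \<noteq> i \<Longrightarrow> w \<in> PiE I A \<Longrightarrow> z \<in> A i \<Longrightarrow> z' \<in> A i \<Longrightarrow> y \<in> A l \<Longrightarrow> y' \<in> A l \<Longrightarrow>
      (q (w(l := y, i := z)) - q (w(l := y, i := z'))) - (q (w(l := y', i := z)) - q (w(l := y', i := z'))) \<le> m l"
  shows "half_l1 (A i) (opt_law q i) (opt_law q' i)
    \<le> (\<rho> + (\<Sum>l\<in>I - {i}. m l * half_l1 (A l) (opt_law q l) (opt_law q' l))) / \<tau>"
proof -
  let ?x = "opt_law q" and ?y = "opt_law q'"
  let ?t = "\<lambda>l. half_l1 (A l) (?x l) (?y l)"
  have x: "?x \<in> laws" and y: "?y \<in> laws"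
    by (auto simp: opt_law_laws)
  have "half_l1 (A i) (?x i) (?y i)
      = half_l1 (A i) (softmax \<tau> (A i) (field q ?x i)) (softmax \<tau> (A i) (field q' ?y i))"
    using i by (intro half_l1_cong opt_law_softmax)
  also have "\<dots> \<le> (\<rho> + (\<Sum>l\<in>I - {i}. m l * ?t l)) / \<tau>"
  proof (rule half_l1_softmax_le)
    fix z z' assume z: "z \<in> A i" "z' \<in> A i"
    let ?g = "\<lambda>w. q (w(i := z)) - q (w(i := z'))"
    have "E ?y (\<lambda>w. (q' (w(i := z)) - q (w(i := z))) - (q' (w(i := z')) - q (w(i := z')))) \<le> E ?y (\<lambda>_. \<rho>)"
      using \<rho> z by (intro E_mono y)
    then have 1: "(field q' ?y i z - field q' ?y i z') - E ?y ?g \<le> \<rho>"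
      by (simp add: E_diff E_const[OF y] field_def)
    have "\<bar>E ?y ?g - E ?x ?g\<bar> \<le> (\<Sum>l\<in>I. ?t l * (if l = i then 0 else m l))"
    proof (rule E_diff_le[OF x y])
      fix l w u u' assume "l \<in> I" "w \<in> PiE I A" "u \<in> A l" "u' \<in> A l"
      then show "?g (w(l := u)) - ?g (w(l := u')) \<le> (if l = i then 0 else m l)"
        using m[of l w z z' u u'] z by auto
    qed
    also have "\<dots> = (\<Sum>l\<in>I - {i}. m l * ?t l)"
      using i finite_index by (subst sum.remove[of I i]) (auto intro!: sum.cong simp: mult.commute)
    finally have "E ?y ?g - E ?x ?g \<le> (\<Sum>l\<in>I - {i}. m l * ?t l)"
      by simp
    moreover have "E ?x ?g = field q ?x i z - field q ?x i z'"
      by (simp add: E_diff field_def)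
    ultimately show "field q' ?y i z - field q ?x i z - (field q' ?y i z' - field q ?x i z')
        \<le> \<rho> + (\<Sum>l\<in>I - {i}. m l * ?t l)"
      using 1 by linarith
  qed (use i temp_pos finite_fibre nonempty_fibre in auto)
  finally show ?thesis .
qed

text \<open>A maximum principle: at the agent \<open>k\<close> whose response relative to
  \<open>\<Lambda>\<close> has the largest value \<open>T\<close>, the unweighted estimate reads
  \<open>T * \<tau> \<le> R + T * Z\<close>. The assumption \<open>m\<Lambda>\<close> says that
  influence relayed by \<open>l\<close> still fits the profile \<open>\<Lambda>\<close>, at the
  price \<open>N l\<close>.\<close>

lemma opt_law_weighted_stability:
  assumes \<Lambda>: "\<And>i. i \<in> I \<Longrightarrow> 0 < \<Lambda> i" and R: "0 \<le> R" and N: "\<And>l. l \<in> I \<Longrightarrow> 0 \<le> N l" and Z: "sum N I \<le> Z" "Z < \<tau>"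
    and \<rho>: "\<And>i w z z'. i \<in> I \<Longrightarrow> w \<in> PiE I A \<Longrightarrow> z \<in> A i \<Longrightarrow> z' \<in> A i \<Longrightarrow>
      (q' (w(i := z)) - q (w(i := z))) - (q' (w(i := z')) - q (w(i := z'))) \<le> R * \<Lambda> i"
    and m: "\<And>i l w y y' z z'. i \<in> I \<Longrightarrow> l \<in> I \<Longrightarrow> l \<noteq> i \<Longrightarrow> w \<in> PiE I A \<Longrightarrow> z \<in> A i \<Longrightarrow> z' \<in> A i \<Longrightarrow> y \<in> A l \<Longrightarrow> y' \<in> A l \<Longrightarrow>
      (q (w(l := y, i := z)) - q (w(l := y, i := z'))) - (q (w(l := y', i := z)) - q (w(l := y', i := z'))) \<le> m i l"
    and m\<Lambda>: "\<And>i l. i \<in> I \<Longrightarrow> l \<in> I \<Longrightarrow> m i l * \<Lambda> l \<le> N l * \<Lambda> i"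
    and i: "i \<in> I"
  shows "half_l1 (A i) (opt_law q i) (opt_law q' i) \<le> R / (\<tau> - Z) * \<Lambda> i"
proof -
  let ?t = "\<lambda>l. half_l1 (A l) (opt_law q l) (opt_law q' l)"
  define T where "T = Max ((\<lambda>l. ?t l / \<Lambda> l) ` I)"
  have "T \<in> (\<lambda>l. ?t l / \<Lambda> l) ` I"
    unfolding T_def using finite_index i by (intro Max_in) auto
  then obtain k where k: "k \<in> I" "T = ?t k / \<Lambda> k"
    by auto
  have tT: "?t l \<le> T * \<Lambda> l" if "l \<in> I" for l
  proof -
    have "?t l / \<Lambda> l \<le> T"
      unfolding T_def using finite_index that by (intro Max_ge) auto
    with \<Lambda>[OF that] show ?thesis
      by (simp add: pos_divide_le_eq)
  qed
  have T0: "0 \<le> T"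
    using k \<Lambda>[OF k(1)] half_l1_nonneg[of "A k"] by simp
  have "m k l * ?t l \<le> T * \<Lambda> k * N l" if l: "l \<in> I - {k}" for l
  proof (cases "0 \<le> m k l")
    case True
    then have "m k l * ?t l \<le> m k l * (T * \<Lambda> l)"
      using tT l by (intro mult_left_mono) auto
    also have "\<dots> = T * (m k l * \<Lambda> l)"
      by simp
    also have "\<dots> \<le> T * (N l * \<Lambda> k)"
      using T0 m\<Lambda>[OF k(1), of l] l by (intro mult_left_mono) auto
    finally show ?thesis
      by (simp add: algebra_simps)
  next
    case False
    then have "m k l * ?t l \<le> 0"
      using half_l1_nonneg by (intro mult_nonpos_nonneg) auto
    also have "0 \<le> T * \<Lambda> k * N l"
      using T0 N l \<Lambda>[OF k(1)] by simp
    finally show ?thesis .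
  qed
  then have "(\<Sum>l\<in>I - {k}. m k l * ?t l) \<le> (\<Sum>l\<in>I - {k}. T * \<Lambda> k * N l)"
    by (rule sum_mono)
  also have "\<dots> \<le> (\<Sum>l\<in>I. T * \<Lambda> k * N l)"
    using finite_index T0 N \<Lambda>[OF k(1)] by (intro sum_mono2) auto
  also have "\<dots> = T * \<Lambda> k * sum N I"
    by (simp add: sum_distrib_left)
  also have "\<dots> \<le> T * \<Lambda> k * Z"
    using Z T0 \<Lambda>[OF k(1)] by (intro mult_left_mono) auto
  finally have "(\<Sum>l\<in>I - {k}. m k l * ?t l) \<le> T * \<Lambda> k * Z" .
  moreover have "?t k \<le> (R * \<Lambda> k + (\<Sum>l\<in>I - {k}. m k l * ?t l)) / \<tau>"
    using k(1) \<rho> m by (intro opt_law_stability) auto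
  ultimately have "?t k \<le> (R * \<Lambda> k + T * \<Lambda> k * Z) / \<tau>"
    using temp_pos by (simp add: pos_le_divide_eq)
  moreover have "?t k = T * \<Lambda> k"
    using k \<Lambda>[OF k(1)] by simp
  ultimately have "(T * \<tau>) * \<Lambda> k \<le> (R + T * Z) * \<Lambda> k"
    using temp_pos by (simp add: pos_le_divide_eq algebra_simps)
  then have "T * \<tau> \<le> R + T * Z"
    using \<Lambda>[OF k(1)] by (rule mult_right_le_imp_le)
  then have "T \<le> R / (\<tau> - Z)"
    using Z by (simp add: field_simps)
  then have "T * \<Lambda> i \<le> R / (\<tau> - Z) * \<Lambda> i"
    using \<Lambda>[OF i] by (intro mult_right_mono) auto
  with tT[OF i] show ?thesis
    by simp
qed

text \<open>Each \<open>p i\<close> is a softmax of a field of its own, and \<open>p\<close> need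
  not be optimal for any common objective. The optimality of \<open>p i\<close> for
  \<open>h i\<close> bounds the entropy difference by a linear term, although entropy is not
  Lipschitz at the boundary. Expectation and entropy each cost \<open>c i\<close>, hence the factor
  2.\<close>

lemma energy_gap_le:
  assumes x: "x \<in> laws"
    and p: "\<And>i a. i \<in> I \<Longrightarrow> a \<in> A i \<Longrightarrow> p i a = softmax \<tau> (A i) (h i) a"
    and h: "\<And>i z z'. i \<in> I \<Longrightarrow> z \<in> A i \<Longrightarrow> z' \<in> A i \<Longrightarrow> h i z - h i z' \<le> c i"
    and q: "\<And>i w z z'. i \<in> I \<Longrightarrow> w \<in> PiE I A \<Longrightarrow> z \<in> A i \<Longrightarrow> z' \<in> A i \<Longrightarrow> q (w(i := z)) - q (w(i := z')) \<le> c i"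
  shows "energy q x - energy q p \<le> (\<Sum>i\<in>I. half_l1 (A i) (x i) (p i) * (2 * c i))"
proof -
  have pv: "prob_vec (A i) (p i)" if "i \<in> I" for i
    using prob_vec_softmax[OF finite_fibre[OF that] nonempty_fibre[OF that], of \<tau> "h i"] p[OF that]
    by (simp add: prob_vec_def)
  then have pl: "p \<in> laws"
    by (simp add: laws_def)
  have 1: "E x q - E p q \<le> (\<Sum>i\<in>I. half_l1 (A i) (x i) (p i) * c i)"
    using E_diff_le[OF x pl, of q c] q by (simp add: abs_le_iff)
  have 2: "\<tau> * entropy (A i) (x i) - \<tau> * entropy (A i) (p i) \<le> half_l1 (A i) (x i) (p i) * c i" if i: "i \<in> I" for i
  proof -
    have xi: "prob_vec (A i) (x i)"
      using x i by (simp add: laws_def)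
    have "entropy (A i) (p i) = entropy (A i) (softmax \<tau> (A i) (h i))"
      "(\<Sum>a\<in>A i. p i a * h i a) = (\<Sum>a\<in>A i. softmax \<tau> (A i) (h i) a * h i a)"
      using p[OF i] by (auto simp: entropy_def)
    then have "\<tau> * entropy (A i) (x i) - \<tau> * entropy (A i) (p i) \<le> (\<Sum>a\<in>A i. (p i a - x i a) * h i a)"
      using free_energy_le[OF finite_fibre[OF i] nonempty_fibre[OF i] temp_pos xi, of "h i"]
      by (simp add: left_diff_distrib sum_subtractf)
    also have "\<dots> \<le> half_l1 (A i) (p i) (x i) * c i"
      using sum_diff_le_half_l1[OF finite_fibre[OF i] nonempty_fibre[OF i] pv[OF i] xi h[OF i]]
      by (simp add: abs_le_iff)
    finally show ?thesis
      by (simp add: half_l1_commute)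
  qed
  have "\<tau> * (\<Sum>i\<in>I. entropy (A i) (x i)) - \<tau> * (\<Sum>i\<in>I. entropy (A i) (p i))
      \<le> (\<Sum>i\<in>I. half_l1 (A i) (x i) (p i) * c i)"
    using 2 by (simp add: sum_distrib_left sum_subtractf[symmetric] sum_mono)
  moreover have "(\<Sum>i\<in>I. half_l1 (A i) (x i) (p i) * (2 * c i)) =
      (\<Sum>i\<in>I. half_l1 (A i) (x i) (p i) * c i) + (\<Sum>i\<in>I. half_l1 (A i) (x i) (p i) * c i)"
    by (simp add: sum.distrib[symmetric] algebra_simps)
  ultimately show ?thesis
    using 1 by (simp add: energy_def)
qed

end

section \<open>Propagation of spatial decay\<close>

text \<open>
  One application of the kernel can move both ends of a dependence by one hop while gaining only one factor
  \<open>\<eta>\<close>, hence the exponent \<open>\<lceil>D/2\<rceil>\<close>.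
\<close>

definition decay :: "real \<Rightarrow> nat \<Rightarrow> real" where
  "decay \<eta> D = \<eta> ^ ((D + 1) div 2)"

lemma decay_0 [simp]: "decay \<eta> 0 = 1"
  by (simp add: decay_def)

lemma decay_pos: "0 < \<eta> \<Longrightarrow> 0 < decay \<eta> D"
  by (simp add: decay_def)

lemma decay_mult_le:
  assumes "0 < \<eta>" "\<eta> \<le> 1" "c \<le> a + b"
  shows "decay \<eta> a * decay \<eta> b \<le> decay \<eta> c"
  unfolding decay_def power_add[symmetric] using assms by (intro power_decreasing) auto

lemma decay_antimono: "0 < \<eta> \<Longrightarrow> \<eta> \<le> 1 \<Longrightarrow> c \<le> a \<Longrightarrow> decay \<eta> a \<le> decay \<eta> c"
  using decay_mult_le[of \<eta> c a 0] by simp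

text \<open>Replaces differentiating \<open>\<phi>\<close>: the quadratic error disappears as \<open>[0, 1]\<close> is subdivided.\<close>

lemma increment_le_of_local_bound:
  fixes \<phi> :: "real \<Rightarrow> real"
  assumes "\<And>t h. 0 \<le> t \<Longrightarrow> 0 < h \<Longrightarrow> t + h \<le> 1 \<Longrightarrow> \<phi> (t + h) - \<phi> t \<le> h * (b + L * h)"
  shows "\<phi> 1 - \<phi> 0 \<le> b"
proof -
  have "\<phi> 1 - \<phi> 0 \<le> b + L * inverse (real (Suc n))" for n
  proof -
    let ?h = "inverse (real (Suc n))"
    have "\<phi> (real m * ?h) - \<phi> 0 \<le> real m * (?h * (b + L * ?h))" if "m \<le> Suc n" for m
      using that
    proof (induction m)
      case (Suc m)
      have "real m * ?h + ?h \<le> 1"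
        using Suc.prems by (simp add: field_simps)
      then have "\<phi> (real m * ?h + ?h) - \<phi> (real m * ?h) \<le> ?h * (b + L * ?h)"
        by (intro assms) auto
      with Suc show ?case
        by (simp add: distrib_right add.commute)
    qed simp
    from this[of "Suc n"] show ?thesis
      by (simp add: mult.assoc[symmetric])
  qed
  moreover have "(\<lambda>n. b + L * inverse (real (Suc n))) \<longlonglongrightarrow> b + L * 0"
    by (intro tendsto_intros LIMSEQ_inverse_real_of_nat)
  ultimately show ?thesis
    by (intro LIMSEQ_le_const[of _ b]) auto
qed

locale decay_network = mean_field I A \<tau> + St: finite_family I S
  for I :: "'i set" and A :: "'i \<Rightarrow> 'a set" and \<tau> :: real and S :: "'i \<Rightarrow> 's set" +
  fixes d :: "'i \<Rightarrow> 'i \<Rightarrow> nat" and \<eta> :: real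
  assumes d_refl: "\<And>i. i \<in> I \<Longrightarrow> d i i = 0"
    and d_sym: "\<And>i j. i \<in> I \<Longrightarrow> j \<in> I \<Longrightarrow> d i j = d j i"
    and d_triangle: "\<And>i j k. i \<in> I \<Longrightarrow> j \<in> I \<Longrightarrow> k \<in> I \<Longrightarrow> d i k \<le> d i j + d j k"
    and \<eta>_pos: "0 < \<eta>" and \<eta>_le: "\<eta> \<le> 1"
begin

abbreviation "\<Lambda> \<equiv> decay \<eta>"

lemmas \<Lambda>_pos = decay_pos[OF \<eta>_pos]
lemmas \<Lambda>_mult_le = decay_mult_le[OF \<eta>_pos \<eta>_le]
lemmas \<Lambda>_antimono = decay_antimono[OF \<eta>_pos \<eta>_le]

text \<open>The bound \<open>N k / 2\<close> on single increments extends the mixed bound to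
  \<open>D = 0\<close> with the constant \<open>N k\<close>. For \<open>D \<ge> 1\<close> the
  agreement includes \<open>k\<close> itself, since \<open>d k k = 0\<close>.\<close>

definition state_decay :: "(('i \<Rightarrow> 's) \<Rightarrow> real) \<Rightarrow> ('i \<Rightarrow> real) \<Rightarrow> bool" where
  "state_decay V N \<longleftrightarrow>
    (\<forall>k\<in>I. \<forall>s\<in>PiE I S. \<forall>x\<in>S k. \<bar>V (s(k := x)) - V s\<bar> \<le> N k / 2) \<and>
    (\<forall>k\<in>I. \<forall>s\<in>PiE I S. \<forall>s'\<in>PiE I S. \<forall>x\<in>S k. \<forall>D\<ge>1. (\<forall>j\<in>I. d k j < D \<longrightarrow> s j = s' j) \<longrightarrow>
      \<bar>(V (s(k := x)) - V s) - (V (s'(k := x)) - V s')\<bar> \<le> N k * \<Lambda> D)"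

text \<open>State and action of an agent are changed together, as in the diagonal interaction \<open>C\<^sub>i\<^sub>i\<close>.\<close>

definition joint_decay :: "(('i \<Rightarrow> 's) \<Rightarrow> ('i \<Rightarrow> 'a) \<Rightarrow> real) \<Rightarrow> ('i \<Rightarrow> real) \<Rightarrow> bool" where
  "joint_decay Q N \<longleftrightarrow>
    (\<forall>k\<in>I. \<forall>s\<in>PiE I S. \<forall>a\<in>PiE I A. \<forall>x\<in>S k. \<forall>b\<in>A k. \<bar>Q (s(k := x)) (a(k := b)) - Q s a\<bar> \<le> N k / 2) \<and>
    (\<forall>k\<in>I. \<forall>s\<in>PiE I S. \<forall>s'\<in>PiE I S. \<forall>a\<in>PiE I A. \<forall>a'\<in>PiE I A. \<forall>x\<in>S k. \<forall>b\<in>A k. \<forall>D\<ge>1.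
      (\<forall>j\<in>I. d k j < D \<longrightarrow> s j = s' j \<and> a j = a' j) \<longrightarrow>
      \<bar>(Q (s(k := x)) (a(k := b)) - Q s a) - (Q (s'(k := x)) (a'(k := b)) - Q s' a')\<bar> \<le> N k * \<Lambda> D)"

lemma state_decay_diff:
  assumes "state_decay V N" "k \<in> I" "s \<in> PiE I S" "x \<in> S k" "y \<in> S k"
  shows "\<bar>V (s(k := x)) - V (s(k := y))\<bar> \<le> N k / 2"
proof -
  have "s(k := y) \<in> PiE I S"
    using assms by (intro St.fun_upd_configs)
  with assms have "\<bar>V ((s(k := y))(k := x)) - V (s(k := y))\<bar> \<le> N k / 2"
    unfolding state_decay_def by blast
  then show ?thesis
    by simp
qed

lemma state_decay_mixed:
  assumes "state_decay V N" "k \<in> I" "s \<in> PiE I S" "s' \<in> PiE I S" "x \<in> S k" "y \<in> S k" "1 \<le> D"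
    and "\<And>j. j \<in> I \<Longrightarrow> j \<noteq> k \<Longrightarrow> d k j < D \<Longrightarrow> s j = s' j"
  shows "\<bar>(V (s(k := x)) - V (s(k := y))) - (V (s'(k := x)) - V (s'(k := y)))\<bar> \<le> N k * \<Lambda> D"
proof -
  have "s(k := y) \<in> PiE I S" "s'(k := y) \<in> PiE I S"
    using assms by (auto intro!: St.fun_upd_configs)
  moreover have "\<forall>j\<in>I. d k j < D \<longrightarrow> (s(k := y)) j = (s'(k := y)) j"
    using assms(8) by auto
  ultimately have "\<bar>(V ((s(k := y))(k := x)) - V (s(k := y))) - (V ((s'(k := y))(k := x)) - V (s'(k := y)))\<bar> \<le> N k * \<Lambda> D"
    using assms(1,2,5,7) unfolding state_decay_def by blast
  then show ?thesis
    by simp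
qed

lemma state_decay_nonneg:
  assumes V: "state_decay V N" and k: "k \<in> I"
  shows "0 \<le> N k"
proof -
  obtain s x where "s \<in> PiE I S" "x \<in> S k"
    using St.configs_nonempty St.nonempty_fibre[OF k] by auto
  with V k have "\<bar>V (s(k := x)) - V s\<bar> \<le> N k / 2"
    unfolding state_decay_def by blast
  then show ?thesis
    by linarith
qed

lemma joint_decay_nonneg:
  assumes Q: "joint_decay Q N" and k: "k \<in> I"
  shows "0 \<le> N k"
proof -
  obtain s a x b where "s \<in> PiE I S" "a \<in> PiE I A" "x \<in> S k" "b \<in> A k"
    using St.configs_nonempty configs_nonempty St.nonempty_fibre[OF k] nonempty_fibre[OF k] by auto
  with Q k have "\<bar>Q (s(k := x)) (a(k := b)) - Q s a\<bar> \<le> N k / 2"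
    unfolding joint_decay_def by blast
  then show ?thesis
    by linarith
qed

section \<open>Response of the maximizer and of the maximum to the state\<close>

context
  fixes Q :: "('i \<Rightarrow> 's) \<Rightarrow> ('i \<Rightarrow> 'a) \<Rightarrow> real" and N :: "'i \<Rightarrow> real" and Z :: real
  assumes Q: "joint_decay Q N" and Z: "sum N I \<le> Z" "Z < \<tau>"
begin

lemma N_nonneg: "k \<in> I \<Longrightarrow> 0 \<le> N k"
  using Q by (rule joint_decay_nonneg)

lemma N_le_Z: "k \<in> I \<Longrightarrow> N k \<le> Z"
  using member_le_sum[of k I N] N_nonneg finite_index Z by force

lemma Z_nonneg: "0 \<le> Z"
  using sum_nonneg[of I N] N_nonneg Z by force

lemma Q_diff_state:
  assumes "k \<in> I" "s \<in> PiE I S" "a \<in> PiE I A" "x \<in> S k"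
  shows "\<bar>Q (s(k := x)) a - Q s a\<bar> \<le> N k / 2"
proof -
  have "a k \<in> A k"
    using assms by auto
  with Q assms have "\<bar>Q (s(k := x)) (a(k := a k)) - Q s a\<bar> \<le> N k / 2"
    unfolding joint_decay_def by blast
  then show ?thesis
    by simp
qed

lemma Q_diff_action:
  assumes "k \<in> I" "s \<in> PiE I S" "a \<in> PiE I A" "z \<in> A k" "z' \<in> A k"
  shows "\<bar>Q s (a(k := z)) - Q s (a(k := z'))\<bar> \<le> N k / 2"
proof -
  have "s k \<in> S k" "a(k := z') \<in> PiE I A"
    using assms by (auto intro: fun_upd_configs)
  with Q assms have "\<bar>Q (s(k := s k)) ((a(k := z'))(k := z)) - Q s (a(k := z'))\<bar> \<le> N k / 2"
    unfolding joint_decay_def by blast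
  then show ?thesis
    by simp
qed

lemma Q_mixed_state:
  assumes "k \<in> I" "s \<in> PiE I S" "s' \<in> PiE I S" "a \<in> PiE I A" "a' \<in> PiE I A" "x \<in> S k"
    and "\<And>j. j \<in> I \<Longrightarrow> d k j < D \<Longrightarrow> s j = s' j \<and> a j = a' j"
  shows "\<bar>(Q (s(k := x)) a - Q s a) - (Q (s'(k := x)) a' - Q s' a')\<bar> \<le> N k * \<Lambda> D"
proof (cases "D = 0")
  case True
  have "\<bar>Q (s(k := x)) a - Q s a\<bar> \<le> N k / 2" "\<bar>Q (s'(k := x)) a' - Q s' a'\<bar> \<le> N k / 2"
    using assms by (intro Q_diff_state; simp)+
  then show ?thesis
    unfolding True decay_0 by linarith
next
  case False
  have eq: "a' k = a k"
    using assms(7)[OF assms(1)] False d_refl[OF assms(1)] by auto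
  have "a k \<in> A k"
    using assms by auto
  with Q assms False have "\<bar>(Q (s(k := x)) (a(k := a k)) - Q s a) - (Q (s'(k := x)) (a'(k := a k)) - Q s' a')\<bar> \<le> N k * \<Lambda> D"
    unfolding joint_decay_def by (metis One_nat_def Suc_leI neq0_conv)
  moreover have "a'(k := a k) = a'"
    using eq by (simp add: fun_upd_idem)
  ultimately show ?thesis
    by simp
qed

text \<open>The actions may differ at \<open>k\<close>, where both get overwritten. The states must
  agree there once \<open>D \<ge> 1\<close>: \<open>joint_decay\<close> changes state and action
  together, so the old state is written back.\<close>

lemma Q_mixed_action:
  assumes "k \<in> I" "s \<in> PiE I S" "s' \<in> PiE I S" "a \<in> PiE I A" "a' \<in> PiE I A" "z \<in> A k" "z' \<in> A k"
    and "\<And>j. j \<in> I \<Longrightarrow> d k j < D \<Longrightarrow> s j = s' j \<and> (j \<noteq> k \<longrightarrow> a j = a' j)"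
  shows "\<bar>(Q s (a(k := z)) - Q s (a(k := z'))) - (Q s' (a'(k := z)) - Q s' (a'(k := z')))\<bar> \<le> N k * \<Lambda> D"
proof (cases "D = 0")
  case True
  have "\<bar>Q s (a(k := z)) - Q s (a(k := z'))\<bar> \<le> N k / 2"
    "\<bar>Q s' (a'(k := z)) - Q s' (a'(k := z'))\<bar> \<le> N k / 2"
    using assms by (intro Q_diff_action; simp)+
  then show ?thesis
    unfolding True decay_0 by linarith
next
  case False
  let ?a = "a(k := z')" and ?a' = "a'(k := z')"
  have eq: "s' k = s k"
    using assms(8)[OF assms(1)] False d_refl[OF assms(1)] by auto
  have 1: "s k \<in> S k" "?a \<in> PiE I A" "?a' \<in> PiE I A"
    using assms by (auto intro: fun_upd_configs)
  have 2: "\<forall>j\<in>I. d k j < D \<longrightarrow> s j = s' j \<and> ?a j = ?a' j"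
    using assms(8) by auto
  have "\<bar>(Q (s(k := s k)) (?a(k := z)) - Q s ?a) - (Q (s'(k := s k)) (?a'(k := z)) - Q s' ?a')\<bar> \<le> N k * \<Lambda> D"
    using Q assms(1-3,6) 1 2 False unfolding joint_decay_def by (metis One_nat_def Suc_leI neq0_conv)
  moreover have "s'(k := s k) = s'"
    using eq by (simp add: fun_upd_idem)
  ultimately show ?thesis
    by simp
qed

text \<open>States are discrete, so the objectives are interpolated instead. Linear bounds on
  differences of \<open>Q\<close> persist along the segment by convexity.\<close>

definition line :: "('i \<Rightarrow> 's) \<Rightarrow> ('i \<Rightarrow> 's) \<Rightarrow> real \<Rightarrow> ('i \<Rightarrow> 'a) \<Rightarrow> real" where
  "line s s' t a = (1 - t) * Q s a + t * Q s' a"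

text \<open>A mixed difference is symmetric in \<open>l\<close> and \<open>i\<close>. It is read as
  the increment at \<open>l\<close> in two environments that differ at \<open>i\<close>, so that the
  bound carries \<open>N l\<close>, whose sum over \<open>l\<close> is at most
  \<open>Z\<close>.\<close>

lemma line_mixed_action:
  assumes "i \<in> I" "l \<in> I" "l \<noteq> i" "w \<in> PiE I A" "z \<in> A i" "z' \<in> A i" "y \<in> A l" "y' \<in> A l"
    and s: "s \<in> PiE I S" "s' \<in> PiE I S" and t: "0 \<le> t" "t \<le> 1"
  shows "(line s s' t (w(l := y, i := z)) - line s s' t (w(l := y, i := z')))
    - (line s s' t (w(l := y', i := z)) - line s s' t (w(l := y', i := z'))) \<le> N l * \<Lambda> (d l i)"
proof -
  have *: "(Q u (w(l := y, i := z)) - Q u (w(l := y, i := z')))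
    - (Q u (w(l := y', i := z)) - Q u (w(l := y', i := z'))) \<le> N l * \<Lambda> (d l i)"
    if u: "u \<in> PiE I S" for u
  proof -
    have "w(i := z) \<in> PiE I A" "w(i := z') \<in> PiE I A"
      using assms by (auto intro: fun_upd_configs)
    then have "\<bar>(Q u ((w(i := z))(l := y)) - Q u ((w(i := z))(l := y')))
        - (Q u ((w(i := z'))(l := y)) - Q u ((w(i := z'))(l := y')))\<bar> \<le> N l * \<Lambda> (d l i)"
      using assms u by (intro Q_mixed_action) auto
    then show ?thesis
      using assms(3) by (simp add: fun_upd_twist[of l i] abs_le_iff)
  qed
  have "(1 - t) * ((Q s (w(l := y, i := z)) - Q s (w(l := y, i := z')))
      - (Q s (w(l := y', i := z)) - Q s (w(l := y', i := z'))))
    + t * ((Q s' (w(l := y, i := z)) - Q s' (w(l := y, i := z')))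
      - (Q s' (w(l := y', i := z)) - Q s' (w(l := y', i := z')))) \<le> N l * \<Lambda> (d l i)"
    using * s t by (intro convex_bound_le) auto
  then show ?thesis
    by (simp add: line_def algebra_simps)
qed

text \<open>A change of state at \<open>k\<close> perturbs the objective in the action of
  \<open>i\<close> with strength \<open>N k * \<Lambda> (d k i)\<close>. The relation
  \<open>\<Lambda> (d k l) * \<Lambda> (d l i) \<le> \<Lambda> (d k i)\<close>, from the triangle
  inequality, carries this profile over to the maximizers.\<close>

lemma opt_law_line_state:
  assumes k: "k \<in> I" and s: "s \<in> PiE I S" "s' \<in> PiE I S" and x: "x \<in> S k" and t: "0 \<le> t" "t \<le> 1" and i: "i \<in> I"
  shows "half_l1 (A i) (opt_law (line s s' t) i) (opt_law (line (s(k := x)) (s'(k := x)) t) i)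
    \<le> N k / (\<tau> - Z) * \<Lambda> (d k i)"
proof (rule opt_law_weighted_stability[where N = N and m = "\<lambda>i l. N l * \<Lambda> (d l i)" and \<Lambda> = "\<lambda>i. \<Lambda> (d k i)"])
  fix i w z z' assume *: "i \<in> I" "w \<in> PiE I A" "z \<in> A i" "z' \<in> A i"
  have "(Q (u(k := x)) (w(i := z)) - Q u (w(i := z))) - (Q (u(k := x)) (w(i := z')) - Q u (w(i := z'))) \<le> N k * \<Lambda> (d k i)"
    if "u \<in> PiE I S" for u
    using Q_mixed_state[OF k that that fun_upd_configs[OF *(2,1,3)] fun_upd_configs[OF *(2,1,4)] x, of "d k i"]
    by (force simp: abs_le_iff)
  then have "(1 - t) * ((Q (s(k := x)) (w(i := z)) - Q s (w(i := z))) - (Q (s(k := x)) (w(i := z')) - Q s (w(i := z'))))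
    + t * ((Q (s'(k := x)) (w(i := z)) - Q s' (w(i := z))) - (Q (s'(k := x)) (w(i := z')) - Q s' (w(i := z'))))
    \<le> N k * \<Lambda> (d k i)"
    using s t by (intro convex_bound_le) auto
  then show "line (s(k := x)) (s'(k := x)) t (w(i := z)) - line s s' t (w(i := z))
      - (line (s(k := x)) (s'(k := x)) t (w(i := z')) - line s s' t (w(i := z'))) \<le> N k * \<Lambda> (d k i)"
    by (simp add: line_def algebra_simps)
next
  fix i l assume "i \<in> I" "l \<in> I"
  then have "\<Lambda> (d k l) * \<Lambda> (d l i) \<le> \<Lambda> (d k i)"
    using k by (intro \<Lambda>_mult_le d_triangle)
  then have "N l * (\<Lambda> (d k l) * \<Lambda> (d l i)) \<le> N l * \<Lambda> (d k i)"
    using N_nonneg[OF \<open>l \<in> I\<close>] by (rule mult_left_mono)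
  then show "N l * \<Lambda> (d l i) * \<Lambda> (d k l) \<le> N l * \<Lambda> (d k i)"
    by (simp add: algebra_simps)
qed (use Z N_nonneg k s t i line_mixed_action \<Lambda>_pos in auto)

text \<open>Only the order in \<open>h\<close> matters, so the weight is constant 1. The estimate
  absorbs the mismatch of times in the envelope argument.\<close>

lemma opt_law_line_time:
  assumes s: "s \<in> PiE I S" "s' \<in> PiE I S" and t: "0 \<le> t" "0 \<le> h" "t + h \<le> 1" and i: "i \<in> I"
  shows "half_l1 (A i) (opt_law (line s s' t) i) (opt_law (line s s' (t + h)) i) \<le> h * Z / (\<tau> - Z)"
proof -
  have "half_l1 (A i) (opt_law (line s s' t) i) (opt_law (line s s' (t + h)) i) \<le> h * Z / (\<tau> - Z) * 1"
  proof (rule opt_law_weighted_stability[where N = N and m = "\<lambda>i l. N l" and \<Lambda> = "\<lambda>i. 1"])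
    fix i w z z' assume *: "i \<in> I" "w \<in> PiE I A" "z \<in> A i" "z' \<in> A i"
    have "(Q s' (w(i := z)) - Q s (w(i := z))) - (Q s' (w(i := z')) - Q s (w(i := z'))) \<le> Z"
      using Q_diff_action[OF *(1) s(1) *(2,3,4)] Q_diff_action[OF *(1) s(2) *(2,3,4)] N_le_Z[OF *(1)] by linarith
    then have "h * ((Q s' (w(i := z)) - Q s (w(i := z))) - (Q s' (w(i := z')) - Q s (w(i := z')))) \<le> h * Z"
      using t by (intro mult_left_mono) auto
    then show "line s s' (t + h) (w(i := z)) - line s s' t (w(i := z))
      - (line s s' (t + h) (w(i := z')) - line s s' t (w(i := z'))) \<le> h * Z * 1"
      by (simp add: line_def algebra_simps)
  next
    fix i l w y y' z z'
    assume *: "i \<in> I" "l \<in> I" "l \<noteq> i" "w \<in> PiE I A" "z \<in> A i" "z' \<in> A i" "y \<in> A l" "y' \<in> A l"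
    have "N l * \<Lambda> (d l i) \<le> N l * 1"
      using \<Lambda>_antimono[of 0 "d l i"] N_nonneg[OF *(2)] by (intro mult_left_mono) auto
    with line_mixed_action[OF * s, of t] t
    show "(line s s' t (w(l := y, i := z)) - line s s' t (w(l := y, i := z')))
      - (line s s' t (w(l := y', i := z)) - line s s' t (w(l := y', i := z'))) \<le> N l"
      by simp
  qed (use Z N_nonneg Z_nonneg t i in auto)
  then show ?thesis
    by simp
qed

text \<open>By the envelope theorem \<open>\<phi>\<close> has slope \<open>E p' w' - E p w\<close>,
  with the maximizers \<open>p\<close>, \<open>p'\<close> and the slopes \<open>w\<close>,
  \<open>w'\<close> of the two segments. Passing from \<open>w'\<close> to \<open>w\<close> costs
  the mixed decay of \<open>Q\<close> at \<open>k\<close>. Passing from \<open>p'\<close> to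
  \<open>p\<close> moves agent \<open>i\<close> by a multiple of \<open>\<Lambda> (d k i)\<close>,
  while \<open>w\<close> varies in its action by at most \<open>N i * \<Lambda> (D - d k i)\<close>;
  the product of the two decays is at most \<open>\<Lambda> D\<close> for every \<open>i\<close>, so
  maximization loses no distance.\<close>

lemma opt_val_mixed_le:
  assumes k: "k \<in> I" and s: "s \<in> PiE I S" "s' \<in> PiE I S" and x: "x \<in> S k"
    and agree: "\<And>j. j \<in> I \<Longrightarrow> d k j < D \<Longrightarrow> s j = s' j"
  shows "(opt_val (Q (s'(k := x))) - opt_val (Q (s(k := x)))) - (opt_val (Q s') - opt_val (Q s))
    \<le> N k * (\<tau> / (\<tau> - Z)) * \<Lambda> D"
proof -
  let ?u = "s(k := x)" and ?u' = "s'(k := x)"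
  define \<phi> where "\<phi> t = opt_val (line ?u ?u' t) - opt_val (line s s' t)" for t
  \<comment> \<open>The direct change of \<open>Q\<close> plus the response of the maximizers;
    \<open>1 + Z / (\<tau> - Z) = \<tau> / (\<tau> - Z)\<close>.\<close>
  define b where "b = N k * \<Lambda> D + N k / (\<tau> - Z) * \<Lambda> D * Z"
  have pos: "0 < \<tau> - Z"
    using Z by simp
  have "\<phi> (t + h) - \<phi> t \<le> h * (b + Z / (\<tau> - Z) * Z * h)" if t: "0 \<le> t" "0 < h" "t + h \<le> 1" for t h
  proof -
    \<comment> \<open>The one-sided inequalities force one maximizer to be taken at time
      \<open>t\<close> and the other at \<open>t + h\<close>. \<open>?r\<close> bridges the two
      times at a cost of order \<open>h\<close>, hence \<open>h * h\<close> in the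
      increment.\<close>
    let ?p = "opt_law (line s s' t)" and ?r = "opt_law (line s s' (t + h))"
      and ?p' = "opt_law (line ?u ?u' (t + h))"
    let ?w = "\<lambda>a. Q s' a - Q s a" and ?w' = "\<lambda>a. Q ?u' a - Q ?u a"
    have "\<phi> (t + h) - \<phi> t = (opt_val (line ?u ?u' (t + h)) - opt_val (line ?u ?u' t))
        + (opt_val (line s s' t) - opt_val (line s s' (t + h)))"
      by (simp add: \<phi>_def)
    also have "\<dots> \<le> E ?p' (\<lambda>a. line ?u ?u' (t + h) a - line ?u ?u' t a)
        + E ?p (\<lambda>a. line s s' t a - line s s' (t + h) a)"
      by (intro add_mono opt_val_diff_le_E)
    also have "(\<lambda>a. line ?u ?u' (t + h) a - line ?u ?u' t a) = (\<lambda>a. h * ?w' a)"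
      by (auto simp: line_def algebra_simps)
    also have "(\<lambda>a. line s s' t a - line s s' (t + h) a) = (\<lambda>a. - h * ?w a)"
      by (auto simp: line_def algebra_simps)
    finally have 1: "\<phi> (t + h) - \<phi> t \<le> h * (E ?p' ?w' - E ?p ?w)"
      unfolding E_cmult by (simp add: right_diff_distrib)
    have "E ?p' (\<lambda>a. ?w' a - ?w a) \<le> E ?p' (\<lambda>_. N k * \<Lambda> D)"
    proof (rule E_mono[OF opt_law_laws])
      fix a assume "a \<in> PiE I A"
      from Q_mixed_state[OF k s(2,1) this this x, of D] agree
      show "?w' a - ?w a \<le> N k * \<Lambda> D"
        by (auto simp: abs_le_iff)
    qed
    then have 2: "E ?p' ?w' - E ?p' ?w \<le> N k * \<Lambda> D"
      by (simp add: E_diff E_const[OF opt_law_laws])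
    have "E ?p' ?w - E ?p ?w \<le> (\<Sum>i\<in>I. half_l1 (A i) (?p i) (?p' i) * (N i * \<Lambda> (D - d k i)))"
    proof -
      have "\<bar>E ?p' ?w - E ?p ?w\<bar> \<le> (\<Sum>i\<in>I. half_l1 (A i) (?p i) (?p' i) * (N i * \<Lambda> (D - d k i)))"
      proof (rule E_diff_le[OF opt_law_laws opt_law_laws])
        fix i a z z' assume *: "i \<in> I" "a \<in> PiE I A" "z \<in> A i" "z' \<in> A i"
        \<comment> \<open>Agents closer than \<open>D - d k i\<close> to \<open>i\<close> are closer
          than \<open>D\<close> to \<open>k\<close>. If \<open>D \<le> d k i\<close> there are none,
          and \<open>\<Lambda> 0 = 1\<close>.\<close>
        have "s' j = s j" if "j \<in> I" "d i j < D - d k i" for j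
          using agree[of j] d_triangle[OF k *(1) that(1)] that by force
        then have "\<bar>(Q s' (a(i := z)) - Q s' (a(i := z'))) - (Q s (a(i := z)) - Q s (a(i := z')))\<bar>
          \<le> N i * \<Lambda> (D - d k i)"
          using * s by (intro Q_mixed_action) auto
        then show "?w (a(i := z)) - ?w (a(i := z')) \<le> N i * \<Lambda> (D - d k i)"
          by (simp add: abs_le_iff)
      qed
      then show ?thesis
        by simp
    qed
    also have "\<dots> \<le> (\<Sum>i\<in>I. (N k / (\<tau> - Z) * \<Lambda> D + h * Z / (\<tau> - Z)) * N i)"
    proof (rule sum_mono)
      fix i assume i: "i \<in> I"
      have "half_l1 (A i) (?p i) (?p' i) \<le> half_l1 (A i) (?p i) (?r i) + half_l1 (A i) (?r i) (?p' i)"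
        by (rule half_l1_triangle)
      also have "half_l1 (A i) (?p i) (?r i) \<le> h * Z / (\<tau> - Z)"
        using t by (intro opt_law_line_time s i) auto
      also have "half_l1 (A i) (?r i) (?p' i) \<le> N k / (\<tau> - Z) * \<Lambda> (d k i)"
        using t by (intro opt_law_line_state s i k x) auto
      finally have "half_l1 (A i) (?p i) (?p' i) * (N i * \<Lambda> (D - d k i))
          \<le> (h * Z / (\<tau> - Z) + N k / (\<tau> - Z) * \<Lambda> (d k i)) * (N i * \<Lambda> (D - d k i))"
        using N_nonneg[OF i] \<Lambda>_pos by (intro mult_right_mono mult_nonneg_nonneg) (auto intro: less_imp_le)
      also have "\<dots> = (h * Z / (\<tau> - Z) * \<Lambda> (D - d k i) + N k / (\<tau> - Z) * (\<Lambda> (d k i) * \<Lambda> (D - d k i))) * N i"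
        by (simp add: algebra_simps)
      also have "\<dots> \<le> (h * Z / (\<tau> - Z) * 1 + N k / (\<tau> - Z) * \<Lambda> D) * N i"
        using N_nonneg[OF i] N_nonneg[OF k] Z_nonneg pos t \<Lambda>_antimono[of 0 "D - d k i"]
        by (intro mult_right_mono add_mono mult_left_mono \<Lambda>_mult_le) auto
      finally show "half_l1 (A i) (?p i) (?p' i) * (N i * \<Lambda> (D - d k i))
          \<le> (N k / (\<tau> - Z) * \<Lambda> D + h * Z / (\<tau> - Z)) * N i"
        by (simp add: add.commute)
    qed
    also have "\<dots> = (N k / (\<tau> - Z) * \<Lambda> D + h * Z / (\<tau> - Z)) * sum N I"
      by (simp add: sum_distrib_left)
    also have "\<dots> \<le> (N k / (\<tau> - Z) * \<Lambda> D + h * Z / (\<tau> - Z)) * Z"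
      using Z N_nonneg[OF k] Z_nonneg pos t \<Lambda>_pos[of D] by (intro mult_left_mono add_nonneg_nonneg mult_nonneg_nonneg divide_nonneg_nonneg) auto
    finally have "E ?p' ?w' - E ?p ?w \<le> b + Z / (\<tau> - Z) * Z * h"
      using 2 by (simp add: b_def algebra_simps)
    then have "h * (E ?p' ?w' - E ?p ?w) \<le> h * (b + Z / (\<tau> - Z) * Z * h)"
      using t by (intro mult_left_mono) auto
    with 1 show ?thesis
      by linarith
  qed
  from increment_le_of_local_bound[of \<phi> b, OF this] have "\<phi> 1 - \<phi> 0 \<le> b" .
  moreover have "line s s' 0 = Q s" "line s s' 1 = Q s'" "line ?u ?u' 0 = Q ?u" "line ?u ?u' 1 = Q ?u'"
    by (auto simp: line_def)
  moreover have "b = N k * (\<tau> / (\<tau> - Z)) * \<Lambda> D"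
    using pos by (simp add: b_def field_simps)
  ultimately show ?thesis
    by (simp add: \<phi>_def)
qed

lemma state_decay_opt_val: "state_decay (\<lambda>s. opt_val (Q s)) (\<lambda>k. N k * (\<tau> / (\<tau> - Z)))"
  unfolding state_decay_def
proof (intro conjI ballI allI impI)
  fix k s x assume *: "k \<in> I" "s \<in> PiE I S" "x \<in> S k"
  have "\<bar>Q (s(k := x)) a - Q s a\<bar> \<le> N k / 2" if "a \<in> PiE I A" for a
    using * that by (intro Q_diff_state)
  then have "opt_val (Q (s(k := x))) - opt_val (Q s) \<le> N k / 2"
    "opt_val (Q s) - opt_val (Q (s(k := x))) \<le> N k / 2"
    by (intro opt_val_diff_le; force simp only: abs_le_iff)+
  moreover have "N k * 1 \<le> N k * (\<tau> / (\<tau> - Z))"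
    using Z Z_nonneg N_nonneg[OF *(1)] by (intro mult_left_mono) auto
  then have "N k / 2 \<le> N k * (\<tau> / (\<tau> - Z)) / 2"
    by (intro divide_right_mono) auto
  ultimately show "\<bar>opt_val (Q (s(k := x))) - opt_val (Q s)\<bar> \<le> N k * (\<tau> / (\<tau> - Z)) / 2"
    by linarith
next
  fix k s s' x and D :: nat
  assume *: "k \<in> I" "s \<in> PiE I S" "s' \<in> PiE I S" "x \<in> S k" "\<forall>j\<in>I. d k j < D \<longrightarrow> s j = s' j"
  show "\<bar>opt_val (Q (s(k := x))) - opt_val (Q s) - (opt_val (Q (s'(k := x))) - opt_val (Q s'))\<bar>
      \<le> N k * (\<tau> / (\<tau> - Z)) * \<Lambda> D"
    using opt_val_mixed_le[OF *(1,2,3,4), of D] opt_val_mixed_le[OF *(1,3,2,4), of D] *(5)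
    by (auto simp: abs_le_iff)
qed

text \<open>The states are joined by changing one agent at a time. Only agents \<open>j\<close> at
  distance at least \<open>D\<close> from \<open>i\<close> really change, and each costs a multiple
  of \<open>N j\<close>, so the sum is governed by \<open>Z\<close> and not by the number of
  agents.\<close>

lemma opt_law_far:
  assumes i: "i \<in> I" and s: "s \<in> PiE I S" "s' \<in> PiE I S"
    and agree: "\<And>j. j \<in> I \<Longrightarrow> d i j < D \<Longrightarrow> s j = s' j"
  shows "half_l1 (A i) (opt_law (Q s) i) (opt_law (Q s') i) \<le> Z / (\<tau> - Z) * \<Lambda> D"
proof -
  define mix where "mix J = (\<lambda>j. if j \<in> J then s' j else s j)" for J
  have pos: "0 < \<tau> - Z"
    using Z by simp
  have mixC: "mix J \<in> PiE I S" for J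
    using s by (auto simp: mix_def PiE_iff extensional_def)
  have "half_l1 (A i) (opt_law (Q s) i) (opt_law (Q (mix J)) i) \<le> (\<Sum>j\<in>J. N j / (\<tau> - Z) * \<Lambda> D)"
    if "finite J" "J \<subseteq> I" for J
    using that
  proof (induction J)
    case empty
    then show ?case
      by (simp add: mix_def)
  next
    case (insert j J)
    then have j: "j \<in> I"
      by auto
    have nn: "0 \<le> N j / (\<tau> - Z) * \<Lambda> D"
      using N_nonneg[OF j] pos \<Lambda>_pos[of D] by simp
    have eq: "mix (insert j J) = (mix J)(j := s' j)"
      by (auto simp: mix_def)
    have "half_l1 (A i) (opt_law (Q (mix J)) i) (opt_law (Q (mix (insert j J))) i) \<le> N j / (\<tau> - Z) * \<Lambda> D"
    proof (cases "d i j < D")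
      case True
      then have "mix (insert j J) = mix J"
        using agree[OF j] insert(2) by (auto simp: mix_def)
      with nn show ?thesis
        by simp
    next
      case False
      \<comment> \<open>A degenerate segment, on which \<open>line\<close> is just
        \<open>Q\<close>.\<close>
      have "half_l1 (A i) (opt_law (line (mix J) (mix J) 0) i)
          (opt_law (line ((mix J)(j := s' j)) ((mix J)(j := s' j)) 0) i) \<le> N j / (\<tau> - Z) * \<Lambda> (d j i)"
        using s j by (intro opt_law_line_state i j mixC) auto
      also have "\<dots> \<le> N j / (\<tau> - Z) * \<Lambda> D"
        using N_nonneg[OF j] pos False d_sym[OF i j] by (intro mult_left_mono \<Lambda>_antimono) auto
      finally show ?thesis
        by (simp add: eq line_def[abs_def])
    qed
    then show ?case
      using insert half_l1_triangle[of "A i" "opt_law (Q s) i" "opt_law (Q (mix (insert j J))) i" "opt_law (Q (mix J)) i"]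
      by simp
  qed
  from this[OF finite_index subset_refl]
  have "half_l1 (A i) (opt_law (Q s) i) (opt_law (Q (mix I)) i) \<le> (\<Sum>j\<in>I. N j / (\<tau> - Z) * \<Lambda> D)" .
  also have "\<dots> = sum N I / (\<tau> - Z) * \<Lambda> D"
    by (simp add: sum_distrib_right sum_divide_distrib)
  also have "\<dots> \<le> Z / (\<tau> - Z) * \<Lambda> D"
    using Z pos \<Lambda>_pos[of D] by (intro mult_right_mono divide_right_mono) auto
  also have "mix I = s'"
    using s by (auto simp: mix_def PiE_iff extensional_def)
  finally show ?thesis .
qed

text \<open>Every agent applies the maximizer for its own version \<open>\<sigma> i\<close> of the
  state, which is the situation of \<open>energy_gap_le\<close>. One factor \<open>Z\<close> comes
  from the distance of the laws, the other from summing the oscillations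
  \<open>N i / 2\<close>.\<close>

lemma truncated_energy_gap:
  assumes s: "s \<in> PiE I S" and \<sigma>: "\<And>i. i \<in> I \<Longrightarrow> \<sigma> i \<in> PiE I S"
    and agree: "\<And>i j. i \<in> I \<Longrightarrow> j \<in> I \<Longrightarrow> d i j < D \<Longrightarrow> s j = \<sigma> i j"
  shows "opt_val (Q s) - energy (Q s) (\<lambda>i. opt_law (Q (\<sigma> i)) i) \<le> Z * (Z / (\<tau> - Z) * \<Lambda> D)"
proof -
  have pos: "0 < \<tau> - Z"
    using Z by simp
  have "opt_val (Q s) - energy (Q s) (\<lambda>i. opt_law (Q (\<sigma> i)) i)
      \<le> (\<Sum>i\<in>I. half_l1 (A i) (opt_law (Q s) i) (opt_law (Q (\<sigma> i)) i) * (2 * (N i / 2)))"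
    unfolding opt_val_def
  proof (rule energy_gap_le)
    fix i z z' assume *: "i \<in> I" "z \<in> A i" "z' \<in> A i"
    have "E (opt_law (Q (\<sigma> i))) (\<lambda>w. Q (\<sigma> i) (w(i := z)) - Q (\<sigma> i) (w(i := z'))) \<le> E (opt_law (Q (\<sigma> i))) (\<lambda>_. N i / 2)"
      by (intro E_mono opt_law_laws order_trans[OF abs_ge_self Q_diff_action] \<sigma> *)
    then show "field (Q (\<sigma> i)) (opt_law (Q (\<sigma> i))) i z - field (Q (\<sigma> i)) (opt_law (Q (\<sigma> i))) i z' \<le> N i / 2"
      by (simp add: E_diff E_const[OF opt_law_laws] field_def)
  next
    fix i w z z' assume "i \<in> I" "w \<in> PiE I A" "z \<in> A i" "z' \<in> A i"
    from Q_diff_action[OF this(1) s this(2,3,4)]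
    show "Q s (w(i := z)) - Q s (w(i := z')) \<le> N i / 2"
      by linarith
  qed (auto simp: opt_law_laws opt_law_softmax)
  also have "\<dots> \<le> (\<Sum>i\<in>I. (Z / (\<tau> - Z) * \<Lambda> D) * N i)"
  proof (rule sum_mono)
    fix i assume i: "i \<in> I"
    have "half_l1 (A i) (opt_law (Q s) i) (opt_law (Q (\<sigma> i)) i) \<le> Z / (\<tau> - Z) * \<Lambda> D"
      using i agree by (intro opt_law_far s \<sigma>) auto
    then show "half_l1 (A i) (opt_law (Q s) i) (opt_law (Q (\<sigma> i)) i) * (2 * (N i / 2)) \<le> (Z / (\<tau> - Z) * \<Lambda> D) * N i"
      using N_nonneg[OF i] by (simp del: times_divide_eq_left add: mult_right_mono)
  qed
  also have "\<dots> = sum N I * (Z / (\<tau> - Z) * \<Lambda> D)"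
    unfolding sum_distrib_left[symmetric] by (rule mult.commute)
  also have "\<dots> \<le> Z * (Z / (\<tau> - Z) * \<Lambda> D)"
    using Z Z_nonneg pos \<Lambda>_pos[of D] by (intro mult_right_mono) auto
  finally show ?thesis .
qed

end

end

section \<open>The transition step\<close>

locale decay_mdp = decay_network I A \<tau> S d \<eta>
  for I :: "'i set" and A :: "'i \<Rightarrow> 'a set" and \<tau> :: real and S :: "'i \<Rightarrow> 's set"
    and d :: "'i \<Rightarrow> 'i \<Rightarrow> nat" and \<eta> :: real +
  fixes \<nu> :: "('i \<Rightarrow> 's) \<Rightarrow> ('i \<Rightarrow> 'a) \<Rightarrow> 'i \<Rightarrow> 's \<Rightarrow> real" and C :: "'i \<Rightarrow> 'i \<Rightarrow> real"
    and r :: "'i \<Rightarrow> 's \<Rightarrow> 'a \<Rightarrow> real" and R \<gamma> :: real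
  assumes index_nonempty: "I \<noteq> {}"
    and \<nu>_laws: "\<And>s a. s \<in> PiE I S \<Longrightarrow> a \<in> PiE I A \<Longrightarrow> \<nu> s a \<in> St.laws"
    and \<nu>_influence: "\<And>s a i k x b. s \<in> PiE I S \<Longrightarrow> a \<in> PiE I A \<Longrightarrow> i \<in> I \<Longrightarrow> k \<in> I \<Longrightarrow> x \<in> S k \<Longrightarrow> b \<in> A k \<Longrightarrow>
      half_l1 (S i) (\<nu> s a i) (\<nu> (s(k := x)) (a(k := b)) i) \<le> C i k"
    and \<nu>_local: "\<And>s s' a a' i. s \<in> PiE I S \<Longrightarrow> s' \<in> PiE I S \<Longrightarrow> i \<in> I \<Longrightarrow>
      (\<And>j. j \<in> I \<Longrightarrow> d i j \<le> 1 \<Longrightarrow> s j = s' j) \<Longrightarrow> a i = a' i \<Longrightarrow> \<nu> s a i = \<nu> s' a' i"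
    and C_row: "\<And>i. i \<in> I \<Longrightarrow> 2 * (\<Sum>k\<in>I. C i k) \<le> \<eta>"
    and r_bounds: "\<And>i x b. i \<in> I \<Longrightarrow> x \<in> S i \<Longrightarrow> b \<in> A i \<Longrightarrow> 0 \<le> r i x b \<and> r i x b \<le> R"
    and \<gamma>: "0 < \<gamma>" "\<gamma> < 1"
begin

definition avg_reward :: "('i \<Rightarrow> 's) \<Rightarrow> ('i \<Rightarrow> 'a) \<Rightarrow> real" where
  "avg_reward s a = (\<Sum>i\<in>I. r i (s i) (a i)) / card I"

definition qfun :: "(('i \<Rightarrow> 's) \<Rightarrow> real) \<Rightarrow> ('i \<Rightarrow> 's) \<Rightarrow> ('i \<Rightarrow> 'a) \<Rightarrow> real" where
  "qfun V s a = avg_reward s a + \<gamma> * St.E (\<nu> s a) V"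

text \<open>One increment of the averaged reward is at most \<open>R / card I\<close>, and
  increments are bounded by half the constant. The factor \<open>1 / \<eta>\<close> pays for the two
  hops lost in a transition.\<close>

definition q_const :: "('i \<Rightarrow> real) \<Rightarrow> 'i \<Rightarrow> real" where
  "q_const N k = 2 * R / card I + \<gamma> / \<eta> * (\<Sum>i\<in>I. C i k * N i)"

lemma C_nonneg: "i \<in> I \<Longrightarrow> k \<in> I \<Longrightarrow> 0 \<le> C i k"
proof -
  assume i: "i \<in> I" "k \<in> I"
  obtain s a x b where "s \<in> PiE I S" "a \<in> PiE I A" "x \<in> S k" "b \<in> A k"
    using St.configs_nonempty configs_nonempty St.nonempty_fibre[OF i(2)] nonempty_fibre[OF i(2)] by auto
  from \<nu>_influence[OF this(1,2) i this(3,4)] half_l1_nonneg show ?thesis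
    by (rule order_trans[rotated])
qed

lemma card_index_pos: "0 < real (card I)"
  using index_nonempty finite_index by (simp add: card_gt_0_iff)

lemma R_nonneg: "0 \<le> R"
proof -
  obtain i where "i \<in> I"
    using index_nonempty by auto
  moreover obtain x b where "x \<in> S i" "b \<in> A i"
    using St.nonempty_fibre nonempty_fibre calculation by blast
  ultimately show ?thesis
    using r_bounds[of i x b] by linarith
qed

text \<open>After summation over \<open>k\<close> the transposed matrix acts through the row sums of
  \<open>C\<close>. Their bound \<open>\<eta> / 2\<close> cancels the factor
  \<open>1 / \<eta>\<close>.\<close>

lemma sum_q_const_le:
  assumes "\<And>i. i \<in> I \<Longrightarrow> 0 \<le> N i"
  shows "(\<Sum>k\<in>I. q_const N k) \<le> 2 * R + \<gamma> / 2 * sum N I"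
proof -
  have "(\<Sum>k\<in>I. \<Sum>i\<in>I. C i k * N i) = (\<Sum>i\<in>I. (\<Sum>k\<in>I. C i k) * N i)"
    by (subst sum.swap) (simp add: sum_distrib_right)
  also have "\<dots> \<le> (\<Sum>i\<in>I. \<eta> / 2 * N i)"
  proof (intro sum_mono mult_right_mono assms)
    fix i assume "i \<in> I"
    with C_row[of i] show "(\<Sum>k\<in>I. C i k) \<le> \<eta> / 2"
      by simp
  qed
  also have "\<dots> = \<eta> / 2 * sum N I"
    by (simp add: sum_distrib_left)
  finally have "\<gamma> / \<eta> * (\<Sum>k\<in>I. \<Sum>i\<in>I. C i k * N i) \<le> \<gamma> / \<eta> * (\<eta> / 2 * sum N I)"
    using \<gamma> \<eta>_pos by (intro mult_left_mono) auto
  moreover have "(\<Sum>k\<in>I. q_const N k) = 2 * R + \<gamma> / \<eta> * (\<Sum>k\<in>I. \<Sum>i\<in>I. C i k * N i)"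
    using card_index_pos by (simp add: q_const_def sum.distrib sum_distrib_left)
  ultimately show ?thesis
    using \<eta>_pos by simp
qed

lemma avg_reward_upd:
  assumes k: "k \<in> I"
  shows "avg_reward (s(k := x)) (a(k := b)) - avg_reward s a = (r k x b - r k (s k) (a k)) / card I"
proof -
  have "(\<Sum>i\<in>I. r i ((s(k := x)) i) ((a(k := b)) i)) = r k x b + (\<Sum>i\<in>I - {k}. r i (s i) (a i))"
    using k finite_index by (subst sum.remove[of I k]) auto
  moreover have "(\<Sum>i\<in>I. r i (s i) (a i)) = r k (s k) (a k) + (\<Sum>i\<in>I - {k}. r i (s i) (a i))"
    using k finite_index by (subst sum.remove[of I k]) auto
  ultimately show ?thesis
    by (simp add: avg_reward_def diff_divide_distrib add_divide_distrib)
qed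

lemma expectation_upd_le:
  assumes V: "state_decay V N" and *: "k \<in> I" "s \<in> PiE I S" "a \<in> PiE I A" "x \<in> S k" "b \<in> A k"
  shows "\<bar>St.E (\<nu> (s(k := x)) (a(k := b))) V - St.E (\<nu> s a) V\<bar> \<le> (\<Sum>i\<in>I. C i k * N i) / 2"
proof -
  have "\<bar>St.E (\<nu> (s(k := x)) (a(k := b))) V - St.E (\<nu> s a) V\<bar>
      \<le> (\<Sum>i\<in>I. half_l1 (S i) (\<nu> s a i) (\<nu> (s(k := x)) (a(k := b)) i) * (N i / 2))"
  proof (rule St.E_diff_le)
    fix i w z z' assume "i \<in> I" "w \<in> PiE I S" "z \<in> S i" "z' \<in> S i"
    from state_decay_diff[OF V this] show "V (w(i := z)) - V (w(i := z')) \<le> N i / 2"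
      by linarith
  qed (use * in \<open>auto intro!: \<nu>_laws fun_upd_configs St.fun_upd_configs\<close>)
  also have "\<dots> \<le> (\<Sum>i\<in>I. C i k * (N i / 2))"
    using * state_decay_nonneg[OF V] by (intro sum_mono mult_right_mono \<nu>_influence) auto
  finally show ?thesis
    by (simp add: sum_divide_distrib)
qed

text \<open>In mixed differences the reward cancels, being a sum of local terms. In the kernel part
  only agents \<open>i\<close> within one hop of \<open>k\<close> react. For \<open>D > 2\<close>
  their laws, and those of all agents closer than \<open>D - 2\<close> to them, are the same in both
  environments, so \<open>E_mixed_diff_le\<close> applies.\<close>

lemma joint_decay_qfun:
  assumes V: "state_decay V N"
  shows "joint_decay (qfun V) (q_const N)"
  unfolding joint_decay_def
proof (intro conjI ballI allI impI)
  fix k s a x b assume *: "k \<in> I" "s \<in> PiE I S" "a \<in> PiE I A" "x \<in> S k" "b \<in> A k"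
  let ?s = "s(k := x)" and ?a = "a(k := b)"
  have "s k \<in> S k" "a k \<in> A k"
    using * by auto
  then have "\<bar>r k x b - r k (s k) (a k)\<bar> \<le> R"
    using r_bounds[OF *(1,4,5)] r_bounds[OF *(1), of "s k" "a k"] by auto
  then have 1: "\<bar>avg_reward ?s ?a - avg_reward s a\<bar> \<le> R / card I"
    unfolding avg_reward_upd[OF *(1)] using card_index_pos by (simp add: divide_right_mono)
  have nn: "0 \<le> (\<Sum>i\<in>I. C i k * N i)"
    using * C_nonneg state_decay_nonneg[OF V] by (intro sum_nonneg mult_nonneg_nonneg) auto
  have 2: "\<gamma> * \<bar>St.E (\<nu> ?s ?a) V - St.E (\<nu> s a) V\<bar> \<le> \<gamma> * ((\<Sum>i\<in>I. C i k * N i) / 2)"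
    using \<gamma> expectation_upd_le[OF V *] by (intro mult_left_mono) auto
  have "\<gamma> * (\<Sum>i\<in>I. C i k * N i) \<le> \<gamma> / \<eta> * (\<Sum>i\<in>I. C i k * N i)"
    using \<gamma> \<eta>_pos \<eta>_le nn by (intro mult_right_mono) (auto simp: field_simps)
  moreover have "\<bar>qfun V ?s ?a - qfun V s a\<bar> \<le> \<bar>avg_reward ?s ?a - avg_reward s a\<bar> + \<gamma> * \<bar>St.E (\<nu> ?s ?a) V - St.E (\<nu> s a) V\<bar>"
  proof -
    have "qfun V ?s ?a - qfun V s a = (avg_reward ?s ?a - avg_reward s a) + \<gamma> * (St.E (\<nu> ?s ?a) V - St.E (\<nu> s a) V)"
      by (simp add: qfun_def algebra_simps)
    then show ?thesis
      using \<gamma> abs_triangle_ineq[of "avg_reward ?s ?a - avg_reward s a" "\<gamma> * (St.E (\<nu> ?s ?a) V - St.E (\<nu> s a) V)"]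
      by (simp add: abs_mult)
  qed
  ultimately show "\<bar>qfun V ?s ?a - qfun V s a\<bar> \<le> q_const N k / 2"
    using 1 2 by (simp add: q_const_def add_divide_distrib)
next
  fix k s s' a a' x b and D :: nat
  assume *: "k \<in> I" "s \<in> PiE I S" "s' \<in> PiE I S" "a \<in> PiE I A" "a' \<in> PiE I A" "x \<in> S k" "b \<in> A k"
    and D: "1 \<le> D" and agree: "\<forall>j\<in>I. d k j < D \<longrightarrow> s j = s' j \<and> a j = a' j"
  let ?s = "s(k := x)" and ?a = "a(k := b)" and ?s' = "s'(k := x)" and ?a' = "a'(k := b)"
  have C: "?s \<in> PiE I S" "?a \<in> PiE I A" "?s' \<in> PiE I S" "?a' \<in> PiE I A"
    using * by (auto intro!: fun_upd_configs St.fun_upd_configs)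
  have N: "0 \<le> N i" if "i \<in> I" for i
    using V that by (rule state_decay_nonneg)
  define X where "X = (\<Sum>i\<in>I. C i k * N i)"
  have X: "0 \<le> X"
    unfolding X_def using * C_nonneg N by (intro sum_nonneg mult_nonneg_nonneg) auto
  have "s k = s' k" "a k = a' k"
    using agree *(1) D d_refl[OF *(1)] by auto
  then have rew: "avg_reward ?s ?a - avg_reward s a = avg_reward ?s' ?a' - avg_reward s' a'"
    unfolding avg_reward_upd[OF *(1)] by simp
  let ?M = "(St.E (\<nu> ?s ?a) V - St.E (\<nu> s a) V) - (St.E (\<nu> ?s' ?a') V - St.E (\<nu> s' a') V)"
  have "\<bar>?M\<bar> \<le> X * \<Lambda> D / \<eta>"
  \<comment> \<open>Up to distance 2 the bound by single increments suffices, because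
    \<open>\<Lambda> D / \<eta> \<ge> 1\<close> there.\<close>
  proof (cases "D \<le> 2")
    case True
    have 1: "\<bar>?M\<bar> \<le> X"
      using expectation_upd_le[OF V *(1,2,4,6,7)] expectation_upd_le[OF V *(1,3,5,6,7)]
      unfolding X_def by linarith
    have "\<eta> \<le> \<Lambda> D"
      using \<Lambda>_antimono[OF True] by (simp add: decay_def)
    then have "X * \<eta> \<le> X * \<Lambda> D"
      using X by (intro mult_left_mono)
    then have "X \<le> X * \<Lambda> D / \<eta>"
      using \<eta>_pos by (simp add: field_simps)
    with 1 show ?thesis
      by linarith
  next
    case False
    have "\<bar>?M\<bar> \<le> (\<Sum>i\<in>I. C i k * (N i * \<Lambda> (D - 2)))"
    \<comment> \<open>One hop is lost from \<open>k\<close> to \<open>i\<close>, another from an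
      agent to the neighbours on which its next state depends.\<close>
    proof (rule St.E_mixed_diff_le[where B = "\<lambda>i. {j. d i j < D - 2}"])
      fix i assume i: "i \<in> I"
      show "half_l1 (S i) (\<nu> s a i) (\<nu> ?s ?a i) \<le> C i k"
        using * i by (intro \<nu>_influence)
      show "0 \<le> N i * \<Lambda> (D - 2)"
        using N[OF i] \<Lambda>_pos[of "D - 2"] by simp
      show "\<nu> s a i = \<nu> ?s ?a i \<and> \<nu> s' a' i = \<nu> ?s' ?a' i \<or>
        \<nu> s a i = \<nu> s' a' i \<and> \<nu> ?s ?a i = \<nu> ?s' ?a' i \<and>
        (\<forall>j\<in>I \<inter> {j. d i j < D - 2}. \<nu> s a j = \<nu> s' a' j \<and> \<nu> ?s ?a j = \<nu> ?s' ?a' j) \<and>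
        (\<forall>w\<in>PiE I S. \<forall>w'\<in>PiE I S. \<forall>z\<in>S i. \<forall>z'\<in>S i. (\<forall>j\<in>I \<inter> {j. d i j < D - 2}. w j = w' j) \<longrightarrow>
          V (w(i := z)) - V (w(i := z')) - (V (w'(i := z)) - V (w'(i := z'))) \<le> N i * \<Lambda> (D - 2))"
      proof (cases "d k i \<le> 1")
        case True
        have near: "\<nu> s a j = \<nu> s' a' j \<and> \<nu> ?s ?a j = \<nu> ?s' ?a' j" if j: "j \<in> I" "d k j + 1 < D" for j
        proof -
          have "s l = s' l" if "l \<in> I" "d j l \<le> 1" for l
            using agree d_triangle[OF *(1) j(1) that(1)] that j by force
          moreover have "a j = a' j"
            using agree j by auto
          ultimately show ?thesis
            using j * C by (intro conjI \<nu>_local) auto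
        qed
        have nb: "\<nu> s a j = \<nu> s' a' j \<and> \<nu> ?s ?a j = \<nu> ?s' ?a' j" if j: "j \<in> I" "d i j < D - 2" for j
          using near[OF j(1)] d_triangle[OF *(1) i j(1)] True j by linarith
        have mixed: "V (w(i := z)) - V (w(i := z')) - (V (w'(i := z)) - V (w'(i := z'))) \<le> N i * \<Lambda> (D - 2)"
          if "w \<in> PiE I S" "w' \<in> PiE I S" "z \<in> S i" "z' \<in> S i" "\<forall>j\<in>I \<inter> {j. d i j < D - 2}. w j = w' j" for w w' z z'
          using state_decay_mixed[OF V i that(1-4), of "D - 2"] False that(5) by (auto simp: abs_le_iff)
        show ?thesis
          using near[OF i] True False nb mixed by auto
      next
        case far: False
        then have "i \<noteq> k" "\<not> d i k \<le> 1"
          using d_refl[OF *(1)] d_sym[OF *(1) i] by auto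
        then have "\<nu> s a i = \<nu> ?s ?a i" "\<nu> s' a' i = \<nu> ?s' ?a' i"
          using * C i by (auto intro!: \<nu>_local)
        then show ?thesis
          by simp
      qed
    qed (use * C in \<open>auto intro!: \<nu>_laws\<close>)
    also have "\<dots> = X * \<Lambda> (D - 2)"
      by (simp add: X_def sum_distrib_right mult.assoc)
    finally have 1: "\<bar>?M\<bar> \<le> X * \<Lambda> (D - 2)" .
    have "\<Lambda> (D - 2) * \<Lambda> 2 \<le> \<Lambda> D"
      by (intro \<Lambda>_mult_le) auto
    then have "X * \<Lambda> (D - 2) \<le> X * \<Lambda> D / \<eta>"
      using X \<eta>_pos by (simp add: decay_def pos_le_divide_eq mult.assoc mult_left_mono)
    with 1 show ?thesis
      by linarith
  qed
  then have "\<gamma> * \<bar>?M\<bar> \<le> \<gamma> * (X * \<Lambda> D / \<eta>)"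
    using \<gamma> by (intro mult_left_mono) auto
  moreover have "qfun V ?s ?a - qfun V s a - (qfun V ?s' ?a' - qfun V s' a') = \<gamma> * ?M"
    using rew by (simp add: qfun_def algebra_simps)
  ultimately have "\<bar>qfun V ?s ?a - qfun V s a - (qfun V ?s' ?a' - qfun V s' a')\<bar> \<le> \<gamma> / \<eta> * X * \<Lambda> D"
    using \<gamma> by (simp add: abs_mult)
  also have "\<dots> \<le> q_const N k * \<Lambda> D"
    using R_nonneg card_index_pos \<Lambda>_pos[of D] by (intro mult_right_mono) (auto simp: q_const_def X_def)
  finally show "\<bar>qfun V ?s ?a - qfun V s a - (qfun V ?s' ?a' - qfun V s' a')\<bar> \<le> q_const N k * \<Lambda> D" .
qed

end

section \<open>Value iteration\<close>

context decay_mdp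
begin

primrec val_iter :: "nat \<Rightarrow> ('i \<Rightarrow> 's) \<Rightarrow> real" where
  "val_iter 0 = (\<lambda>_. 0)"
| "val_iter (Suc m) = (\<lambda>s. opt_val (qfun (val_iter m) s))"

lemma qfun_diff_le:
  assumes "s \<in> PiE I S" "a \<in> PiE I A" "\<And>s. s \<in> PiE I S \<Longrightarrow> \<bar>V s - W s\<bar> \<le> c"
  shows "\<bar>qfun V s a - qfun W s a\<bar> \<le> \<gamma> * c"
proof -
  have "\<bar>St.E (\<nu> s a) (\<lambda>s. V s - W s)\<bar> \<le> c"
    using assms by (intro St.E_abs_le \<nu>_laws) auto
  then have "\<gamma> * \<bar>St.E (\<nu> s a) V - St.E (\<nu> s a) W\<bar> \<le> \<gamma> * c"
    using \<gamma> by (intro mult_left_mono) (auto simp: St.E_diff)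
  moreover have "qfun V s a - qfun W s a = \<gamma> * (St.E (\<nu> s a) V - St.E (\<nu> s a) W)"
    by (simp add: qfun_def algebra_simps)
  ultimately show ?thesis
    using \<gamma> by (simp add: abs_mult)
qed

lemma val_iter_contraction:
  obtains c where "\<And>m s. s \<in> PiE I S \<Longrightarrow> \<bar>val_iter (Suc m) s - val_iter m s\<bar> \<le> \<gamma> ^ m * c"
proof
  let ?c = "Max ((\<lambda>s. \<bar>val_iter 1 s - val_iter 0 s\<bar>) ` PiE I S)"
  show "\<bar>val_iter (Suc m) s - val_iter m s\<bar> \<le> \<gamma> ^ m * ?c" if "s \<in> PiE I S" for m s
    using that
  proof (induction m arbitrary: s)
    case 0
    then show ?case
      using St.finite_configs by (auto intro!: Max_ge)
  next
    case (Suc m)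
    have q: "\<bar>qfun (val_iter (Suc m)) s a - qfun (val_iter m) s a\<bar> \<le> \<gamma> * (\<gamma> ^ m * ?c)" if "a \<in> PiE I A" for a
      by (rule qfun_diff_le[OF Suc.prems that Suc.IH])
    then have "opt_val (qfun (val_iter (Suc m)) s) - opt_val (qfun (val_iter m) s) \<le> \<gamma> * (\<gamma> ^ m * ?c)"
      "opt_val (qfun (val_iter m) s) - opt_val (qfun (val_iter (Suc m)) s) \<le> \<gamma> * (\<gamma> ^ m * ?c)"
      by (intro opt_val_diff_le; force simp only: abs_le_iff)+
    then show ?case
      unfolding val_iter.simps(2)[of "Suc m"] val_iter.simps(2)[of m] power_Suc mult.assoc
      by (simp only: abs_le_iff minus_diff_eq)
  qed
qed

section \<open>Constants and the invariant of the iteration\<close>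

context
  fixes K :: real
  assumes K: "K = (4 - 3 * \<gamma>) / (4 - 5 * \<gamma>)" and \<gamma>_less: "\<gamma> < 4 / 5" and \<tau>_ge: "12 * (R * K) \<le> \<tau>"
begin

text \<open>
  With \<open>Z = 12/5 R K\<close> this closes the invariant \<open>\<Sum>N \<le> 3 R K\<close> of the value iteration, because
  \<open>\<tau> \<ge> 12 R K = 5 Z\<close> makes the maximization step cost only a factor \<open>\<tau> / (\<tau> - Z) \<le> 5/4\<close>.
\<close>

lemma K_ge: "2 + 3 / 2 * \<gamma> * K \<le> 12 / 5 * K" "0 < K"
proof -
  have pos: "0 < 4 - 5 * \<gamma>"
    using \<gamma>_less by simp
  have "0 \<le> (12 / 5 - 3 / 2 * \<gamma>) * (4 - 3 * \<gamma>) - 2 * (4 - 5 * \<gamma>)"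
  proof -
    have "(12 / 5 - 3 / 2 * \<gamma>) * (4 - 3 * \<gamma>) - 2 * (4 - 5 * \<gamma>)
        = 9 / 2 * (\<gamma> - 16 / 45)\<^sup>2 + (8 / 5 - 9 / 2 * (16 / 45)\<^sup>2)"
      by (simp add: power2_eq_square field_simps)
    moreover have "(0::real) \<le> 8 / 5 - 9 / 2 * (16 / 45)\<^sup>2"
      by (simp add: power2_eq_square)
    ultimately show ?thesis
      by simp
  qed
  then have "2 * (4 - 5 * \<gamma>) \<le> (12 / 5 - 3 / 2 * \<gamma>) * (4 - 3 * \<gamma>)"
    by linarith
  also have "4 - 3 * \<gamma> = K * (4 - 5 * \<gamma>)"
    using pos by (simp add: K)
  finally have "2 * (4 - 5 * \<gamma>) \<le> ((12 / 5 - 3 / 2 * \<gamma>) * K) * (4 - 5 * \<gamma>)"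
    by (simp only: mult.assoc)
  then have "2 \<le> (12 / 5 - 3 / 2 * \<gamma>) * K"
    using pos by (rule mult_right_le_imp_le)
  then show "2 + 3 / 2 * \<gamma> * K \<le> 12 / 5 * K"
    by (simp add: left_diff_distrib)
  show "0 < K"
    using pos \<gamma>_less by (simp add: K)
qed

lemma Z_bound: "12 / 5 * (R * K) < \<tau>" "\<tau> / (\<tau> - 12 / 5 * (R * K)) \<le> 5 / 4" "0 \<le> R * K"
proof -
  show RK: "0 \<le> R * K"
    using R_nonneg K_ge by simp
  then show 1: "12 / 5 * (R * K) < \<tau>"
    using \<tau>_ge temp_pos by linarith
  then show "\<tau> / (\<tau> - 12 / 5 * (R * K)) \<le> 5 / 4"
    using \<tau>_ge by (subst pos_divide_le_eq) (auto simp: right_diff_distrib mult.commute[of K R])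
qed

lemma sum_q_const_le_Z:
  assumes "\<And>i. i \<in> I \<Longrightarrow> 0 \<le> N i" "sum N I \<le> 3 * (R * K)"
  shows "sum (q_const N) I \<le> 12 / 5 * (R * K)"
proof -
  have "sum (q_const N) I \<le> 2 * R + \<gamma> / 2 * sum N I"
    using assms(1) by (rule sum_q_const_le)
  also have "\<gamma> / 2 * sum N I \<le> \<gamma> / 2 * (3 * (R * K))"
    using assms(2) \<gamma> by (intro mult_left_mono) auto
  also have "2 * R + \<gamma> / 2 * (3 * (R * K)) = R * (2 + 3 / 2 * \<gamma> * K)"
    by (simp add: algebra_simps)
  also have "\<dots> \<le> R * (12 / 5 * K)"
    using R_nonneg K_ge by (intro mult_left_mono) auto
  finally show ?thesis
    by simp
qed

text \<open>The weights \<open>N\<close> may change with \<open>m\<close>; their sum stays bounded,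
  since \<open>12 / 5 * (5 / 4) = 3\<close>.\<close>

lemma state_decay_val_iter: "\<exists>N. state_decay (val_iter m) N \<and> sum N I \<le> 3 * (R * K)"
proof (induction m)
  case 0
  have "state_decay (val_iter 0) (\<lambda>_. 0)"
    by (simp add: state_decay_def)
  then show ?case
    using Z_bound(3) by (intro exI[of _ "\<lambda>_. 0"]) (simp add: mult.commute[of K R])
next
  case (Suc m)
  then obtain N where N: "state_decay (val_iter m) N" "sum N I \<le> 3 * (R * K)"
    by auto
  let ?Z = "12 / 5 * (R * K)"
  have Z: "sum (q_const N) I \<le> ?Z"
    using N state_decay_nonneg[OF N(1)] by (intro sum_q_const_le_Z)
  have Q: "joint_decay (qfun (val_iter m)) (q_const N)"
    using N(1) by (rule joint_decay_qfun)
  have "state_decay (val_iter (Suc m)) (\<lambda>k. q_const N k * (\<tau> / (\<tau> - ?Z)))"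
    using state_decay_opt_val[OF Q Z Z_bound(1)] by simp
  moreover have "(\<Sum>k\<in>I. q_const N k * (\<tau> / (\<tau> - ?Z))) \<le> 3 * (R * K)"
  proof -
    have "(\<Sum>k\<in>I. q_const N k * (\<tau> / (\<tau> - ?Z))) = sum (q_const N) I * (\<tau> / (\<tau> - ?Z))"
      by (simp only: sum_distrib_right)
    also have "\<dots> \<le> ?Z * (5 / 4)"
      using Z Z_bound temp_pos joint_decay_nonneg[OF Q]
      by (intro mult_mono) (auto intro!: sum_nonneg divide_nonneg_nonneg)
    finally show ?thesis
      by (simp add: mult.commute[of K R])
  qed
  ultimately show ?case
    by blast
qed

text \<open>\<open>W\<close> is an iterate so late that one more step moves it by at most
  \<open>e\<close>. It thus almost dominates the energy of every law and is almost reached by the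
  truncated maximizers. The constant 3/5 is \<open>12 / 5 * (1 / 4)\<close>, from
  \<open>Z / (\<tau> - Z) \<le> 1 / 4\<close>.\<close>

lemma near_optimal_truncation:
  assumes e: "0 < e"
  shows "\<exists>W. (\<forall>s\<in>PiE I S. \<forall>x\<in>laws. energy (qfun W s) x \<le> W s + e) \<and>
    (\<forall>s\<in>PiE I S. \<forall>\<sigma>. (\<forall>i\<in>I. \<sigma> i \<in> PiE I S \<and> (\<forall>j\<in>I. d i j < D \<longrightarrow> s j = \<sigma> i j)) \<longrightarrow>
      W s - (3 / 5 * (R * K * \<Lambda> D) + e) \<le> energy (qfun W s) (\<lambda>i. opt_law (qfun W (\<sigma> i)) i))"
proof -
  obtain c where c: "\<And>m s. s \<in> PiE I S \<Longrightarrow> \<bar>val_iter (Suc m) s - val_iter m s\<bar> \<le> \<gamma> ^ m * c"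
    using val_iter_contraction by blast
  have "(\<lambda>m. \<gamma> ^ m * c) \<longlonglongrightarrow> 0 * c"
    using \<gamma> by (intro tendsto_intros LIMSEQ_realpow_zero) auto
  then have "\<forall>\<^sub>F m in sequentially. \<gamma> ^ m * c < e"
    using e by (intro order_tendstoD) auto
  then obtain m where m: "\<gamma> ^ m * c < e"
    by (auto simp: eventually_sequentially)
  let ?W = "val_iter m"
  let ?Z = "12 / 5 * (R * K)"
  have close: "\<bar>opt_val (qfun ?W s) - ?W s\<bar> \<le> e" if "s \<in> PiE I S" for s
    using c[OF that, of m] m by simp
  obtain N where N: "state_decay ?W N" "sum N I \<le> 3 * (R * K)"
    using state_decay_val_iter by blast
  have Z: "sum (q_const N) I \<le> ?Z"
    using N state_decay_nonneg[OF N(1)] by (intro sum_q_const_le_Z)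
  have Q: "joint_decay (qfun ?W) (q_const N)"
    using N(1) by (rule joint_decay_qfun)
  have pos: "0 < \<tau> - ?Z"
    using Z_bound(1) by simp
  have "?Z / (\<tau> - ?Z) \<le> 1 / 4"
    using pos \<tau>_ge by (subst pos_divide_le_eq) (auto simp: right_diff_distrib mult.commute[of K R])
  then have "?Z * (?Z / (\<tau> - ?Z) * \<Lambda> D) \<le> ?Z * (1 / 4 * \<Lambda> D)"
    using Z_bound(3) \<Lambda>_pos[of D] by (intro mult_left_mono mult_right_mono) auto
  also have "\<dots> = 3 / 5 * (R * K * \<Lambda> D)"
    by simp
  finally have zb: "?Z * (?Z / (\<tau> - ?Z) * \<Lambda> D) \<le> 3 / 5 * (R * K * \<Lambda> D)" .
  show ?thesis
  proof (intro exI[of _ ?W] conjI ballI allI impI)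
    fix s x assume *: "s \<in> PiE I S" "x \<in> laws"
    show "energy (qfun ?W s) x \<le> ?W s + e"
      using energy_le_opt_val[OF *(2), of "qfun ?W s"] close[OF *(1)] by linarith
  next
    fix s \<sigma> assume *: "s \<in> PiE I S" "\<forall>i\<in>I. \<sigma> i \<in> PiE I S \<and> (\<forall>j\<in>I. d i j < D \<longrightarrow> s j = \<sigma> i j)"
    have "opt_val (qfun ?W s) - energy (qfun ?W s) (\<lambda>i. opt_law (qfun ?W (\<sigma> i)) i) \<le> ?Z * (?Z / (\<tau> - ?Z) * \<Lambda> D)"
      using * by (intro truncated_energy_gap[OF Q Z Z_bound(1)]) auto
    then show "?W s - (3 / 5 * (R * K * \<Lambda> D) + e) \<le> energy (qfun ?W s) (\<lambda>i. opt_law (qfun ?W (\<sigma> i)) i)"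
      using zb close[OF *(1)] by linarith
  qed
qed

end

end

section \<open>From powers of \<open>\<eta>\<close> to powers of the radius\<close>

lemma of_nat_le_two_power_half: "real x \<le> 2 ^ ((x + 1) div 2)"
proof (induction x rule: less_induct)
  case (less x)
  show ?case
  proof (cases "x < 4")
    case True
    then have "x = 0 \<or> x = 1 \<or> x = 2 \<or> x = 3"
      by auto
    then show ?thesis
      by auto
  next
    case False
    \<comment> \<open>For \<open>x \<ge> 4\<close> one has \<open>x \<le> 2 * (x - 2)\<close>, while
      the exponent grows by exactly one.\<close>
    then have "real (x - 2) \<le> 2 ^ ((x - 2 + 1) div 2)"
      by (intro less) auto
    moreover have "(x + 1) div 2 = Suc ((x - 2 + 1) div 2)"
      using False by auto
    ultimately show ?thesis
      using False by simp
  qed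
qed

text \<open>Writing \<open>\<eta> = 2 powr log 2 \<eta>\<close> exchanges base and exponent. As
  \<open>log 2 \<eta> \<le> 0\<close>, the power increases when its base is lowered to
  \<open>x\<close>.\<close>

lemma decay_le_powr:
  assumes "0 < \<eta>" "\<eta> \<le> 1" "0 < x"
  shows "decay \<eta> x \<le> real x powr (log 2 \<eta>)"
proof -
  have l: "log 2 \<eta> \<le> 0"
    using assms by simp
  have "decay \<eta> x = (2 powr log 2 \<eta>) powr real ((x + 1) div 2)"
    using assms by (simp add: decay_def powr_realpow)
  also have "\<dots> = (2 powr real ((x + 1) div 2)) powr log 2 \<eta>"
    by (simp add: powr_powr mult.commute)
  also have "\<dots> = (2 ^ ((x + 1) div 2)) powr log 2 \<eta>"
    by (simp add: powr_realpow)
  also have "\<dots> \<le> real x powr log 2 \<eta>"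
    using assms l of_nat_le_two_power_half[of x] by (intro powr_mono2') auto
  finally show ?thesis .
qed

section \<open>Hop distances\<close>

lemma (in pair_pseudo_graph) awalk_reverse:
  "awalk u p v \<Longrightarrow> awalk v (rev (map prod.swap p)) u"
proof (induction p arbitrary: u)
  case Nil
  then show ?case
    by (auto simp: awalk_Nil_iff)
next
  case (Cons e p)
  obtain a b where e: "e = (a, b)"
    by (cases e)
  with Cons.prems have *: "(a, b) \<in> parcs G" "u = a" "awalk b p v"
    by (auto simp: awalk_Cons_iff)
  then have "awalk b [(b, a)] a"
    using arcs_symmetric[of a b] by (auto simp: awalk_Cons_iff awalk_Nil_iff in_arcsD1)
  with Cons.IH[OF *(3)] * e show ?case
    by (auto intro: awalk_appendI)
qed

context networked_mdp
begin

interpretation G: pair_graph "network M"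
  by (rule network_graph)

abbreviation walk :: "nat \<Rightarrow> (nat \<times> nat) list \<Rightarrow> nat \<Rightarrow> bool" where
  "walk \<equiv> pre_digraph.awalk (with_proj (network M))"

text \<open>The distance is an infimum of walk costs. The bound \<open>m\<close> is relaxed to a
  strict bound \<open>Suc m\<close>, which some walk meets, and lengths are integers.\<close>

lemma graph_dist_le_iff:
  "graph_dist M i j \<le> ereal (real m) \<longleftrightarrow> (\<exists>p. walk i p j \<and> length p \<le> m)"
proof
  have cost: "G.awalk_cost (\<lambda>_. 1) p = real (length p)" for p
    by (simp add: G.awalk_cost_def sum_list_triv)
  show "\<exists>p. walk i p j \<and> length p \<le> m" if le: "graph_dist M i j \<le> ereal (real m)"
  proof -
    have "ereal (real m) < ereal (real (Suc m))"
      by simp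
    with le have "graph_dist M i j < ereal (real (Suc m))"
      by (rule order_le_less_trans)
    then obtain p where "walk i p j" "ereal (G.awalk_cost (\<lambda>_. 1) p) < ereal (real (Suc m))"
      by (auto simp: graph_dist_def G.\<mu>_def INF_less_iff)
    then show ?thesis
      by (auto simp: cost intro!: exI[of _ p])
  qed
  show "graph_dist M i j \<le> ereal (real m)" if ex: "\<exists>p. walk i p j \<and> length p \<le> m"
  proof -
    from ex obtain p where p: "walk i p j" "length p \<le> m"
      by blast
    have "graph_dist M i j \<le> ereal (G.awalk_cost (\<lambda>_. 1) p)"
      unfolding graph_dist_def by (rule G.min_cost_le_walk_cost[OF p(1)])
    also have "\<dots> \<le> ereal (real m)"
      using p by (simp add: cost)
    finally show ?thesis .
  qed
qed

lemma nbhd_iff: "j \<in> nbhd M m i \<longleftrightarrow> j \<in> agents M \<and> (\<exists>p. walk i p j \<and> length p \<le> m)"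
  by (simp add: nbhd_def graph_dist_le_iff)

lemma nbhd_subset: "nbhd M m i \<subseteq> agents M"
  by (simp add: nbhd_def)

lemma nbhd_refl: "i \<in> agents M \<Longrightarrow> i \<in> nbhd M m i"
  unfolding nbhd_iff using network_verts by (auto intro!: exI[of _ "[]"] simp: G.awalk_Nil_iff)

lemma nbhd_mono: "m \<le> m' \<Longrightarrow> j \<in> nbhd M m i \<Longrightarrow> j \<in> nbhd M m' i"
  unfolding nbhd_iff by (meson order_trans)

lemma nbhd_sym: "i \<in> agents M \<Longrightarrow> j \<in> nbhd M m i \<Longrightarrow> i \<in> nbhd M m j"
  unfolding nbhd_iff using G.awalk_reverse by (metis length_map length_rev)

lemma nbhd_trans: "j \<in> nbhd M m i \<Longrightarrow> k \<in> nbhd M m' j \<Longrightarrow> k \<in> nbhd M (m + m') i"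
  unfolding nbhd_iff by (metis G.awalk_appendI add_mono length_append)

text \<open>The hop distance capped at \<open>L\<close>, so that it is finite also across connected components.\<close>

definition hops :: "nat \<Rightarrow> nat \<Rightarrow> nat \<Rightarrow> nat" where
  "hops L i j = (LEAST m. m = L \<or> j \<in> nbhd M m i)"

lemma hops_cases: "hops L i j = L \<or> j \<in> nbhd M (hops L i j) i"
  unfolding hops_def by (rule LeastI[of "\<lambda>m. m = L \<or> j \<in> nbhd M m i" L]) simp

lemma hops_le: "hops L i j \<le> L"
  unfolding hops_def by (rule Least_le) simp

lemma hops_le_nbhd: "j \<in> nbhd M m i \<Longrightarrow> hops L i j \<le> m"
  unfolding hops_def by (rule Least_le) simp

text \<open>Below the cap the value is a true hop count. With the cap \<open>\<kappa> + 1\<close>,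
  being below it amounts to lying in the \<open>\<kappa>\<close>-hop neighbourhood.\<close>

lemma hops_less_nbhd: "hops L i j < L \<Longrightarrow> hops L i j \<le> m \<Longrightarrow> j \<in> nbhd M m i"
  using hops_cases[of L i j] nbhd_mono by auto

lemma hops_refl: "i \<in> agents M \<Longrightarrow> hops L i i = 0"
  using hops_le_nbhd[OF nbhd_refl, where m = 0] by fastforce

lemma hops_sym_le: "i \<in> agents M \<Longrightarrow> hops L j i \<le> hops L i j"
  using hops_cases[of L i j] hops_le[of L j i] hops_le_nbhd[OF nbhd_sym] by auto

lemma hops_sym: "i \<in> agents M \<Longrightarrow> j \<in> agents M \<Longrightarrow> hops L i j = hops L j i"
  by (intro antisym hops_sym_le)

lemma hops_triangle: "hops L i k \<le> hops L i j + hops L j k"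
  using hops_cases[of L i j] hops_cases[of L j k] hops_le[of L i k] hops_le_nbhd[OF nbhd_trans]
  by force

end

section \<open>Bellman defects along trajectories\<close>

definition action_kernel :: "('s, 'a) nmdp \<Rightarrow> ('s, 'a) joint_policy \<Rightarrow> (nat \<Rightarrow> 's) \<Rightarrow> ((nat \<Rightarrow> 's) \<times> (nat \<Rightarrow> 'a)) pmf" where
  "action_kernel M \<zeta> x = do { a \<leftarrow> joint_action_pmf M \<zeta> x; return_pmf (x, a) }"

text \<open>The value integrates a sum of functions of single times, so it is determined by the
  one-time marginals of the trajectory.\<close>

primrec state_law :: "('s, 'a) nmdp \<Rightarrow> ('s, 'a) joint_policy \<Rightarrow> (nat \<Rightarrow> 's) \<Rightarrow> nat \<Rightarrow> (nat \<Rightarrow> 's) pmf" where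
  "state_law M \<zeta> s 0 = return_pmf s"
| "state_law M \<zeta> s (Suc t) = do { x \<leftarrow> state_law M \<zeta> s t; a \<leftarrow> joint_action_pmf M \<zeta> x; transition M x a }"

definition pair_law :: "('s, 'a) nmdp \<Rightarrow> ('s, 'a) joint_policy \<Rightarrow> (nat \<Rightarrow> 's) \<Rightarrow> nat \<Rightarrow> ((nat \<Rightarrow> 's) \<times> (nat \<Rightarrow> 'a)) pmf" where
  "pair_law M \<zeta> s t = bind_pmf (state_law M \<zeta> s t) (action_kernel M \<zeta>)"

lemma pair_law_Suc:
  "pair_law M \<zeta> s (Suc t) = bind_pmf (pair_law M \<zeta> s t)
    (\<lambda>z. bind_pmf (transition M (fst z) (snd z)) (action_kernel M \<zeta>))"
  by (simp add: pair_law_def action_kernel_def bind_assoc_pmf bind_return_pmf)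

context
  fixes M :: "('s, 'a) nmdp" and \<zeta> :: "('s, 'a) joint_policy" and s :: "nat \<Rightarrow> 's"
begin

interpretation IT: Ionescu_Tulcea "step_kernel M \<zeta> s" "\<lambda>_. count_space UNIV"
  by (rule Ionescu_Tulcea_step_kernel)

text \<open>The Markov property turns a function \<open>g\<close> of the last coordinate into a
  function \<open>G\<close> of the one before, to which the induction applies; \<open>g\<close> is
  therefore arbitrary.\<close>

lemma nn_integral_prefix:
  "(\<integral>\<^sup>+\<omega>. g (\<omega> t) \<partial>IT.C 0 (Suc t) (\<lambda>_. undefined)) = (\<integral>\<^sup>+z. g z \<partial>measure_pmf (pair_law M \<zeta> s t))"
proof (induction t arbitrary: g)
  have step: "(\<integral>\<^sup>+\<omega>. g (\<omega> t) \<partial>IT.C 0 (Suc t) (\<lambda>_. undefined)) =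
      (\<integral>\<^sup>+\<omega>. (\<integral>\<^sup>+z. g z \<partial>step_kernel M \<zeta> s t \<omega>) \<partial>IT.C 0 t (\<lambda>_. undefined))"
    for t and g :: "(nat \<Rightarrow> 's) \<times> (nat \<Rightarrow> 'a) \<Rightarrow> ennreal"
  proof -
    have u: "(\<lambda>_. undefined) \<in> space (PiM {0..<0::nat} (\<lambda>_. count_space (UNIV :: ((nat \<Rightarrow> 's) \<times> (nat \<Rightarrow> 'a)) set)))"
      by (simp add: space_PiM)
    have g: "(\<lambda>\<omega>. g (\<omega> t)) \<in> borel_measurable (PiM {0..<Suc t} (\<lambda>_. count_space UNIV))"
      by (rule measurable_compose[OF measurable_component_singleton]) auto
    have "IT.eP t \<in> measurable (IT.C 0 t (\<lambda>_. undefined)) (subprob_algebra (PiM {0..<Suc t} (\<lambda>_. count_space UNIV)))"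
    proof -
      have "sets (IT.C 0 t (\<lambda>_. undefined)) = sets (PiM {0..<t} (\<lambda>_. count_space UNIV))"
        using IT.sets_C[OF u, of t] by simp
      then show ?thesis
        using IT.measurable_eP[of t] by (simp cong: measurable_cong_sets)
    qed
    then have "(\<integral>\<^sup>+\<omega>. g (\<omega> t) \<partial>IT.C 0 (Suc t) (\<lambda>_. undefined)) =
      (\<integral>\<^sup>+\<omega>. (\<integral>\<^sup>+\<omega>'. g (\<omega>' t) \<partial>IT.eP t \<omega>) \<partial>IT.C 0 t (\<lambda>_. undefined))"
      using nn_integral_bind[OF g] by simp
    also have "\<dots> = (\<integral>\<^sup>+\<omega>. (\<integral>\<^sup>+z. g z \<partial>step_kernel M \<zeta> s t \<omega>) \<partial>IT.C 0 t (\<lambda>_. undefined))"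
      using g by (intro nn_integral_cong) (simp add: IT.space_C[OF u] IT.nn_integral_eP)
    finally show ?thesis .
  qed
  case 0
  show ?case
    unfolding step
    by (simp add: step_kernel_def pair_law_def action_kernel_def[abs_def] bind_return_pmf nn_integral_return space_PiM emeasure_return sets_PiM_empty)
  case (Suc t)
  define G where "G z = (\<integral>\<^sup>+z'. g z' \<partial>measure_pmf (bind_pmf (transition M (fst z) (snd z)) (action_kernel M \<zeta>)))" for z
  have "(\<integral>\<^sup>+\<omega>. g (\<omega> (Suc t)) \<partial>IT.C 0 (Suc (Suc t)) (\<lambda>_. undefined)) =
    (\<integral>\<^sup>+\<omega>. G (\<omega> t) \<partial>IT.C 0 (Suc t) (\<lambda>_. undefined))"
    unfolding step[of "Suc t" g] by (simp del: IT.C.simps add: step_kernel_def action_kernel_def[abs_def] G_def)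
  also have "\<dots> = (\<integral>\<^sup>+z. G z \<partial>measure_pmf (pair_law M \<zeta> s t))"
    by (rule Suc.IH)
  also have "\<dots> = (\<integral>\<^sup>+z. g z \<partial>measure_pmf (pair_law M \<zeta> s (Suc t)))"
    by (simp only: G_def pair_law_Suc nn_integral_bind_pmf)
  finally show ?case .
qed

lemma sets_trajectory: "sets (trajectory M \<zeta> s) = sets (PiM UNIV (\<lambda>_. count_space UNIV))"
  unfolding trajectory_def by (rule IT.PF.sets_lim)

lemma measurable_trajectory [measurable]: "(\<lambda>\<omega>. f (\<omega> t)) \<in> measurable (trajectory M \<zeta> s) (count_space UNIV)"
  unfolding measurable_cong_sets[OF sets_trajectory refl]
  by (rule measurable_compose[OF measurable_component_singleton]) auto

text \<open>The event is a cylinder over the single index \<open>t\<close>, and the projective limit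
  reduces its measure to the law of the first \<open>Suc t\<close> steps.\<close>

lemma distr_trajectory:
  "distr (trajectory M \<zeta> s) (count_space UNIV) (\<lambda>\<omega>. \<omega> t) = measure_pmf (pair_law M \<zeta> s t)"
proof (rule measure_eqI)
  fix X :: "((nat \<Rightarrow> 's) \<times> (nat \<Rightarrow> 'a)) set"
  let ?N = "\<lambda>_::nat. count_space (UNIV :: ((nat \<Rightarrow> 's) \<times> (nat \<Rightarrow> 'a)) set)"
  let ?Y = "PiE {t} (\<lambda>_. X)"
  have u: "(\<lambda>_. undefined) \<in> space (PiM {0..<0::nat} ?N)"
    by (simp add: space_PiM)
  have Y: "?Y \<in> sets (PiM {t} ?N)"
    by (intro sets_PiM_I_finite) auto
  have "emeasure (distr (trajectory M \<zeta> s) (count_space UNIV) (\<lambda>\<omega>. \<omega> t)) X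
      = emeasure (trajectory M \<zeta> s) ((\<lambda>\<omega>. \<omega> t) -` X \<inter> space (trajectory M \<zeta> s))"
    using measurable_trajectory[of "\<lambda>z. z" t] by (intro emeasure_distr) auto
  also have "(\<lambda>\<omega>. \<omega> t) -` X \<inter> space (trajectory M \<zeta> s) = IT.PF.emb UNIV {t} ?Y"
    using sets_eq_imp_space_eq[OF sets_trajectory] by (auto simp: prod_emb_def space_PiM PiE_iff)
  also have "emeasure (trajectory M \<zeta> s) \<dots> = emeasure (IT.CI {t}) ?Y"
    unfolding trajectory_def using Y by (intro IT.lim) auto
  also have "\<dots> = emeasure (IT.C 0 (Suc t) (\<lambda>_. undefined)) (IT.PF.emb {0..<Suc t} {t} ?Y)"
    using Y by (intro IT.emeasure_CI) auto
  also have "\<dots> = (\<integral>\<^sup>+\<omega>. indicator (IT.PF.emb {0..<Suc t} {t} ?Y) \<omega> \<partial>IT.C 0 (Suc t) (\<lambda>_. undefined))"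
    using Y IT.sets_C[OF u, of "Suc t"] by (intro nn_integral_indicator[symmetric]) (auto intro!: measurable_prod_emb)
  also have "\<dots> = (\<integral>\<^sup>+\<omega>. indicator X (\<omega> t) \<partial>IT.C 0 (Suc t) (\<lambda>_. undefined))"
    by (intro nn_integral_cong)
      (auto simp del: IT.C.simps simp: IT.space_C[OF u] prod_emb_def space_PiM PiE_iff split: split_indicator)
  also have "\<dots> = emeasure (measure_pmf (pair_law M \<zeta> s t)) X"
    unfolding nn_integral_prefix by (simp add: nn_integral_indicator)
  finally show "emeasure (distr (trajectory M \<zeta> s) (count_space UNIV) (\<lambda>\<omega>. \<omega> t)) X
      = emeasure (measure_pmf (pair_law M \<zeta> s t)) X" .
qed simp

end

section \<open>Values of policies through their Bellman operators\<close>

definition bellman :: "('s, 'a) nmdp \<Rightarrow> real \<Rightarrow> real \<Rightarrow> ('s, 'a) joint_policy \<Rightarrow> ((nat \<Rightarrow> 's) \<Rightarrow> real) \<Rightarrow> (nat \<Rightarrow> 's) \<Rightarrow> real" where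
  "bellman M \<gamma> \<tau> \<zeta> W x = measure_pmf.expectation (joint_action_pmf M \<zeta> x)
    (\<lambda>a. reward M x a - \<tau> * ln (pmf (joint_action_pmf M \<zeta> x) a) + \<gamma> * measure_pmf.expectation (transition M x a) W)"

context networked_mdp
begin

lemma finite_agents: "finite (agents M)"
  by (simp add: agents_def)

lemma finite_joint_states: "finite (joint_states M)"
  unfolding joint_states_def partial_states_def using finite_agents states_finite by (intro finite_PiE)

lemma finite_joint_actions: "finite (PiE (agents M) (actions M))"
  using finite_agents actions_finite by (intro finite_PiE)

lemma set_joint_action_pmf:
  assumes "\<zeta> \<in> policies M" "x \<in> joint_states M"
  shows "set_pmf (joint_action_pmf M \<zeta> x) \<subseteq> PiE (agents M) (actions M)"
  using assms finite_agents
  by (auto simp: joint_action_pmf_def set_Pi_pmf PiE_dflt_def policies_def PiE_iff extensional_def)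

lemma set_transition:
  assumes "x \<in> joint_states M" "a \<in> PiE (agents M) (actions M)"
  shows "set_pmf (transition M x a) \<subseteq> joint_states M"
proof
  fix y assume "y \<in> set_pmf (transition M x a)"
  then have *: "y \<in> PiE_dflt (agents M) undefined (\<lambda>i. set_pmf (kernel M i (restrict x (nbhd M 1 i)) (a i)))"
    by (simp add: transition_def set_Pi_pmf finite_agents comp_def)
  have y: "y i = undefined" if "i \<notin> agents M" for i
    using * that by (auto simp: PiE_dflt_def)
  have y': "y i \<in> set_pmf (kernel M i (restrict x (nbhd M 1 i)) (a i))" if "i \<in> agents M" for i
    using * that by (auto simp: PiE_dflt_def)
  have "restrict x (nbhd M 1 i) \<in> partial_states M (nbhd M 1 i)" for i
    using assms by (auto simp: joint_states_def partial_states_def nbhd_def)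
  then have "y i \<in> states M i" if "i \<in> agents M" for i
    using y'[OF that] kernel_states[OF that, of "restrict x (nbhd M 1 i)" "a i"] assms(2) that by auto
  with y show "y \<in> joint_states M"
    by (auto simp: joint_states_def partial_states_def PiE_iff extensional_def)
qed

lemma set_state_law:
  assumes "\<zeta> \<in> policies M" "s \<in> joint_states M"
  shows "set_pmf (state_law M \<zeta> s t) \<subseteq> joint_states M"
proof (induction t)
  case (Suc t)
  show ?case
  proof
    fix y assume "y \<in> set_pmf (state_law M \<zeta> s (Suc t))"
    then obtain x a where "x \<in> set_pmf (state_law M \<zeta> s t)" "a \<in> set_pmf (joint_action_pmf M \<zeta> x)"
      "y \<in> set_pmf (transition M x a)"
      by auto
    then show "y \<in> joint_states M"
      using Suc set_joint_action_pmf[OF assms(1), of x] set_transition[of x a] by blast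
  qed
qed (use assms in auto)

lemma set_pair_law:
  assumes "\<zeta> \<in> policies M" "s \<in> joint_states M"
  shows "set_pmf (pair_law M \<zeta> s t) \<subseteq> joint_states M \<times> PiE (agents M) (actions M)"
  using set_state_law[OF assms, of t] set_joint_action_pmf[OF assms(1)]
  by (fastforce simp: pair_law_def action_kernel_def)

lemma expectation_pair_law:
  fixes g :: "(nat \<Rightarrow> 's) \<times> (nat \<Rightarrow> 'a) \<Rightarrow> real"
  assumes "\<zeta> \<in> policies M" "s \<in> joint_states M"
  shows "measure_pmf.expectation (pair_law M \<zeta> s t) g =
    (\<Sum>x\<in>joint_states M. pmf (state_law M \<zeta> s t) x * measure_pmf.expectation (joint_action_pmf M \<zeta> x) (\<lambda>a. g (x, a)))"
proof -
  have act: "measure_pmf.expectation (action_kernel M \<zeta> x) g = measure_pmf.expectation (joint_action_pmf M \<zeta> x) (\<lambda>a. g (x, a))" for x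
    unfolding action_kernel_def by (simp add: map_pmf_def[symmetric])
  have "finite (set_pmf (action_kernel M \<zeta> x))" if "x \<in> joint_states M" for x
    using set_joint_action_pmf[OF assms(1) that] finite_joint_actions
    by (auto simp: action_kernel_def intro: finite_subset)
  then show ?thesis
    unfolding pair_law_def using set_state_law[OF assms] finite_joint_states
    by (subst pmf_expectation_bind[of "joint_states M"]) (auto simp: act)
qed

lemma expectation_state_law:
  fixes W :: "(nat \<Rightarrow> 's) \<Rightarrow> real"
  assumes "\<zeta> \<in> policies M" "s \<in> joint_states M"
  shows "measure_pmf.expectation (state_law M \<zeta> s t) W = (\<Sum>x\<in>joint_states M. pmf (state_law M \<zeta> s t) x * W x)"
  using set_state_law[OF assms] finite_joint_states
  by (subst integral_measure_pmf_real[of "joint_states M"]) (auto simp: mult.commute)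

lemma expectation_state_law_Suc:
  fixes W :: "(nat \<Rightarrow> 's) \<Rightarrow> real"
  assumes "\<zeta> \<in> policies M" "s \<in> joint_states M"
  shows "measure_pmf.expectation (state_law M \<zeta> s (Suc t)) W =
    (\<Sum>x\<in>joint_states M. pmf (state_law M \<zeta> s t) x *
      measure_pmf.expectation (joint_action_pmf M \<zeta> x) (\<lambda>a. measure_pmf.expectation (transition M x a) W))"
proof -
  have ft: "finite (set_pmf (transition M x a))" if "x \<in> joint_states M" "a \<in> PiE (agents M) (actions M)" for x a
    using set_transition[OF that] finite_joint_states by (rule finite_subset)
  have *: "measure_pmf.expectation (bind_pmf (joint_action_pmf M \<zeta> x) (transition M x)) W =
      measure_pmf.expectation (joint_action_pmf M \<zeta> x) (\<lambda>a. measure_pmf.expectation (transition M x a) W)"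
    if x: "x \<in> joint_states M" for x
    using set_joint_action_pmf[OF assms(1) x] finite_joint_actions ft[OF x]
    by (subst pmf_expectation_bind[of "PiE (agents M) (actions M)"])
      (auto simp: integral_measure_pmf_real[of "PiE (agents M) (actions M)"] subset_iff mult.commute)
  have "finite (set_pmf (bind_pmf (joint_action_pmf M \<zeta> x) (transition M x)))" if "x \<in> joint_states M" for x
    using set_joint_action_pmf[OF assms(1) that] finite_subset[OF set_joint_action_pmf[OF assms(1) that] finite_joint_actions] ft[OF that]
    by auto
  then show ?thesis
    using set_state_law[OF assms] finite_joint_states
    by (simp del: set_bind_pmf) (subst pmf_expectation_bind[of "joint_states M"]; simp add: * del: set_bind_pmf)
qed

text \<open>Almost every trajectory stays in a finite set of state-action pairs, on which the
  regularized reward is bounded although \<open>ln\<close> is not. With \<open>\<gamma> < 1\<close>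
  this allows sum and integral to be exchanged.\<close>

lemma value_fun_eq:
  assumes \<zeta>: "\<zeta> \<in> policies M" and s: "s \<in> joint_states M" and \<gamma>: "0 < \<gamma>" "\<gamma> < 1"
  shows "(\<lambda>t. \<gamma> ^ t * measure_pmf.expectation (pair_law M \<zeta> s t)
      (\<lambda>z. reward M (fst z) (snd z) - \<tau> * ln (pmf (joint_action_pmf M \<zeta> (fst z)) (snd z))))
    sums value_fun M \<gamma> \<tau> \<zeta> s"
proof -
  define f where "f z = reward M (fst z) (snd z) - \<tau> * ln (pmf (joint_action_pmf M \<zeta> (fst z)) (snd z))" for z
  let ?T = "trajectory M \<zeta> s" and ?F = "joint_states M \<times> PiE (agents M) (actions M)"
  have finF: "finite ?F"
    using finite_joint_states finite_joint_actions by simp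
  define B where "B = (\<Sum>z\<in>?F. \<bar>f z\<bar>)"
  have B: "\<bar>f z\<bar> \<le> B" if "z \<in> ?F" for z
    unfolding B_def using finF that by (intro member_le_sum) auto
  have m: "(\<lambda>\<omega>. \<omega> t) \<in> measurable ?T (count_space UNIV)" for t
    using measurable_trajectory[of "\<lambda>z. z"] .
  have int: "integrable ?T (\<lambda>\<omega>. g (\<omega> t))" "(\<integral>\<omega>. g (\<omega> t) \<partial>?T) = measure_pmf.expectation (pair_law M \<zeta> s t) g"
    for g :: "(nat \<Rightarrow> 's) \<times> (nat \<Rightarrow> 'a) \<Rightarrow> real" and t
  proof -
    have "integrable (measure_pmf (pair_law M \<zeta> s t)) g"
      using finite_subset[OF set_pair_law[OF \<zeta> s] finF] by (rule integrable_measure_pmf_finite)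
    then show "integrable ?T (\<lambda>\<omega>. g (\<omega> t))"
      unfolding distr_trajectory[symmetric] using m by (subst (asm) integrable_distr_eq) auto
    show "(\<integral>\<omega>. g (\<omega> t) \<partial>?T) = measure_pmf.expectation (pair_law M \<zeta> s t) g"
      unfolding distr_trajectory[symmetric] using m by (subst integral_distr) auto
  qed
  have "AE \<omega> in ?T. \<forall>t. \<omega> t \<in> ?F"
    unfolding AE_all_countable
  proof
    fix t
    have "AE z in measure_pmf (pair_law M \<zeta> s t). z \<in> ?F"
      using set_pair_law[OF \<zeta> s, of t] by (auto simp: AE_measure_pmf_iff)
    then show "AE \<omega> in ?T. \<omega> t \<in> ?F"
      unfolding distr_trajectory[symmetric] using m by (subst (asm) AE_distr_iff) auto
  qed
  then have summ: "AE \<omega> in ?T. summable (\<lambda>t. norm (\<gamma> ^ t * f (\<omega> t)))"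
  proof (rule AE_mp, intro AE_I2 impI)
    fix \<omega> assume "\<forall>t::nat. \<omega> t \<in> ?F"
    then show "summable (\<lambda>t. norm (\<gamma> ^ t * f (\<omega> t)))"
      using \<gamma> B by (intro summable_comparison_test[OF _ summable_mult2[OF summable_geometric[of \<gamma>], of B]])
        (auto simp: abs_mult intro!: mult_left_mono)
  qed
  have summ2: "summable (\<lambda>t. \<integral>\<omega>. norm (\<gamma> ^ t * f (\<omega> t)) \<partial>?T)"
  proof (rule summable_comparison_test[OF _ summable_mult2[OF summable_geometric[of \<gamma>], of B]])
    have "(\<integral>\<omega>. norm (\<gamma> ^ t * f (\<omega> t)) \<partial>?T) \<le> \<gamma> ^ t * B" for t
    proof -
      have "(\<integral>\<omega>. norm (\<gamma> ^ t * f (\<omega> t)) \<partial>?T) = \<gamma> ^ t * measure_pmf.expectation (pair_law M \<zeta> s t) (\<lambda>z. \<bar>f z\<bar>)"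
        using \<gamma> int(2)[of "\<lambda>z. \<bar>f z\<bar>" t] by (simp add: abs_mult)
      also have "measure_pmf.expectation (pair_law M \<zeta> s t) (\<lambda>z. \<bar>f z\<bar>) \<le> measure_pmf.expectation (pair_law M \<zeta> s t) (\<lambda>_. B)"
        using finite_subset[OF set_pair_law[OF \<zeta> s] finF] set_pair_law[OF \<zeta> s, of t] B
        by (intro integral_mono_AE integrable_measure_pmf_finite) (auto simp: AE_measure_pmf_iff)
      finally show ?thesis
        using \<gamma> by (simp add: mult_left_mono)
    qed
    moreover have "0 \<le> (\<integral>\<omega>. norm (\<gamma> ^ t * f (\<omega> t)) \<partial>?T)" for t
      by simp
    ultimately show "\<exists>N. \<forall>t\<ge>N. norm (\<integral>\<omega>. norm (\<gamma> ^ t * f (\<omega> t)) \<partial>?T) \<le> \<gamma> ^ t * B"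
      by simp
  qed (use \<gamma> in auto)
  have "(\<lambda>t. \<integral>\<omega>. \<gamma> ^ t * f (\<omega> t) \<partial>?T) sums (\<integral>\<omega>. (\<Sum>t. \<gamma> ^ t * f (\<omega> t)) \<partial>?T)"
    using int(1) by (intro sums_integral summ summ2) auto
  then have "(\<lambda>t. \<gamma> ^ t * measure_pmf.expectation (pair_law M \<zeta> s t) f) sums (\<integral>\<omega>. (\<Sum>t. \<gamma> ^ t * f (\<omega> t)) \<partial>?T)"
    by (simp add: int(2)[of f])
  then show ?thesis
    by (simp add: value_fun_def f_def[abs_def])
qed

text \<open>The performance difference formula with an arbitrary function \<open>W\<close> as
  reference: the discounted expectations of \<open>W\<close> along the trajectory telescope.\<close>

lemma value_fun_defect:
  assumes \<zeta>: "\<zeta> \<in> policies M" and s: "s \<in> joint_states M" and \<gamma>: "0 < \<gamma>" "\<gamma> < 1"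
  shows "(\<lambda>t. \<gamma> ^ t * (\<Sum>x\<in>joint_states M. pmf (state_law M \<zeta> s t) x * (bellman M \<gamma> \<tau> \<zeta> W x - W x)))
    sums (value_fun M \<gamma> \<tau> \<zeta> s - W s)"
proof -
  let ?S = "joint_states M"
  define f where "f z = reward M (fst z) (snd z) - \<tau> * ln (pmf (joint_action_pmf M \<zeta> (fst z)) (snd z))" for z
  define b where "b t = measure_pmf.expectation (state_law M \<zeta> s t) W" for t
  have bb: "bellman M \<gamma> \<tau> \<zeta> W x = measure_pmf.expectation (joint_action_pmf M \<zeta> x) (\<lambda>a. f (x, a))
      + \<gamma> * measure_pmf.expectation (joint_action_pmf M \<zeta> x) (\<lambda>a. measure_pmf.expectation (transition M x a) W)"
    if "x \<in> ?S" for x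
  proof -
    have "finite (set_pmf (joint_action_pmf M \<zeta> x))"
      using finite_subset[OF set_joint_action_pmf[OF \<zeta> that] finite_joint_actions] .
    then show ?thesis
      by (simp add: bellman_def f_def integrable_measure_pmf_finite)
  qed
  have bS: "b (Suc t) = (\<Sum>x\<in>?S. pmf (state_law M \<zeta> s t) x *
      measure_pmf.expectation (joint_action_pmf M \<zeta> x) (\<lambda>a. measure_pmf.expectation (transition M x a) W))" for t
    unfolding b_def by (rule expectation_state_law_Suc[OF \<zeta> s])
  have "(\<Sum>x\<in>?S. pmf (state_law M \<zeta> s t) x * (bellman M \<gamma> \<tau> \<zeta> W x - W x))
      = measure_pmf.expectation (pair_law M \<zeta> s t) f + \<gamma> * b (Suc t) - b t" for t
    unfolding expectation_pair_law[OF \<zeta> s] bS unfolding b_def expectation_state_law[OF \<zeta> s]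
    by (simp add: bb sum_distrib_left sum.distrib[symmetric] sum_subtractf[symmetric] algebra_simps)
  note defect = this
  have eq: "\<gamma> ^ t * (\<Sum>x\<in>?S. pmf (state_law M \<zeta> s t) x * (bellman M \<gamma> \<tau> \<zeta> W x - W x))
      = \<gamma> ^ t * measure_pmf.expectation (pair_law M \<zeta> s t) f + (\<gamma> ^ Suc t * b (Suc t) - \<gamma> ^ t * b t)" for t
    unfolding defect by (simp add: algebra_simps)
  have "(\<lambda>t. \<gamma> ^ t * b t) \<longlonglongrightarrow> 0"
  proof -
    define B where "B = (\<Sum>x\<in>?S. \<bar>W x\<bar>)"
    have "\<bar>b t\<bar> \<le> B" for t
    proof -
      have "\<bar>b t\<bar> \<le> (\<Sum>x\<in>?S. \<bar>pmf (state_law M \<zeta> s t) x * W x\<bar>)"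
        unfolding b_def expectation_state_law[OF \<zeta> s] by (rule sum_abs)
      also have "\<dots> \<le> B"
        unfolding B_def by (intro sum_mono) (simp add: abs_mult pmf_le_1 mult_left_le_one_le)
      finally show ?thesis .
    qed
    then have bound: "norm (\<gamma> ^ t * b t) \<le> \<gamma> ^ t * B" for t
      using \<gamma> by (simp add: abs_mult mult_left_mono)
    have "(\<lambda>t. \<gamma> ^ t * B) \<longlonglongrightarrow> 0"
      using \<gamma> by (intro tendsto_mult_left_zero LIMSEQ_realpow_zero) auto
    then show ?thesis
      using bound by (rule Lim_null_comparison[OF always_eventually[OF allI], rotated])
  qed
  then have "(\<lambda>t. \<gamma> ^ Suc t * b (Suc t) - \<gamma> ^ t * b t) sums (0 - \<gamma> ^ 0 * b 0)"
    by (rule telescope_sums)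
  moreover have "b 0 = W s"
    by (simp add: b_def)
  ultimately have "(\<lambda>t. \<gamma> ^ t * measure_pmf.expectation (pair_law M \<zeta> s t) f + (\<gamma> ^ Suc t * b (Suc t) - \<gamma> ^ t * b t))
      sums (value_fun M \<gamma> \<tau> \<zeta> s + (0 - W s))"
    using value_fun_eq[OF \<zeta> s \<gamma>, of \<tau>] by (intro sums_add) (auto simp: f_def[abs_def])
  then show ?thesis
    by (simp only: eq) simp
qed

lemma sum_state_law_le:
  assumes "\<zeta> \<in> policies M" "s \<in> joint_states M" "\<And>x. x \<in> joint_states M \<Longrightarrow> g x \<le> c"
  shows "(\<Sum>x\<in>joint_states M. pmf (state_law M \<zeta> s t) x * g x) \<le> c"
proof -
  have "(\<Sum>x\<in>joint_states M. pmf (state_law M \<zeta> s t) x * g x) \<le> (\<Sum>x\<in>joint_states M. pmf (state_law M \<zeta> s t) x * c)"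
    using assms(3) by (intro sum_mono mult_left_mono) auto
  also have "\<dots> = c"
    using sum_pmf_eq_1[OF finite_joint_states set_state_law[OF assms(1,2)], of t]
    by (simp add: sum_distrib_right[symmetric])
  finally show ?thesis .
qed

lemma value_fun_le:
  assumes \<zeta>: "\<zeta> \<in> policies M" and s: "s \<in> joint_states M" and \<gamma>: "0 < \<gamma>" "\<gamma> < 1"
    and W: "\<And>x. x \<in> joint_states M \<Longrightarrow> bellman M \<gamma> \<tau> \<zeta> W x \<le> W x + e"
  shows "value_fun M \<gamma> \<tau> \<zeta> s \<le> W s + e / (1 - \<gamma>)"
proof -
  have "value_fun M \<gamma> \<tau> \<zeta> s - W s \<le> e / (1 - \<gamma>)"
  proof (rule sums_le[OF _ value_fun_defect[OF \<zeta> s \<gamma>]])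
    show "(\<lambda>t. \<gamma> ^ t * e) sums (e / (1 - \<gamma>))"
      using sums_mult2[OF geometric_sums[of \<gamma>], of e] \<gamma> by simp
    show "\<gamma> ^ t * (\<Sum>x\<in>joint_states M. pmf (state_law M \<zeta> s t) x * (bellman M \<gamma> \<tau> \<zeta> W x - W x)) \<le> \<gamma> ^ t * e" for t
      using W \<gamma> by (intro mult_left_mono sum_state_law_le[OF \<zeta> s]) (auto simp: algebra_simps)
  qed
  then show ?thesis
    by simp
qed

lemma value_fun_ge:
  assumes \<zeta>: "\<zeta> \<in> policies M" and s: "s \<in> joint_states M" and \<gamma>: "0 < \<gamma>" "\<gamma> < 1"
    and W: "\<And>x. x \<in> joint_states M \<Longrightarrow> W x - e \<le> bellman M \<gamma> \<tau> \<zeta> W x"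
  shows "W s - e / (1 - \<gamma>) \<le> value_fun M \<gamma> \<tau> \<zeta> s"
proof -
  have "- (value_fun M \<gamma> \<tau> \<zeta> s - W s) \<le> e / (1 - \<gamma>)"
  proof (rule sums_le[OF _ sums_minus[OF value_fun_defect[OF \<zeta> s \<gamma>]]])
    show "(\<lambda>t. \<gamma> ^ t * e) sums (e / (1 - \<gamma>))"
      using sums_mult2[OF geometric_sums[of \<gamma>], of e] \<gamma> by simp
    fix t
    have "(\<Sum>x\<in>joint_states M. pmf (state_law M \<zeta> s t) x * - (bellman M \<gamma> \<tau> \<zeta> W x - W x)) \<le> e"
      using W by (intro sum_state_law_le[OF \<zeta> s]) (auto simp: algebra_simps)
    then have "- (\<Sum>x\<in>joint_states M. pmf (state_law M \<zeta> s t) x * (bellman M \<gamma> \<tau> \<zeta> W x - W x)) \<le> e"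
      by (simp only: mult_minus_right sum_negf)
    then have "\<gamma> ^ t * - (\<Sum>x\<in>joint_states M. pmf (state_law M \<zeta> s t) x * (bellman M \<gamma> \<tau> \<zeta> W x - W x)) \<le> \<gamma> ^ t * e"
      using \<gamma> by (intro mult_left_mono) auto
    then show "- (\<gamma> ^ t * (\<Sum>x\<in>joint_states M. pmf (state_law M \<zeta> s t) x * (bellman M \<gamma> \<tau> \<zeta> W x - W x))) \<le> \<gamma> ^ t * e"
      by simp
  qed
  then show ?thesis
    by simp
qed

lemma objective_diff_le:
  assumes "\<And>s. s \<in> joint_states M \<Longrightarrow> value_fun M \<gamma> \<tau> \<zeta> s - value_fun M \<gamma> \<tau> \<zeta>' s \<le> c"
  shows "objective M \<gamma> \<tau> \<zeta> - objective M \<gamma> \<tau> \<zeta>' \<le> c"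
proof -
  have fin: "finite (set_pmf (init M))"
    using init_states finite_joint_states by (rule finite_subset)
  have "objective M \<gamma> \<tau> \<zeta> - objective M \<gamma> \<tau> \<zeta>'
      = measure_pmf.expectation (init M) (\<lambda>s. value_fun M \<gamma> \<tau> \<zeta> s - value_fun M \<gamma> \<tau> \<zeta>' s)"
    unfolding objective_def using fin by (simp add: integrable_measure_pmf_finite)
  also have "\<dots> \<le> measure_pmf.expectation (init M) (\<lambda>_. c)"
    using fin init_states assms
    by (intro integral_mono_AE integrable_measure_pmf_finite) (auto simp: AE_measure_pmf_iff)
  finally show ?thesis
    by simp
qed

end

section \<open>Near-optimal truncated policies\<close>

definition vec_pmf :: "'a set \<Rightarrow> ('a \<Rightarrow> real) \<Rightarrow> 'a pmf" where
  "vec_pmf A x = embed_pmf (\<lambda>a. if a \<in> A then x a else 0)"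

lemma pmf_vec_pmf:
  assumes "finite A" "prob_vec A x"
  shows "pmf (vec_pmf A x) a = (if a \<in> A then x a else 0)"
  unfolding vec_pmf_def
proof (rule pmf_embed_pmf)
  have "(\<integral>\<^sup>+a. ennreal (if a \<in> A then x a else 0) \<partial>count_space UNIV) = (\<Sum>a\<in>A. ennreal (if a \<in> A then x a else 0))"
    using assms(1) by (intro nn_integral_count_space') auto
  also have "\<dots> = ennreal (\<Sum>a\<in>A. x a)"
    using assms(2) by (subst sum_ennreal[symmetric]) (auto simp: prob_vec_def)
  finally show "(\<integral>\<^sup>+a. ennreal (if a \<in> A then x a else 0) \<partial>count_space UNIV) = 1"
    using assms(2) by (simp add: prob_vec_def)
qed (use assms in \<open>auto simp: prob_vec_def\<close>)

lemma set_vec_pmf: "finite A \<Longrightarrow> prob_vec A x \<Longrightarrow> set_pmf (vec_pmf A x) \<subseteq> A"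
  by (auto simp: set_pmf_iff pmf_vec_pmf split: if_splits)

lemma prob_vec_pmf: "finite A \<Longrightarrow> set_pmf p \<subseteq> A \<Longrightarrow> prob_vec A (pmf p)"
  by (simp add: prob_vec_def sum_pmf_eq_1)

lemma tv_dist_term: "\<bar>measure_pmf.prob p B - measure_pmf.prob q B\<bar> \<le> 1"
proof -
  have "measure_pmf.prob p B \<le> 1" "measure_pmf.prob q B \<le> 1" "0 \<le> measure_pmf.prob p B" "0 \<le> measure_pmf.prob q B"
    by auto
  then show ?thesis
    by linarith
qed

lemma tv_dist_ge: "\<bar>measure_pmf.prob p B - measure_pmf.prob q B\<bar> \<le> tv_dist p q"
  unfolding tv_dist_def by (rule cSUP_upper) (auto intro!: bdd_aboveI[of _ 1] tv_dist_term)

lemma tv_dist_le_1: "tv_dist p q \<le> 1"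
  unfolding tv_dist_def by (rule cSUP_least) (auto intro: tv_dist_term)

text \<open>The supremum over events is tested on the set \<open>B\<close> where \<open>p\<close>
  exceeds \<open>q\<close>. As both have mass 1 on \<open>A\<close>, the positive part of the
  difference carries half of its absolute sum.\<close>

lemma half_l1_le_tv_dist:
  assumes A: "finite A" and p: "set_pmf p \<subseteq> A" and q: "set_pmf q \<subseteq> A"
  shows "half_l1 A (pmf p) (pmf q) \<le> tv_dist p q"
proof -
  define B where "B = {a \<in> A. pmf q a < pmf p a}"
  have B: "finite B" "B \<subseteq> A"
    using A by (auto simp: B_def)
  have "(\<Sum>a\<in>A. \<bar>pmf p a - pmf q a\<bar>)
      = (\<Sum>a\<in>A. 2 * (if a \<in> B then pmf p a - pmf q a else 0) - (pmf p a - pmf q a))"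
    by (intro sum.cong) (auto simp: B_def)
  also have "\<dots> = 2 * (\<Sum>a\<in>A. if a \<in> B then pmf p a - pmf q a else 0) - (sum (pmf p) A - sum (pmf q) A)"
    by (simp add: sum_subtractf sum_distrib_left)
  also have "(\<Sum>a\<in>A. if a \<in> B then pmf p a - pmf q a else 0) = (\<Sum>a\<in>B. pmf p a - pmf q a)"
    using A B by (simp add: sum.If_cases Int_absorb1)
  also have "\<dots> = measure_pmf.prob p B - measure_pmf.prob q B"
    using B by (simp add: measure_measure_pmf_finite sum_subtractf)
  also have "sum (pmf p) A - sum (pmf q) A = 0"
    using A p q by (simp add: sum_pmf_eq_1)
  finally have "half_l1 A (pmf p) (pmf q) = measure_pmf.prob p B - measure_pmf.prob q B"
    by (simp add: half_l1_def)
  also have "\<dots> \<le> tv_dist p q"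
    using tv_dist_ge[of p B q] by linarith
  finally show ?thesis .
qed

lemma (in finite_family) expectation_Pi_pmf:
  fixes f :: "('i \<Rightarrow> 'a) \<Rightarrow> real"
  assumes "\<And>i. i \<in> I \<Longrightarrow> set_pmf (p i) \<subseteq> A i"
  shows "measure_pmf.expectation (Pi_pmf I undefined p) f = E (\<lambda>i. pmf (p i)) f"
proof -
  have "set_pmf (Pi_pmf I undefined p) \<subseteq> PiE I A"
    using assms finite_index by (fastforce simp: set_Pi_pmf PiE_dflt_def PiE_iff extensional_def)
  then have "measure_pmf.expectation (Pi_pmf I undefined p) f = (\<Sum>w\<in>PiE I A. f w * pmf (Pi_pmf I undefined p) w)"
    using finite_configs by (intro integral_measure_pmf_real) auto
  also have "\<dots> = E (\<lambda>i. pmf (p i)) f"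
    unfolding prod_expect_def using finite_index
    by (intro sum.cong) (auto simp: pmf_Pi PiE_iff extensional_def)
  finally show ?thesis .
qed

text \<open>The logarithm of the product splits where all factors are nonzero; elsewhere the weight
  of the configuration is 0.\<close>

lemma (in finite_family) E_ln_prod:
  assumes x: "x \<in> laws"
  shows "E x (\<lambda>w. ln (\<Prod>i\<in>I. x i (w i))) = - (\<Sum>i\<in>I. entropy (A i) (x i))"
proof -
  have "E x (\<lambda>w. ln (\<Prod>i\<in>I. x i (w i))) = E x (\<lambda>w. \<Sum>i\<in>I. ln (x i (w i)))"
    unfolding prod_expect_def
  proof (intro sum.cong refl)
    fix w assume w: "w \<in> PiE I A"
    show "(\<Prod>i\<in>I. x i (w i)) * ln (\<Prod>i\<in>I. x i (w i)) = (\<Prod>i\<in>I. x i (w i)) * (\<Sum>i\<in>I. ln (x i (w i)))"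
    proof (cases "\<exists>i\<in>I. x i (w i) = 0")
      case True
      then have "(\<Prod>i\<in>I. x i (w i)) = 0"
        using finite_index by (simp add: prod_zero_iff)
      then show ?thesis
        by simp
    next
      case False
      then have "ln (\<Prod>i\<in>I. x i (w i)) = (\<Sum>i\<in>I. ln (x i (w i)))"
        using finite_index by (intro ln_prod) auto
      then show ?thesis
        by simp
    qed
  qed
  also have "\<dots> = (\<Sum>i\<in>I. \<Sum>z\<in>A i. x i z * ln (x i z))"
    unfolding E_sum by (intro sum.cong refl E_marginal[OF _ x, where g = "\<lambda>z. ln (x _ z)"])
  finally show ?thesis
    by (simp add: entropy_def sum_negf)
qed

lemma (in mean_field) energy_cong_law:
  assumes "\<And>i a. i \<in> I \<Longrightarrow> a \<in> A i \<Longrightarrow> x i a = y i a"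
  shows "energy q x = energy q y"
  using E_cong_law[OF assms] assms by (simp add: energy_def entropy_def)

section \<open>The networked process as an instance of the abstract model\<close>

context networked_mdp
begin

definition next_law :: "(nat \<Rightarrow> 's) \<Rightarrow> (nat \<Rightarrow> 'a) \<Rightarrow> nat \<Rightarrow> 's \<Rightarrow> real" where
  "next_law s a i = pmf (kernel M i (restrict s (nbhd M 1 i)) (a i))"

lemma restrict_joint_states:
  "s \<in> joint_states M \<Longrightarrow> restrict s (nbhd M m i) \<in> partial_states M (nbhd M m i)"
  using nbhd_subset by (auto simp: joint_states_def partial_states_def)

lemma card_agents: "card (agents M) = num_agents M"
  by (simp add: agents_def)

lemma set_kernel:
  assumes "s \<in> joint_states M" "a \<in> PiE (agents M) (actions M)" "i \<in> agents M"
  shows "set_pmf (kernel M i (restrict s (nbhd M 1 i)) (a i)) \<subseteq> states M i"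
  using assms by (intro kernel_states restrict_joint_states) auto

lemma finite_family_states: "finite_family (agents M) (states M)"
  using finite_agents states_finite states_nonempty by unfold_locales

lemma finite_family_actions: "finite_family (agents M) (actions M)"
  using finite_agents actions_finite actions_nonempty by unfold_locales

lemma rbar_nonneg: "0 \<le> rbar"
proof -
  have "1 \<in> agents M"
    using agents_nonempty by (simp add: agents_def)
  moreover obtain x b where "x \<in> states M 1" "b \<in> actions M 1"
    using states_nonempty[OF calculation] actions_nonempty[OF calculation] by auto
  ultimately show ?thesis
    using reward_bounds[of 1 x b] by simp
qed

lemma bellman_eq_energy:
  assumes \<zeta>: "\<zeta> \<in> policies M" and x: "x \<in> joint_states M"
  shows "bellman M \<gamma> \<tau> \<zeta> W x =
    prod_expect (agents M) (actions M) (\<lambda>i. pmf (\<zeta> i x))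
      (\<lambda>a. reward M x a + \<gamma> * prod_expect (agents M) (states M) (next_law x a) W)
    + \<tau> * (\<Sum>i\<in>agents M. entropy (actions M i) (pmf (\<zeta> i x)))"
proof -
  interpret A: finite_family "agents M" "actions M"
    by (rule finite_family_actions)
  interpret St: finite_family "agents M" "states M"
    by (rule finite_family_states)
  let ?p = "\<lambda>i. pmf (\<zeta> i x)"
  have sup: "set_pmf (\<zeta> i x) \<subseteq> actions M i" if "i \<in> agents M" for i
    using \<zeta> x that by (auto simp: policies_def)
  then have laws: "?p \<in> A.laws"
    by (auto simp: A.laws_def intro!: prob_vec_pmf actions_finite)
  have "bellman M \<gamma> \<tau> \<zeta> W x = A.E ?p (\<lambda>a. reward M x a - \<tau> * ln (pmf (joint_action_pmf M \<zeta> x) a)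
      + \<gamma> * measure_pmf.expectation (transition M x a) W)"
    unfolding bellman_def joint_action_pmf_def by (rule A.expectation_Pi_pmf[OF sup])
  also have "\<dots> = A.E ?p (\<lambda>a. (reward M x a + \<gamma> * St.E (next_law x a) W) - \<tau> * ln (\<Prod>i\<in>agents M. ?p i (a i)))"
  proof (rule A.E_cong)
    fix a assume a: "a \<in> PiE (agents M) (actions M)"
    have "measure_pmf.expectation (transition M x a) W = St.E (next_law x a) W"
      unfolding transition_def next_law_def by (rule St.expectation_Pi_pmf[OF set_kernel[OF x a]])
    moreover have "pmf (joint_action_pmf M \<zeta> x) a = (\<Prod>i\<in>agents M. ?p i (a i))"
      using a finite_agents by (auto simp: joint_action_pmf_def pmf_Pi PiE_iff extensional_def)
    ultimately show "reward M x a - \<tau> * ln (pmf (joint_action_pmf M \<zeta> x) a)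
        + \<gamma> * measure_pmf.expectation (transition M x a) W
      = (reward M x a + \<gamma> * St.E (next_law x a) W) - \<tau> * ln (\<Prod>i\<in>agents M. ?p i (a i))"
      by simp
  qed
  also have "\<dots> = A.E ?p (\<lambda>a. reward M x a + \<gamma> * St.E (next_law x a) W) - \<tau> * A.E ?p (\<lambda>a. ln (\<Prod>i\<in>agents M. ?p i (a i)))"
    unfolding A.E_diff A.E_cmult ..
  finally show ?thesis
    by (simp add: A.E_ln_prod[OF laws])
qed

lemma interaction_nonneighbour: "j \<notin> nbhd M 1 i \<Longrightarrow> interaction M i j = 0"
  by (simp add: interaction_def)

text \<open>For \<open>k \<noteq> i\<close> the change at \<open>k\<close> reaches agent
  \<open>i\<close> through the state only, for \<open>k = i\<close> through state and action; this
  matches the two kinds of entries of the interaction matrix. The suprema are bounded because total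
  variation is at most 1.\<close>

lemma next_law_influence:
  assumes s: "s \<in> joint_states M" and a: "a \<in> PiE (agents M) (actions M)" and i: "i \<in> agents M" and k: "k \<in> agents M"
    and x: "x \<in> states M k" and b: "b \<in> actions M k"
  shows "half_l1 (states M i) (next_law s a i) (next_law (s(k := x)) (a(k := b)) i) \<le> interaction M i k"
proof (cases "k \<in> nbhd M 1 i")
  case False
  then have "k \<noteq> i"
    using nbhd_refl[OF i] by auto
  moreover have "restrict (s(k := x)) (nbhd M 1 i) = restrict s (nbhd M 1 i)"
    using False by (auto simp: restrict_def)
  ultimately show ?thesis
    using False by (simp add: next_law_def interaction_nonneighbour)
next
  case True
  let ?u = "restrict s (nbhd M 1 i)"
  have u: "?u \<in> partial_states M (nbhd M 1 i)"
    using s by (rule restrict_joint_states)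
  have r: "restrict (s(k := x)) (nbhd M 1 i) = ?u(k := x)" "?u = ?u(k := s k)"
    using True by (auto simp: restrict_def)
  have sk: "s k \<in> states M k" and ai: "a i \<in> actions M i"
    using s a k i by (auto simp: joint_states_def partial_states_def)
  have s': "s(k := x) \<in> joint_states M" and a': "a(k := b) \<in> PiE (agents M) (actions M)"
    using s a k x b by (auto simp: joint_states_def partial_states_def PiE_iff extensional_def)
  have "half_l1 (states M i) (next_law s a i) (next_law (s(k := x)) (a(k := b)) i)
      \<le> tv_dist (kernel M i (restrict s (nbhd M 1 i)) (a i)) (kernel M i (restrict (s(k := x)) (nbhd M 1 i)) ((a(k := b)) i))"
    unfolding next_law_def using i by (intro half_l1_le_tv_dist states_finite set_kernel s a s' a')
  also have "\<dots> = tv_dist (kernel M i (?u(k := s k)) (a i)) (kernel M i (?u(k := x)) ((a(k := b)) i))"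
    using r by simp
  also have "\<dots> \<le> interaction M i k"
  proof (cases "k = i")
    case False
    let ?f = "\<lambda>(u, x, x', b). tv_dist (kernel M i (u(k := x)) b) (kernel M i (u(k := x')) b)"
    have "?f (?u, s k, x, a i) \<le> (SUP z \<in> partial_states M (nbhd M 1 i) \<times> states M k \<times> states M k \<times> actions M i. ?f z)"
      using u sk x ai by (intro cSUP_upper) (auto intro!: bdd_aboveI[of _ 1] tv_dist_le_1)
    then show ?thesis
      using True False by (simp add: interaction_def)
  next
    case ki: True
    let ?f = "\<lambda>(u, x, x', b, b'). tv_dist (kernel M i (u(i := x)) b) (kernel M i (u(i := x')) b')"
    have "?f (?u, s i, x, a i, b) \<le> (SUP z \<in> partial_states M (nbhd M 1 i) \<times> states M i \<times> states M i \<times> actions M i \<times> actions M i. ?f z)"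
      using u sk x ai b ki by (intro cSUP_upper) (auto intro!: bdd_aboveI[of _ 1] tv_dist_le_1)
    then show ?thesis
      using True ki by (simp add: interaction_def)
  qed
  finally show ?thesis .
qed

text \<open>Capping only shrinks distances, so agreement within capped distance 1 covers the
  neighbourhood on which the kernel depends, whatever the cap \<open>L\<close>.\<close>

lemma networked_decay_mdp:
  assumes \<tau>: "0 < \<tau>" and \<gamma>: "0 < \<gamma>" "\<gamma> < 1" and \<eta>: "0 < \<eta>" "\<eta> \<le> 1"
    and row: "\<And>i. i \<in> agents M \<Longrightarrow> 2 * (\<Sum>j\<in>nbhd M 1 i. interaction M i j) \<le> \<eta>"
  shows "decay_mdp (agents M) (actions M) \<tau> (states M) (hops L) \<eta> next_law (interaction M) (local_reward M) rbar \<gamma>"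
proof -
  interpret A: finite_family "agents M" "actions M"
    by (rule finite_family_actions)
  interpret St: finite_family "agents M" "states M"
    by (rule finite_family_states)
  have js: "joint_states M = PiE (agents M) (states M)"
    by (simp add: joint_states_def partial_states_def)
  show ?thesis
  proof
    show "agents M \<noteq> {}"
      using agents_nonempty by (simp add: agents_def)
    show "next_law s a \<in> St.laws" if "s \<in> PiE (agents M) (states M)" "a \<in> PiE (agents M) (actions M)" for s a
      using that set_kernel[of s a] by (auto simp: St.laws_def next_law_def js intro!: prob_vec_pmf states_finite)
    show "half_l1 (states M i) (next_law s a i) (next_law (s(k := x)) (a(k := b)) i) \<le> interaction M i k"
      if "s \<in> PiE (agents M) (states M)" "a \<in> PiE (agents M) (actions M)" "i \<in> agents M" "k \<in> agents M"
        "x \<in> states M k" "b \<in> actions M k" for s a i k x b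
      using that by (intro next_law_influence) (auto simp: js)
    show "next_law s a i = next_law s' a' i"
      if "i \<in> agents M" "\<And>j. j \<in> agents M \<Longrightarrow> hops L i j \<le> 1 \<Longrightarrow> s j = s' j" "a i = a' i" for s s' a a' i
    proof -
      have "restrict s (nbhd M 1 i) = restrict s' (nbhd M 1 i)"
        using that(2) hops_le_nbhd[of _ 1 i L] nbhd_subset by (intro restrict_ext) blast
      then show ?thesis
        using that(3) by (simp add: next_law_def)
    qed
    show "2 * (\<Sum>k\<in>agents M. interaction M i k) \<le> \<eta>" if "i \<in> agents M" for i
    proof -
      have "(\<Sum>k\<in>agents M. interaction M i k) = (\<Sum>k\<in>nbhd M 1 i. interaction M i k)"
        using finite_agents nbhd_subset by (intro sum.mono_neutral_right) (auto simp: interaction_nonneighbour)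
      with row[OF that] show ?thesis
        by simp
    qed
    show "0 \<le> local_reward M i x b \<and> local_reward M i x b \<le> rbar"
      if "i \<in> agents M" "x \<in> states M i" "b \<in> actions M i" for i x b
      using reward_bounds[OF that] by simp
  qed (use \<tau> \<gamma> \<eta> hops_refl hops_sym hops_triangle in auto)
qed

text \<open>Without rewards only entropy counts. The constant \<open>c\<close> solves the Bellman
  equation exactly, and it is attained by a policy that ignores the state and hence is
  \<open>\<kappa>\<close>-hop for every \<open>\<kappa>\<close>.\<close>

lemma zero_reward_optimal_policy:
  assumes \<tau>: "0 < \<tau>" and \<gamma>: "0 < \<gamma>" "\<gamma> < 1" and R: "rbar = 0"
    and \<zeta>: "\<zeta> \<in> policies M"
  shows "\<exists>\<zeta>'\<in>khop_policies M \<kappa>. objective M \<gamma> \<tau> \<zeta> - objective M \<gamma> \<tau> \<zeta>' \<le> 0"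
proof -
  interpret mean_field "agents M" "actions M" \<tau>
    using finite_family_actions \<tau> by (simp add: mean_field_def mean_field_axioms_def)
  interpret St: finite_family "agents M" "states M"
    by (rule finite_family_states)
  have js: "joint_states M = PiE (agents M) (states M)"
    by (simp add: joint_states_def partial_states_def)
  define c where "c = opt_val (\<lambda>_. 0) / (1 - \<gamma>)"
  have c: "\<gamma> * c + opt_val (\<lambda>_. 0) = c"
    using \<gamma> by (simp add: c_def field_simps)
  define \<zeta>' :: "('s, 'a) joint_policy" where "\<zeta>' = (\<lambda>i _. vec_pmf (actions M i) (opt_law (\<lambda>_. 0) i))"
  have vec: "prob_vec (actions M i) (opt_law (\<lambda>_. 0) i)" if "i \<in> agents M" for i
    using opt_law_laws that by (auto simp: laws_def)
  then have pol: "\<zeta>' \<in> policies M"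
    unfolding policies_def \<zeta>'_def using set_vec_pmf[OF actions_finite] by fastforce
  then have khop: "\<zeta>' \<in> khop_policies M \<kappa>"
    by (simp add: khop_policies_def \<zeta>'_def)
  have bell: "bellman M \<gamma> \<tau> \<xi> (\<lambda>_. c) x = \<gamma> * c + energy (\<lambda>_. 0) (\<lambda>i. pmf (\<xi> i x))" and
    laws: "(\<lambda>i. pmf (\<xi> i x)) \<in> laws"
    if \<xi>: "\<xi> \<in> policies M" and x: "x \<in> joint_states M" for \<xi> x
  proof -
    show laws: "(\<lambda>i. pmf (\<xi> i x)) \<in> laws"
      using \<xi> x by (auto simp: laws_def policies_def intro!: prob_vec_pmf actions_finite)
    have "E (\<lambda>i. pmf (\<xi> i x)) (\<lambda>a. reward M x a + \<gamma> * St.E (next_law x a) (\<lambda>_. c)) = E (\<lambda>i. pmf (\<xi> i x)) (\<lambda>_. \<gamma> * c)"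
    proof (rule E_cong)
      fix a assume a: "a \<in> PiE (agents M) (actions M)"
      have "local_reward M i (x i) (a i) = 0" if "i \<in> agents M" for i
        using reward_bounds[OF that, of "x i" "a i"] x a that R by (auto simp: js)
      then have "reward M x a = 0"
        by (simp add: reward_def)
      moreover have "next_law x a \<in> St.laws"
        using set_kernel[OF x a] by (auto simp: St.laws_def next_law_def intro!: prob_vec_pmf states_finite)
      ultimately show "reward M x a + \<gamma> * St.E (next_law x a) (\<lambda>_. c) = \<gamma> * c"
        by (simp add: St.E_const)
    qed
    moreover have "E (\<lambda>i. pmf (\<xi> i x)) (\<lambda>_. 0) = 0"
      by (rule E_const[OF laws])
    ultimately show "bellman M \<gamma> \<tau> \<xi> (\<lambda>_. c) x = \<gamma> * c + energy (\<lambda>_. 0) (\<lambda>i. pmf (\<xi> i x))"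
      by (simp add: bellman_eq_energy[OF \<xi> x] energy_def E_const[OF laws])
  qed
  have "value_fun M \<gamma> \<tau> \<zeta> s - value_fun M \<gamma> \<tau> \<zeta>' s \<le> 0" if s: "s \<in> joint_states M" for s
  proof -
    have "value_fun M \<gamma> \<tau> \<zeta> s \<le> c + 0 / (1 - \<gamma>)"
    proof (rule value_fun_le[OF \<zeta> s \<gamma>])
      fix x assume x: "x \<in> joint_states M"
      show "bellman M \<gamma> \<tau> \<zeta> (\<lambda>_. c) x \<le> c + 0"
        using energy_le_opt_val[OF laws[OF \<zeta> x], of "\<lambda>_. 0"] c by (simp add: bell[OF \<zeta> x])
    qed
    moreover have "c - 0 / (1 - \<gamma>) \<le> value_fun M \<gamma> \<tau> \<zeta>' s"
    proof (rule value_fun_ge[OF pol s \<gamma>])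
      fix x assume x: "x \<in> joint_states M"
      have "energy (\<lambda>_. 0) (\<lambda>i. pmf (\<zeta>' i x)) = opt_val (\<lambda>_. 0)"
        unfolding opt_val_def by (rule energy_cong_law) (simp add: \<zeta>'_def pmf_vec_pmf actions_finite vec)
      then show "c - 0 \<le> bellman M \<gamma> \<tau> \<zeta>' (\<lambda>_. c) x"
        using c by (simp add: bell[OF pol x])
    qed
    ultimately show ?thesis
      by simp
  qed
  then show ?thesis
    using khop by (intro bexI[of _ \<zeta>'] objective_diff_le)
qed

text \<open>The error budget \<open>B\<close> is split into three fifths for the truncation and one
  fifth for the residual of \<open>W\<close> under each of the two policies. The tolerance
  \<open>B / 5\<close> is positive because \<open>0 < rbar\<close>.\<close>

lemma near_optimal_khop_policy:
  assumes \<tau>: "0 < \<tau>" and discount: "0 < \<gamma>" "\<gamma> < 4 / 5" and \<eta>: "0 < \<eta>" "\<eta> \<le> 1"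
    and row: "\<And>i. i \<in> agents M \<Longrightarrow> 2 * (\<Sum>j\<in>nbhd M 1 i. interaction M i j) \<le> \<eta>"
    and K: "K = (4 - 3 * \<gamma>) / (4 - 5 * \<gamma>)" and R: "0 < rbar" "12 * (rbar * K) \<le> \<tau>"
    and \<zeta>: "\<zeta> \<in> policies M"
  shows "\<exists>\<zeta>'\<in>khop_policies M \<kappa>. objective M \<gamma> \<tau> \<zeta> - objective M \<gamma> \<tau> \<zeta>'
    \<le> rbar * K * decay \<eta> (\<kappa> + 1) / (1 - \<gamma>)"
proof -
  have \<gamma>1: "\<gamma> < 1"
    using discount by simp
  \<comment> \<open>With this cap, the agents at the maximal distance from \<open>i\<close> are
    exactly those that agent \<open>i\<close> may not observe.\<close>
  interpret decay_mdp "agents M" "actions M" \<tau> "states M" "hops (\<kappa> + 1)" \<eta> next_law "interaction M" "local_reward M" rbar \<gamma>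
    using \<tau> discount \<eta> row by (intro networked_decay_mdp) auto
  have js: "joint_states M = PiE (agents M) (states M)"
    by (simp add: joint_states_def partial_states_def)
  define B where "B = rbar * K * decay \<eta> (\<kappa> + 1)"
  have "0 < K"
    using discount by (simp add: K)
  then have B: "0 < B"
    unfolding B_def using R \<eta> by (simp add: decay_pos)
  have "0 < B / 5"
    using B by simp
  from near_optimal_truncation[OF K discount(2) R(2) this, of "\<kappa> + 1", folded B_def]
  obtain W where W1: "\<forall>s\<in>PiE (agents M) (states M). \<forall>x\<in>laws. energy (qfun W s) x \<le> W s + B / 5"
    and W2: "\<forall>s\<in>PiE (agents M) (states M). \<forall>\<sigma>.
      (\<forall>i\<in>agents M. \<sigma> i \<in> PiE (agents M) (states M) \<and> (\<forall>j\<in>agents M. hops (\<kappa> + 1) i j < \<kappa> + 1 \<longrightarrow> s j = \<sigma> i j)) \<longrightarrow>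
      W s - (3 / 5 * B + B / 5) \<le> energy (qfun W s) (\<lambda>i. opt_law (qfun W (\<sigma> i)) i)"
    by (elim exE conjE)
  have bell: "bellman M \<gamma> \<tau> \<xi> W x = energy (qfun W x) (\<lambda>i. pmf (\<xi> i x))"
    if \<xi>: "\<xi> \<in> policies M" and x: "x \<in> joint_states M" for \<xi> x
  proof -
    have "reward M x a = avg_reward x a" for a
      by (simp add: reward_def avg_reward_def card_agents)
    then show ?thesis
      by (simp add: bellman_eq_energy[OF \<xi> x] energy_def qfun_def[abs_def])
  qed
  obtain s0 where s0: "s0 \<in> PiE (agents M) (states M)"
    using St.configs_nonempty by auto
  \<comment> \<open>Unobserved coordinates are filled from an arbitrary fixed state; the truncation
    estimate is uniform in the filling.\<close>
  define trunc where "trunc i s = (\<lambda>j\<in>agents M. if j \<in> nbhd M \<kappa> i then s j else s0 j)" for i s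
  have trunc: "trunc i s \<in> PiE (agents M) (states M)" if "s \<in> PiE (agents M) (states M)" for i s
    using that s0 by (auto simp: trunc_def)
  define \<zeta>' :: "('s, 'a) joint_policy" where
    "\<zeta>' = (\<lambda>i s. vec_pmf (actions M i) (opt_law (qfun W (trunc i s)) i))"
  have vec: "prob_vec (actions M i) (opt_law q i)" if "i \<in> agents M" for i q
    using opt_law_laws[of q] that by (auto simp: laws_def)
  then have pol: "\<zeta>' \<in> policies M"
    unfolding policies_def \<zeta>'_def using set_vec_pmf[OF actions_finite] by fastforce
  have "trunc i s = trunc i s'" if eq: "restrict s (nbhd M \<kappa> i) = restrict s' (nbhd M \<kappa> i)" for i s s'
  proof -
    have "s j = s' j" if "j \<in> nbhd M \<kappa> i" for j
      using fun_cong[OF eq, of j] that by simp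
    then show ?thesis
      by (auto simp: trunc_def)
  qed
  then have "\<zeta>' i s = \<zeta>' i s'" if "restrict s (nbhd M \<kappa> i) = restrict s' (nbhd M \<kappa> i)" for i s s'
    unfolding \<zeta>'_def using that by metis
  then have khop: "\<zeta>' \<in> khop_policies M \<kappa>"
    unfolding khop_policies_def using pol by blast
  have "value_fun M \<gamma> \<tau> \<zeta> s - value_fun M \<gamma> \<tau> \<zeta>' s \<le> B / (1 - \<gamma>)" if s: "s \<in> joint_states M" for s
  proof -
    have "value_fun M \<gamma> \<tau> \<zeta> s \<le> W s + B / 5 / (1 - \<gamma>)"
    proof (rule value_fun_le[OF \<zeta> s discount(1) \<gamma>1])
      fix x assume x: "x \<in> joint_states M"
      have "(\<lambda>i. pmf (\<zeta> i x)) \<in> laws"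
        using \<zeta> x by (auto simp: laws_def policies_def intro!: prob_vec_pmf actions_finite)
      then show "bellman M \<gamma> \<tau> \<zeta> W x \<le> W x + B / 5"
        using x W1 by (simp add: bell[OF \<zeta> x] js)
    qed
    moreover have "W s - (3 / 5 * B + B / 5) / (1 - \<gamma>) \<le> value_fun M \<gamma> \<tau> \<zeta>' s"
    proof (rule value_fun_ge[OF pol s discount(1) \<gamma>1])
      fix x assume x: "x \<in> joint_states M"
      have "energy (qfun W x) (\<lambda>i. pmf (\<zeta>' i x)) = energy (qfun W x) (\<lambda>i. opt_law (qfun W (trunc i x)) i)"
        by (rule energy_cong_law) (simp add: \<zeta>'_def pmf_vec_pmf actions_finite vec)
      moreover have "x j = trunc i x j" if "i \<in> agents M" "j \<in> agents M" "hops (\<kappa> + 1) i j < \<kappa> + 1" for i j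
        using that hops_less_nbhd[of "\<kappa> + 1" i j \<kappa>] by (simp add: trunc_def)
      ultimately show "W x - (3 / 5 * B + B / 5) \<le> bellman M \<gamma> \<tau> \<zeta>' W x"
        using x W2[THEN bspec, of x, THEN spec, of "\<lambda>i. trunc i x"] trunc by (simp add: bell[OF pol x] js)
    qed
    ultimately have "value_fun M \<gamma> \<tau> \<zeta> s - value_fun M \<gamma> \<tau> \<zeta>' s \<le> B / 5 / (1 - \<gamma>) + (3 / 5 * B + B / 5) / (1 - \<gamma>)"
      by linarith
    also have "\<dots> = (B / 5 + (3 / 5 * B + B / 5)) / (1 - \<gamma>)"
      by (rule add_divide_distrib[symmetric])
    also have "B / 5 + (3 / 5 * B + B / 5) = B"
      by simp
    finally show ?thesis .
  qed
  then show ?thesis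
    using khop unfolding B_def by (intro bexI[of _ \<zeta>'] objective_diff_le)
qed

end

text \<open>Negating the exponent turns a minimum of logarithms into the logarithm of the maximum of
  the inverted quotients. For \<open>c = 0\<close> the second logarithm is infinite and the maximum
  is \<open>b / a > 0\<close>, so the power stays finite.\<close>

lemma inverse_power_min_log2_quotient:
  assumes "1 \<le> x" "0 < a" "0 < b" "0 \<le> c"
  shows "inverse_power x (min (log2_quotient a b) (log2_quotient 1 c)) = x powr log 2 (max (b / a) c)"
proof (cases "c = 0")
  case True
  have "- log 2 (a / b) = log 2 (b / a)"
    using assms by (simp add: log_divide)
  then show ?thesis
    using True assms by (simp add: inverse_power_def log2_quotient_def powr_minus_divide[symmetric])
next
  case False
  with assms have c: "0 < c"
    by simp
  have "- min (log 2 (a / b)) (log 2 (1 / c)) = max (log 2 (b / a)) (log 2 c)"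
    using assms c by (simp add: log_divide min_def max_def)
  also have "\<dots> = log 2 (max (b / a) c)"
    using assms c by (simp add: max_def)
  finally have *: "- min (log 2 (a / b)) (log 2 (1 / c)) = log 2 (max (b / a) c)" .
  have "min (log2_quotient a b) (log2_quotient 1 c) = ereal (min (log 2 (a / b)) (log 2 (1 / c)))"
    using False assms by (simp add: log2_quotient_def ereal_min)
  then show ?thesis
    unfolding *[symmetric] by (simp only: inverse_power_def real_of_ereal.simps powr_minus_divide PInfty_neq_ereal if_False)
qed

theorem theorem1:
  fixes M :: "('s, 'a) nmdp"
    and rbar \<gamma> \<tau> :: real
    and \<zeta>opt :: "('s, 'a) joint_policy"
    and \<kappa> :: nat
    and \<mu> :: ereal
  assumes mdp: "networked_mdp M rbar"
    and gamma: "0 < \<gamma>" "\<gamma> < 0.8"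
    and tau: "0 < \<tau>"
      "\<tau> \<ge> 6 * rbar * ((4 - 3 * \<gamma>) / (4 - 5 * \<gamma>)) * (real (max_actions M))\<^sup>2 * exp 1"
    and interaction: "\<forall>i\<in>agents M. (\<Sum>j\<in>nbhd M 1 i. interaction M i j) < 1 / 2"
    and opt: "\<zeta>opt \<in> policies M"
      "\<forall>\<zeta>\<in>policies M. objective M \<gamma> \<tau> \<zeta> \<le> objective M \<gamma> \<tau> \<zeta>opt"
    and kappa: "\<kappa> \<ge> 1"
    and mu: "\<mu> = min
      (log2_quotient (\<tau> * (4 - 5 * \<gamma>))
         (6 * rbar * (real (max_actions M))\<^sup>2 * exp 1 * (4 - 3 * \<gamma>)))
      (log2_quotient 1
         (2 * (SUP i\<in>agents M. \<Sum>j\<in>nbhd M 1 i. interaction M i j)))"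
  shows "\<exists>\<zeta>hat\<in>khop_policies M \<kappa>.
    objective M \<gamma> \<tau> \<zeta>opt - objective M \<gamma> \<tau> \<zeta>hat
      \<le> rbar * (4 - 3 * \<gamma>) / ((1 - \<gamma>) * (4 - 5 * \<gamma>)) * inverse_power (real \<kappa> + 1) \<mu>"
proof -
  interpret networked_mdp M rbar
    by (rule mdp)
  have \<gamma>: "\<gamma> < 4 / 5" "\<gamma> < 1"
    using gamma by auto
  have agents: "agents M \<noteq> {}"
    using agents_nonempty by (simp add: agents_def)
  show ?thesis
  \<comment> \<open>For zero rewards the bound is 0 and leaves no room for approximation.\<close>
  proof (cases "rbar = 0")
    case True
    then show ?thesis
      using zero_reward_optimal_policy[OF tau(1) gamma(1) \<gamma>(2) True opt(1)] by simp
  next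
    case False
    then have R: "0 < rbar"
      using rbar_nonneg by simp
    define K where "K = (4 - 3 * \<gamma>) / (4 - 5 * \<gamma>)"
    define b where "b = 6 * rbar * (real (max_actions M))\<^sup>2 * exp 1 * (4 - 3 * \<gamma>)"
    define c where "c = 2 * (SUP i\<in>agents M. \<Sum>j\<in>nbhd M 1 i. interaction M i j)"
    \<comment> \<open>This is \<open>2 powr - \<mu>\<close>. The first argument of
      \<open>max\<close> is positive, which keeps \<open>\<eta> > 0\<close> even in the absence of
      interaction.\<close>
    define \<eta> where "\<eta> = max (b / (\<tau> * (4 - 5 * \<gamma>))) c"
    have mu': "\<mu> = min (log2_quotient (\<tau> * (4 - 5 * \<gamma>)) b) (log2_quotient 1 c)"
      unfolding b_def c_def by (rule mu)
    have K: "0 < K"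
      using \<gamma> by (simp add: K_def)
    have A: "1 \<le> real (max_actions M)"
    proof -
      obtain i where i: "i \<in> agents M"
        using agents by auto
      then have "1 \<le> card (actions M i)"
        using actions_finite[OF i] actions_nonempty[OF i] by (simp add: Suc_le_eq card_gt_0_iff)
      also have "\<dots> \<le> max_actions M"
        unfolding max_actions_def using i finite_agents by (intro Max_ge) auto
      finally show ?thesis
        by simp
    qed
    then have A2: "1 \<le> (real (max_actions M))\<^sup>2"
      by (simp add: one_le_power)
    have e: "2 \<le> exp (1::real)"
      using exp_ge_add_one_self[of "1::real"] by simp
    \<comment> \<open>The factors \<open>(real (max_actions M))\<^sup>2 \<ge> 1\<close> and
      \<open>exp 1 \<ge> 2\<close> turn the 6 of the hypothesis into the 12 on which the invariant
      of the iteration rests.\<close>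
    have RK: "12 * (rbar * K) \<le> \<tau>"
    proof -
      have "6 * (rbar * K) * (1 * 2) \<le> 6 * (rbar * K) * ((real (max_actions M))\<^sup>2 * exp 1)"
        using R K A2 e by (intro mult_left_mono mult_mono) auto
      also have "\<dots> \<le> \<tau>"
        using tau(2) by (simp add: K_def mult.assoc)
      finally show ?thesis
        by simp
    qed
    have b: "0 < b"
      unfolding b_def using R A \<gamma> by (intro mult_pos_pos) auto
    have fin: "finite ((\<lambda>i. \<Sum>j\<in>nbhd M 1 i. interaction M i j) ` agents M)"
      using finite_agents by simp
    have row: "2 * (\<Sum>j\<in>nbhd M 1 i. interaction M i j) \<le> c" if "i \<in> agents M" for i
      unfolding c_def using that fin by (intro mult_left_mono cSUP_upper bdd_above_finite) auto
    have c1: "c \<le> 1"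
      unfolding c_def using agents interaction cSUP_least[of "agents M" "\<lambda>i. \<Sum>j\<in>nbhd M 1 i. interaction M i j" "1 / 2"]
      by (simp add: less_imp_le)
    \<comment> \<open>Overwriting a configuration by its own values shows that the entries of the
      interaction matrix are nonnegative.\<close>
    have c0: "0 \<le> c"
    proof -
      obtain i where i: "i \<in> agents M"
        using agents by auto
      obtain s a where "s \<in> joint_states M" "a \<in> PiE (agents M) (actions M)"
        using finite_family.configs_nonempty[OF finite_family_states] finite_family.configs_nonempty[OF finite_family_actions]
        by (auto simp: joint_states_def partial_states_def)
      then have "half_l1 (states M i) (next_law s a i) (next_law (s(k := s k)) (a(k := a k)) i) \<le> interaction M i k"
        if "k \<in> agents M" for k
        using i that by (intro next_law_influence) (auto simp: joint_states_def partial_states_def)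
      then have "0 \<le> interaction M i k" if "k \<in> nbhd M 1 i" for k
        using that nbhd_subset order_trans[OF half_l1_nonneg] by blast
      then have "0 \<le> 2 * (\<Sum>j\<in>nbhd M 1 i. interaction M i j)"
        by (simp add: sum_nonneg)
      with row[OF i] show ?thesis
        by linarith
    qed
    have \<tau>5: "0 < \<tau> * (4 - 5 * \<gamma>)"
      using tau \<gamma> by simp
    have "b = 6 * rbar * K * (real (max_actions M))\<^sup>2 * exp 1 * (4 - 5 * \<gamma>)"
      using \<gamma> by (simp add: b_def K_def)
    also have "\<dots> \<le> \<tau> * (4 - 5 * \<gamma>)"
      using tau(2) \<gamma> by (intro mult_right_mono) (auto simp: K_def)
    finally have "b / (\<tau> * (4 - 5 * \<gamma>)) \<le> 1"
      using \<tau>5 by (simp add: pos_divide_le_eq)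
    then have \<eta>: "0 < \<eta>" "\<eta> \<le> 1"
      using b \<tau>5 c1 by (auto simp: \<eta>_def less_max_iff_disj)
    have "2 * (\<Sum>j\<in>nbhd M 1 i. interaction M i j) \<le> \<eta>" if "i \<in> agents M" for i
      using row[OF that] unfolding \<eta>_def by (rule max.coboundedI2)
    from near_optimal_khop_policy[OF tau(1) gamma(1) \<gamma>(1) \<eta> this K_def R RK opt(1), of \<kappa>]
    obtain \<zeta>hat where \<zeta>hat: "\<zeta>hat \<in> khop_policies M \<kappa>"
      "objective M \<gamma> \<tau> \<zeta>opt - objective M \<gamma> \<tau> \<zeta>hat \<le> rbar * K * decay \<eta> (\<kappa> + 1) / (1 - \<gamma>)"
      by blast
    note \<zeta>hat(2)
    also have "rbar * K * decay \<eta> (\<kappa> + 1) / (1 - \<gamma>) \<le> rbar * K * (real (\<kappa> + 1) powr log 2 \<eta>) / (1 - \<gamma>)"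
      using R K \<gamma> \<eta> by (intro divide_right_mono mult_left_mono decay_le_powr) auto
    also have "real (\<kappa> + 1) powr log 2 \<eta> = inverse_power (real \<kappa> + 1) \<mu>"
      unfolding mu' \<eta>_def using inverse_power_min_log2_quotient[OF _ \<tau>5 b c0, of "real \<kappa> + 1"]
      by (simp add: add.commute)
    also have "rbar * K * inverse_power (real \<kappa> + 1) \<mu> / (1 - \<gamma>)
        = rbar * (4 - 3 * \<gamma>) / ((1 - \<gamma>) * (4 - 5 * \<gamma>)) * inverse_power (real \<kappa> + 1) \<mu>"
      by (simp add: K_def mult.commute)
    finally show ?thesis
      using \<zeta>hat(1) by blast
  qed
qed

end
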